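(* Let $A$ be an invariant algebra on a compact Hausdorff group $G$. The mapping $R:\varphi\mapsto R_\varphi$ is a topological isomorphism between the semigroups $\mathcal{M}_A$ and $\mathfrak{M}_A$. For each $\varphi\in\mathcal{M}_A$, the operator $R_\varphi$ admits a unique continuous extension to $H^2$. This defines a ${}^*$-representation $R$ of $\mathcal{M}_A$ in $H^2$ (that is, $R_{\varphi^*}=R_\varphi^*$, the Hilbert space adjoint, for all $\varphi\in\mathcal{M}_A$) that realizes a homeomorphic and isomorphic embedding of $\mathcal{M}_A$ into $\mathrm{BL}(H^2)$ with the strong operator topology.
   Context: $C(G)$ is the Banach algebra of continuous complex functions on $G$ with the sup-norm. Translations: $L_gf(h)=f(gh)$, $R_gf(h)=f(hg)$. An invariant algebra on $G$ is a closed subalgebra $A\subseteq C(G)$ that contains the constants and satisfies $L_gA\subseteq A$, $R_gA\subseteq A$ for all $g\in G$. $H^2$ is the closure of $A$ in $L^2(G)$ (Haar measure). $\mathrm{BL}(X)$ is the space of bounded linear operators in $X$. $\mathcal{M}_A$ is the set of all nonzero multiplicative linear functionals on $A$ with the weak-* topology. It is a semigroup under convolution: $(\varphi*\psi)(f)=\int_{G\times G}f(gh)\,d\mu(g)\,d\nu(h)$ for any finite regular Borel complex measures $\mu,\nu$ on $G$ extending $\varphi,\psi$ from $A$ to $C(G)$ (independent of the choice). Involution: $\varphi^*(f)=\overline{\varphi(f^\star)}$ where $f^\star(g)=\overline{f(g^{-1})}$ (one has $A^\star=A$). For $\varphi\in A'$, $R_\varphi:A\to A$ is the unique continuous linear operator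 with $\psi(R_\varphi f)=(\psi*\varphi)(f)$ for all $\psi\in A'$, $f\in A$; explicitly $R_\varphi f(g)=\varphi(L_gf)$, and $R_\varphi=\int_G R_g\,d\mu(g)$ for any measure $\mu$ on $G$ extending $\varphi$. $\mathfrak{M}_A$ is the semigroup (under composition) of all continuous nonzero endomorphisms of the algebra $A$ that commute with all left translations $L_g$, $g\in G$, endowed with the strong operator topology of $\mathrm{BL}(A)$. *)

theory Defs
  imports "HOL-Analysis.Analysis"
begin

text \<open>
  The group \<open>G\<close> is a type of class \<^class>\<open>topological_group_add\<close>: it is written additively
  (\<open>g + h\<close> for the product \<open>gh\<close>, \<open>- g\<close> for the inverse of \<open>g\<close>), but it is \<^emph>\<open>not\<close> assumed to be
  commutative. Since \<open>G\<close> will be compact, \<open>C(G)\<close> with the sup-norm is the type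
  \<open>'g \<Rightarrow>\<^sub>C complex\<close>. The product by the complex scalar \<open>c\<close> is the product by the
  constant function \<^term>\<open>const_bcontfun c\<close>.
\<close>

subsection \<open>The algebra of bounded continuous functions\<close>

unbundle bcontfun.lifting

instantiation bcontfun :: (topological_space, real_normed_algebra) real_normed_algebra
begin

lift_definition times_bcontfun :: "('a \<Rightarrow>\<^sub>C 'b) \<Rightarrow> ('a \<Rightarrow>\<^sub>C 'b) \<Rightarrow> 'a \<Rightarrow>\<^sub>C 'b"
  is "\<lambda>f g x. f x * g x"
proof -
  fix f g :: "'a \<Rightarrow> 'b"
  assume f: "f \<in> bcontfun" and g: "g \<in> bcontfun"
  obtain a b where ab: "\<And>x. norm (f x) \<le> a" "\<And>x. norm (g x) \<le> b"
    using f g by (auto simp: bcontfun_def bounded_iff)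
  have "norm (f x * g x) \<le> a * b" for x
    by (rule order_trans[OF norm_mult_ineq])
       (use ab[of x] in \<open>auto intro!: mult_mono order_trans[OF norm_ge_zero]\<close>)
  moreover have "continuous_on UNIV (\<lambda>x. f x * g x)"
    using f g by (auto simp: bcontfun_def intro!: continuous_intros)
  ultimately show "(\<lambda>x. f x * g x) \<in> bcontfun"
    by (rule bcontfun_normI[rotated])
qed

lemmas [simp] = times_bcontfun.rep_eq

instance
proof
  fix a b c :: "'a \<Rightarrow>\<^sub>C 'b" and r :: real
  show "a * b * c = a * (b * c)"
    by (rule bcontfun_eqI) (simp add: mult.assoc)
  show "(a + b) * c = a * c + b * c" "a * (b + c) = a * b + a * c"
    by (rule bcontfun_eqI; simp add: algebra_simps)+
  show "r *\<^sub>R a * b = r *\<^sub>R (a * b)" "a * r *\<^sub>R b = r *\<^sub>R (a * b)"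
    by (rule bcontfun_eqI; simp)+
  show "norm (a * b) \<le> norm a * norm b"
  proof (rule norm_bound)
    fix x
    have "norm (a x * b x) \<le> norm (a x) * norm (b x)"
      by (rule norm_mult_ineq)
    also have "\<dots> \<le> norm a * norm b"
      by (intro mult_mono norm_bounded norm_ge_zero)
    finally show "norm ((a * b) x) \<le> norm a * norm b" by simp
  qed
qed

end

lift_definition left_trans :: "'g::topological_group_add \<Rightarrow> ('g \<Rightarrow>\<^sub>C complex) \<Rightarrow> 'g \<Rightarrow>\<^sub>C complex"
  is "\<lambda>g f h. f (g + h)"
proof -
  fix g :: 'g and f :: "'g \<Rightarrow> complex"
  assume f: "f \<in> bcontfun"
  have "continuous_on UNIV (f \<circ> (\<lambda>h. g + h))"
    using f by (intro continuous_on_compose continuous_intros)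
      (auto simp: bcontfun_def intro: continuous_on_subset)
  moreover have "bounded (range (\<lambda>h. f (g + h)))"
    using f by (auto simp: bcontfun_def intro: bounded_subset)
  ultimately show "(\<lambda>h. f (g + h)) \<in> bcontfun"
    by (simp add: bcontfun_def o_def)
qed

lift_definition right_trans :: "'g::topological_group_add \<Rightarrow> ('g \<Rightarrow>\<^sub>C complex) \<Rightarrow> 'g \<Rightarrow>\<^sub>C complex"
  is "\<lambda>g f h. f (h + g)"
proof -
  fix g :: 'g and f :: "'g \<Rightarrow> complex"
  assume f: "f \<in> bcontfun"
  have "continuous_on UNIV (f \<circ> (\<lambda>h. h + g))"
    using f by (intro continuous_on_compose continuous_intros)
      (auto simp: bcontfun_def intro: continuous_on_subset)
  moreover have "bounded (range (\<lambda>h. f (h + g)))"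
    using f by (auto simp: bcontfun_def intro: bounded_subset)
  ultimately show "(\<lambda>h. f (h + g)) \<in> bcontfun"
    by (simp add: bcontfun_def o_def)
qed

text \<open>The involution \<open>f\<^sup>\<star>(g) = cnj (f (g\<^sup>-\<^sup>1))\<close>.\<close>

lift_definition fun_star :: "('g::topological_group_add \<Rightarrow>\<^sub>C complex) \<Rightarrow> 'g \<Rightarrow>\<^sub>C complex"
  is "\<lambda>f g. cnj (f (- g))"
proof -
  fix f :: "'g \<Rightarrow> complex"
  assume f: "f \<in> bcontfun"
  have "continuous_on UNIV (f \<circ> (\<lambda>h. - h))"
    using f by (intro continuous_on_compose continuous_intros)
      (auto simp: bcontfun_def intro: continuous_on_subset)
  then have "continuous_on UNIV (\<lambda>g. cnj (f (- g)))"
    by (auto simp: o_def intro: continuous_on_cnj)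
  moreover have "bounded (range (\<lambda>g. cnj (f (- g))))"
    using f by (auto simp: bcontfun_def bounded_iff)
  ultimately show "(\<lambda>g. cnj (f (- g))) \<in> bcontfun"
    by (simp add: bcontfun_def)
qed

definition invariant_algebra :: "('g::topological_group_add \<Rightarrow>\<^sub>C complex) set \<Rightarrow> bool" where
  "invariant_algebra A \<longleftrightarrow>
     closed A \<and>
     (\<forall>c. const_bcontfun c \<in> A) \<and>
     (\<forall>f\<in>A. \<forall>h\<in>A. f + h \<in> A \<and> f * h \<in> A) \<and>
     (\<forall>g. left_trans g ` A \<subseteq> A \<and> right_trans g ` A \<subseteq> A)"


subsection \<open>Bounded operators and the topology of pointwise convergence\<close>

text \<open>
  Functionals and operators on a subset are represented by functions that are \<^const>\<open>undefined\<close>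
  outside of it, so that equality is equality on the subset.
\<close>

definition bounded_ops ::
  "'v set \<Rightarrow> ('v \<Rightarrow> 'v \<Rightarrow> 'v) \<Rightarrow> (complex \<Rightarrow> 'v \<Rightarrow> 'v) \<Rightarrow> ('v \<Rightarrow> real) \<Rightarrow> ('v \<Rightarrow> 'v) set" where
  "bounded_ops X add scl nrm =
     {T \<in> X \<rightarrow>\<^sub>E X.
        (\<forall>x\<in>X. \<forall>y\<in>X. T (add x y) = add (T x) (T y)) \<and>
        (\<forall>c. \<forall>x\<in>X. T (scl c x) = scl c (T x)) \<and>
        (\<exists>K. \<forall>x\<in>X. nrm (T x) \<le> K * nrm x)}"

text \<open>
  The strong operator topology on a set of operators in the space \<open>topspace X\<close>, i.e. the
  topology of pointwise convergence.
\<close>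

definition strong_op_topology :: "'v topology \<Rightarrow> ('v \<Rightarrow> 'v) set \<Rightarrow> ('v \<Rightarrow> 'v) topology" where
  "strong_op_topology X Ops = subtopology (product_topology (\<lambda>_. X) (topspace X)) Ops"

abbreviation BL_alg ::
  "('g::topological_space \<Rightarrow>\<^sub>C complex) set \<Rightarrow> (('g \<Rightarrow>\<^sub>C complex) \<Rightarrow> ('g \<Rightarrow>\<^sub>C complex)) set" where
  "BL_alg A \<equiv> bounded_ops A (+) (\<lambda>c f. const_bcontfun c * f) norm"


subsection \<open>Functionals on the algebra\<close>

definition linear_functional ::
  "('g::topological_space \<Rightarrow>\<^sub>C complex) set \<Rightarrow> (('g \<Rightarrow>\<^sub>C complex) \<Rightarrow> complex) \<Rightarrow> bool" where
  "linear_functional A \<phi> \<longleftrightarrow>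
     \<phi> \<in> extensional A \<and>
     (\<forall>f\<in>A. \<forall>h\<in>A. \<phi> (f + h) = \<phi> f + \<phi> h) \<and>
     (\<forall>c. \<forall>f\<in>A. \<phi> (const_bcontfun c * f) = c * \<phi> f)"

definition dual_space ::
  "('g::topological_space \<Rightarrow>\<^sub>C complex) set \<Rightarrow> (('g \<Rightarrow>\<^sub>C complex) \<Rightarrow> complex) set" where
  "dual_space A = {\<phi>. linear_functional A \<phi> \<and> continuous_on A \<phi>}"

text \<open>\<open>\<M>\<^sub>A\<close>; continuity is automatic and not required.\<close>

definition mult_functionals ::
  "('g::topological_space \<Rightarrow>\<^sub>C complex) set \<Rightarrow> (('g \<Rightarrow>\<^sub>C complex) \<Rightarrow> complex) set" where
  "mult_functionals A =
     {\<phi>. linear_functional A \<phi> \<and> (\<forall>f\<in>A. \<forall>h\<in>A. \<phi> (f * h) = \<phi> f * \<phi> h) \<and> (\<exists>f\<in>A. \<phi> f \<noteq> 0)}"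

definition weak_star_topology ::
  "('g::topological_space \<Rightarrow>\<^sub>C complex) set \<Rightarrow> (('g \<Rightarrow>\<^sub>C complex) \<Rightarrow> complex) topology" where
  "weak_star_topology A =
     subtopology (product_topology (\<lambda>_. euclidean) A) (mult_functionals A)"

definition functional_star ::
  "('g::topological_group_add \<Rightarrow>\<^sub>C complex) set \<Rightarrow> (('g \<Rightarrow>\<^sub>C complex) \<Rightarrow> complex)
     \<Rightarrow> (('g \<Rightarrow>\<^sub>C complex) \<Rightarrow> complex)" where
  "functional_star A \<phi> = (\<lambda>f\<in>A. cnj (\<phi> (fun_star f)))"


subsection \<open>Regular measures and convolution\<close>

definition regular_borel_measure :: "'g::topological_space measure \<Rightarrow> bool" where
  "regular_borel_measure M \<longleftrightarrow>
     finite_measure M \<and> sets M = sets borel \<and>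
     (\<forall>B\<in>sets borel.
        emeasure M B = (INF U\<in>{U. open U \<and> B \<subseteq> U}. emeasure M U) \<and>
        emeasure M B = (SUP K\<in>{K. compact K \<and> K \<subseteq> B}. emeasure M K))"

text \<open>
  A finite regular Borel complex measure is given by a Jordan decomposition
  \<open>\<mu> = \<mu> 0 + \<i> \<mu> 1 - \<mu> 2 - \<i> \<mu> 3 = (\<Sum>k<4. \<i> ^ k \<mu> k)\<close> into finite regular positive measures;
  neither minimality nor uniqueness of the decomposition is required.
\<close>

definition regular_complex_measure :: "(nat \<Rightarrow> 'g::topological_space measure) \<Rightarrow> bool" where
  "regular_complex_measure \<mu> \<longleftrightarrow> (\<forall>k<4. regular_borel_measure (\<mu> k))"

definition complex_measure_integral ::
  "(nat \<Rightarrow> 'g::topological_space measure) \<Rightarrow> ('g \<Rightarrow> complex) \<Rightarrow> complex" where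
  "complex_measure_integral \<mu> f = (\<Sum>k<4. \<i> ^ k * (LINT x|\<mu> k. f x))"

definition measure_extends ::
  "('g::topological_space \<Rightarrow>\<^sub>C complex) set \<Rightarrow> (nat \<Rightarrow> 'g measure)
     \<Rightarrow> (('g \<Rightarrow>\<^sub>C complex) \<Rightarrow> complex) \<Rightarrow> bool" where
  "measure_extends A \<mu> \<phi> \<longleftrightarrow>
     regular_complex_measure \<mu> \<and> (\<forall>f\<in>A. \<phi> f = complex_measure_integral \<mu> (apply_bcontfun f))"

text \<open>The definite description expresses independence of the choice of the extending measures.\<close>

definition convolution ::
  "('g::topological_group_add \<Rightarrow>\<^sub>C complex) set \<Rightarrow> (('g \<Rightarrow>\<^sub>C complex) \<Rightarrow> complex)
     \<Rightarrow> (('g \<Rightarrow>\<^sub>C complex) \<Rightarrow> complex) \<Rightarrow> (('g \<Rightarrow>\<^sub>C complex) \<Rightarrow> complex)" where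
  "convolution A \<phi> \<psi> = (\<lambda>f\<in>A. THE z. \<exists>\<mu> \<nu>. measure_extends A \<mu> \<phi> \<and> measure_extends A \<nu> \<psi> \<and>
     z = complex_measure_integral \<nu> (\<lambda>h. complex_measure_integral \<mu> (\<lambda>g. apply_bcontfun f (g + h))))"


subsection \<open>The operators \<open>R\<^sub>\<phi>\<close> and the semigroup of endomorphisms\<close>

definition R_op ::
  "('g::topological_group_add \<Rightarrow>\<^sub>C complex) set \<Rightarrow> (('g \<Rightarrow>\<^sub>C complex) \<Rightarrow> complex)
     \<Rightarrow> (('g \<Rightarrow>\<^sub>C complex) \<Rightarrow> ('g \<Rightarrow>\<^sub>C complex))" where
  "R_op A \<phi> = (THE T. T \<in> BL_alg A \<and> (\<forall>\<psi>\<in>dual_space A. \<forall>f\<in>A. \<psi> (T f) = convolution A \<psi> \<phi> f))"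

definition invariant_endomorphisms ::
  "('g::topological_group_add \<Rightarrow>\<^sub>C complex) set \<Rightarrow> (('g \<Rightarrow>\<^sub>C complex) \<Rightarrow> ('g \<Rightarrow>\<^sub>C complex)) set" where
  "invariant_endomorphisms A =
     {T \<in> BL_alg A.
        (\<forall>f\<in>A. \<forall>h\<in>A. T (f * h) = T f * T h) \<and>
        (\<exists>f\<in>A. T f \<noteq> 0) \<and>
        (\<forall>g. \<forall>f\<in>A. T (left_trans g f) = left_trans g (T f))}"


subsection \<open>Haar measure, \<open>L\<^sup>2(G)\<close> and \<open>H\<^sup>2\<close>\<close>

definition haar_measure :: "'g::topological_group_add measure \<Rightarrow> bool" where
  "haar_measure m \<longleftrightarrow>
     regular_borel_measure m \<and> emeasure m UNIV = 1 \<and> (\<forall>g. distr m borel (\<lambda>h. g + h) = m)"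

definition square_integrable :: "'g measure \<Rightarrow> ('g \<Rightarrow> complex) set" where
  "square_integrable m = {f \<in> borel_measurable m. integrable m (\<lambda>x. (cmod (f x))\<^sup>2)}"

text \<open>
  The elements of \<open>L\<^sup>2\<close> are classes of square-integrable functions modulo equality almost
  everywhere; the operations are computed on representatives.
\<close>

definition l2_class :: "'g measure \<Rightarrow> ('g \<Rightarrow> complex) \<Rightarrow> ('g \<Rightarrow> complex) set" where
  "l2_class m f = {h \<in> square_integrable m. AE x in m. h x = f x}"

definition l2_space :: "'g measure \<Rightarrow> ('g \<Rightarrow> complex) set set" where
  "l2_space m = l2_class m ` square_integrable m"

definition l2_rep :: "('g \<Rightarrow> complex) set \<Rightarrow> 'g \<Rightarrow> complex" where
  "l2_rep F = (SOME f. f \<in> F)"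

definition l2_add ::
  "'g measure \<Rightarrow> ('g \<Rightarrow> complex) set \<Rightarrow> ('g \<Rightarrow> complex) set \<Rightarrow> ('g \<Rightarrow> complex) set" where
  "l2_add m F H = l2_class m (\<lambda>x. l2_rep F x + l2_rep H x)"

definition l2_scale ::
  "'g measure \<Rightarrow> complex \<Rightarrow> ('g \<Rightarrow> complex) set \<Rightarrow> ('g \<Rightarrow> complex) set" where
  "l2_scale m c F = l2_class m (\<lambda>x. c * l2_rep F x)"

definition l2_inner ::
  "'g measure \<Rightarrow> ('g \<Rightarrow> complex) set \<Rightarrow> ('g \<Rightarrow> complex) set \<Rightarrow> complex" where
  "l2_inner m F H = (LINT x|m. l2_rep F x * cnj (l2_rep H x))"

definition l2_norm :: "'g measure \<Rightarrow> ('g \<Rightarrow> complex) set \<Rightarrow> real" where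
  "l2_norm m F = sqrt (LINT x|m. (cmod (l2_rep F x))\<^sup>2)"

definition l2_dist :: "'g measure \<Rightarrow> ('g \<Rightarrow> complex) set \<Rightarrow> ('g \<Rightarrow> complex) set \<Rightarrow> real" where
  "l2_dist m F H = sqrt (LINT x|m. (cmod (l2_rep F x - l2_rep H x))\<^sup>2)"

definition l2_topology :: "'g measure \<Rightarrow> ('g \<Rightarrow> complex) set topology" where
  "l2_topology m = Metric_space.mtopology (l2_space m) (l2_dist m)"

definition H2 ::
  "('g::topological_space \<Rightarrow>\<^sub>C complex) set \<Rightarrow> 'g measure \<Rightarrow> ('g \<Rightarrow> complex) set set" where
  "H2 A m = (l2_topology m) closure_of ((\<lambda>f. l2_class m (apply_bcontfun f)) ` A)"

abbreviation H2_topology ::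
  "('g::topological_space \<Rightarrow>\<^sub>C complex) set \<Rightarrow> 'g measure \<Rightarrow> ('g \<Rightarrow> complex) set topology" where
  "H2_topology A m \<equiv> subtopology (l2_topology m) (H2 A m)"

abbreviation BL_H2 ::
  "('g::topological_space \<Rightarrow>\<^sub>C complex) set \<Rightarrow> 'g measure
     \<Rightarrow> (('g \<Rightarrow> complex) set \<Rightarrow> ('g \<Rightarrow> complex) set) set" where
  "BL_H2 A m \<equiv> bounded_ops (H2 A m) (l2_add m) (l2_scale m) (l2_norm m)"

definition continuous_extension ::
  "('g::topological_space \<Rightarrow>\<^sub>C complex) set \<Rightarrow> 'g measure
     \<Rightarrow> (('g \<Rightarrow>\<^sub>C complex) \<Rightarrow> ('g \<Rightarrow>\<^sub>C complex))
     \<Rightarrow> (('g \<Rightarrow> complex) set \<Rightarrow> ('g \<Rightarrow> complex) set) \<Rightarrow> bool" where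
  "continuous_extension A m S T \<longleftrightarrow>
     T \<in> extensional (H2 A m) \<and>
     continuous_map (H2_topology A m) (H2_topology A m) T \<and>
     (\<forall>f\<in>A. T (l2_class m (apply_bcontfun f)) = l2_class m (apply_bcontfun (S f)))"

definition R_H2 ::
  "('g::topological_group_add \<Rightarrow>\<^sub>C complex) set \<Rightarrow> 'g measure \<Rightarrow> (('g \<Rightarrow>\<^sub>C complex) \<Rightarrow> complex)
     \<Rightarrow> (('g \<Rightarrow> complex) set \<Rightarrow> ('g \<Rightarrow> complex) set)" where
  "R_H2 A m \<phi> = (THE T. continuous_extension A m (R_op A \<phi>) T)"

definition H2_adjoint ::
  "('g::topological_space \<Rightarrow>\<^sub>C complex) set \<Rightarrow> 'g measure
     \<Rightarrow> (('g \<Rightarrow> complex) set \<Rightarrow> ('g \<Rightarrow> complex) set)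
     \<Rightarrow> (('g \<Rightarrow> complex) set \<Rightarrow> ('g \<Rightarrow> complex) set)" where
  "H2_adjoint A m T = (THE S. S \<in> BL_H2 A m \<and>
     (\<forall>x\<in>H2 A m. \<forall>y\<in>H2 A m. l2_inner m (T x) y = l2_inner m x (S y)))"

end

theory Submission
  imports Defs
begin

text \<open>
  By Hahn-Banach and Riesz every \<open>\<phi> \<in> A'\<close> extends to a regular measure \<open>\<mu>\<close>, and since
  \<open>h \<mapsto> R\<^sub>h f\<close> is norm continuous, Riemann sums show that \<open>R\<^sub>\<phi> f = \<integral> R\<^sub>h f d\<mu>(h)\<close> lies in the closed
  algebra \<open>A\<close>, equals \<open>g \<mapsto> \<phi>(L\<^sub>g f)\<close>, and satisfies \<open>\<psi>(R\<^sub>\<phi> f) = (\<psi> * \<phi>)(f)\<close>. The inverse of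
  \<open>\<phi> \<mapsto> R\<^sub>\<phi>\<close> is evaluation at the unit. As \<open>R\<^sub>h\<close> is an isometry of \<open>L\<^sup>2\<close>, the operators \<open>R\<^sub>\<phi>\<close> are
  uniformly bounded in \<open>L\<^sup>2\<close>, so they extend to \<open>H\<^sup>2\<close> and depend continuously on \<open>\<phi>\<close>; \<open>\<M>\<^sub>A\<close> is compact,
  hence the continuous injection into the Hausdorff space of operators is an embedding.
\<close>

section \<open>The Hahn-Banach theorem\<close>

text \<open>Several matters shape the proof. An invariant algebra is not assumed to be closed under
  \<open>fun_star\<close>, yet \<open>functional_star\<close> and the adjoint formula need exactly
  this; \<open>fun_star_A\<close> derives it from the L2 adjoint of a convolution operator, which is
  why Haar measure enters before the involution. Moreover \<open>convolution\<close>,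
  \<open>R_op\<close>, \<open>R_H2\<close> and \<open>H2_adjoint\<close> are definite descriptions,
  so each needs a uniqueness argument: the value does not depend on the extending measures, point
  evaluations separate \<open>A\<close>, the image of \<open>A\<close> is dense in the Hausdorff
  space H2, and the inner product of H2 is nondegenerate.

  C(G) need not be separable, so C(G)-valued integrals are taken pointwise and approximated by
  finite sums whose nodes and weights serve all scalar integrands at once. The same sums justify the
  exchanges of two integrations.

  The constant 4 in the L2 bounds counts the positive measures that represent a functional: for a
  multiplicative functional each can be given mass at most 1. Only its independence of the
  functional matters.\<close>

text \<open>Minimal sublinear functionals are linear, so Zorn's lemma applies to total functions.\<close>

definition sublinear :: "('v::real_vector \<Rightarrow> real) \<Rightarrow> bool" where
  "sublinear q \<longleftrightarrow> (\<forall>x y. q (x + y) \<le> q x + q y) \<and> (\<forall>t x. 0 \<le> t \<longrightarrow> q (t *\<^sub>R x) = t * q x)"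

lemma sublinear_minus_le: "sublinear q \<Longrightarrow> - q (- x) \<le> q x"
proof -
  assume q: "sublinear q"
  have "q (0 *\<^sub>R x) = 0 * q x" using q unfolding sublinear_def by blast
  then have "q 0 = 0" by simp
  moreover have "q (x + - x) \<le> q x + q (- x)" using q unfolding sublinear_def by blast
  ultimately show ?thesis by simp
qed

text \<open>Infimal convolution: \<open>q' x\<close> is the infimum of
  \<open>q (x + E a) - u a\<close> over \<open>a\<close> in \<open>A\<close>. It is finite because
  \<open>u a <= q (E a)\<close> bounds it below by \<open>- q (- x)\<close>, and taking
  \<open>a\<close> itself at \<open>x = - E a\<close> gives the last conclusion. Working with a cone
  \<open>A\<close> lets the lemma serve half-lines as well as subspaces.\<close>

lemma sublinear_reduce:
  fixes q :: "'v::real_vector \<Rightarrow> real" and E :: "'w::real_vector \<Rightarrow> 'v"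
  assumes q: "sublinear q"
    and zero: "0 \<in> A"
    and add: "\<And>a b. a \<in> A \<Longrightarrow> b \<in> A \<Longrightarrow> a + b \<in> A \<and> E (a + b) = E a + E b \<and> u (a + b) = u a + u b"
    and scale: "\<And>t a. a \<in> A \<Longrightarrow> 0 \<le> t \<Longrightarrow> t *\<^sub>R a \<in> A \<and> E (t *\<^sub>R a) = t *\<^sub>R E a \<and> u (t *\<^sub>R a) = t * u a"
    and le: "\<And>a. a \<in> A \<Longrightarrow> u a \<le> q (E a)"
  obtains q' where "sublinear q'" "q' \<le> q" "\<And>a. a \<in> A \<Longrightarrow> q' (- E a) \<le> - u a"
proof -
  define q' where "q' x = (INF a\<in>A. q (x + E a) - u a)" for x
  have qa: "q (x + y) \<le> q x + q y" and qs: "0 \<le> t \<Longrightarrow> q (t *\<^sub>R x) = t * q x" for x y t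
    using q by (auto simp: sublinear_def)
  have E0: "E 0 = 0" "u 0 = 0"
    using scale[OF zero, of 0] by auto
  have q0: "q 0 = 0" using qs[of 0 0] by simp
  have lower: "- q (- x) \<le> q (x + E a) - u a" if "a \<in> A" for a x
    using le[OF that] qa[of "x + E a" "- x"] by simp
  have bdd: "bdd_below ((\<lambda>a. q (x + E a) - u a) ` A)" for x
    using lower by (auto intro!: bdd_belowI2)
  have le1: "q' x \<le> q (x + E a) - u a" if "a \<in> A" for a x
    unfolding q'_def using bdd that by (rule cINF_lower)
  have ge1: "c \<le> q' x" if "\<And>a. a \<in> A \<Longrightarrow> c \<le> q (x + E a) - u a" for c x
    unfolding q'_def using zero that by (intro cINF_greatest) auto
  have q'0: "q' 0 = 0"
  proof (rule antisym)
    show "q' 0 \<le> 0" using le1[OF zero, of 0] E0 q0 by simp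
    show "0 \<le> q' 0" by (rule ge1) (use le in simp)
  qed
  have tri: "q' (x + y) \<le> q' x + q' y" for x y
  proof -
    have "q' (x + y) - (q (x + E a) - u a) \<le> q' y" if a: "a \<in> A" for a
    proof (rule ge1)
      fix b assume b: "b \<in> A"
      have "q' (x + y) \<le> q (x + y + E (a + b)) - u (a + b)"
        using add[OF a b] by (intro le1) auto
      also have "\<dots> = q ((x + E a) + (y + E b)) - u a - u b"
        using add[OF a b] by (simp add: algebra_simps)
      also have "\<dots> \<le> q (x + E a) + q (y + E b) - u a - u b"
        using qa by simp
      finally show "q' (x + y) - (q (x + E a) - u a) \<le> q (y + E b) - u b" by simp
    qed
    then have "q' (x + y) - q' y \<le> q' x"
      by (intro ge1) (simp add: algebra_simps)
    then show ?thesis by simp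
  qed
  have half: "t * q' x \<le> q' (t *\<^sub>R x)" if t: "t > 0" for t x
  proof (rule ge1)
    fix a assume a: "a \<in> A"
    \<comment> \<open>Rescaling permutes the cone: the competitor \<open>a\<close> for
      \<open>t x\<close> corresponds to \<open>a / t\<close> for \<open>x\<close>.\<close>
    define b where "b = (1 / t) *\<^sub>R a"
    have b: "b \<in> A" "E b = (1 / t) *\<^sub>R E a" "u b = (1 / t) * u a"
      using scale[OF a, of "1 / t"] t by (auto simp: b_def)
    have "t * q' x \<le> t * (q (x + E b) - u b)"
      using le1[OF b(1), of x] t by simp
    also have "\<dots> = q (t *\<^sub>R x + E a) - u a"
      using qs[of t "x + E b"] t b by (simp add: algebra_simps)
    finally show "t * q' x \<le> q (t *\<^sub>R x + E a) - u a" .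
  qed
  have scal: "q' (t *\<^sub>R x) = t * q' x" if t: "t \<ge> 0" for t x
  proof (cases "t = 0")
    case False
    with t have t: "t > 0" by simp
    have "(1 / t) * q' (t *\<^sub>R x) \<le> q' ((1 / t) *\<^sub>R t *\<^sub>R x)"
      using t by (intro half) simp
    with t have "q' (t *\<^sub>R x) \<le> t * q' x" by (simp add: field_simps)
    with half[OF t, of x] show ?thesis by simp
  qed (simp add: q'0)
  show thesis
  proof
    show "sublinear q'" using tri scal by (auto simp: sublinear_def)
    show "q' \<le> q" using le1[OF zero] E0 by (auto simp: le_fun_def)
    show "q' (- E a) \<le> - u a" if "a \<in> A" for a
      using le1[OF that, of "- E a"] q0 by simp
  qed
qed

text \<open>Reduction along the half-line of \<open>y\<close> with \<open>u a = a * q y\<close>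
  forces \<open>q (- y) <= - q y\<close> once \<open>q' = q\<close>; an odd sublinear function is
  linear.\<close>

lemma minimal_sublinear_linear:
  fixes q :: "'v::real_vector \<Rightarrow> real"
  assumes q: "sublinear q" and min: "\<And>q'. sublinear q' \<Longrightarrow> q' \<le> q \<Longrightarrow> q' = q"
  shows "linear q"
proof -
  have qa: "q (x + y) \<le> q x + q y" and qs: "0 \<le> t \<Longrightarrow> q (t *\<^sub>R x) = t * q x" for x y t
    using q by (auto simp: sublinear_def)
  have odd: "q (- y) = - q y" for y
  proof -
    obtain q' where q': "sublinear q'" "q' \<le> q" "\<And>a. a \<in> {0..} \<Longrightarrow> q' (- (a *\<^sub>R y)) \<le> - (a * q y)"
      by (rule sublinear_reduce[OF q, of "{0::real..}" "\<lambda>a. a *\<^sub>R y" "\<lambda>a. a * q y"])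
         (auto simp: algebra_simps qs)
    have "q (- y) \<le> - q y" using q'(3)[of 1] min[OF q'(1,2)] by simp
    with sublinear_minus_le[OF q, of y] show ?thesis by simp
  qed
  show ?thesis
  proof (rule linearI)
    show "q (x + y) = q x + q y" for x y
      using qa[of x y] qa[of "- x" "- y"] odd[of x] odd[of y] odd[of "x + y"] by simp
    show "q (c *\<^sub>R x) = c *\<^sub>R q x" for c x
      using qs[of c x] qs[of "- c" x] odd[of "c *\<^sub>R x"] by (cases "c \<ge> 0") auto
  qed
qed

text \<open>Zorn's lemma for the reversed pointwise order: a nonempty chain is bounded by its
  pointwise infimum, finite because every member stays above \<open>- p (- x)\<close>.\<close>

lemma exists_linear_le_sublinear:
  fixes p :: "'v::real_vector \<Rightarrow> real"
  assumes p: "sublinear p"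
  obtains F where "linear F" "F \<le> p"
proof -
  let ?S = "{q. sublinear q \<and> q \<le> p}"
  have "\<exists>m\<in>?S. \<forall>a\<in>?S. a \<le> m \<longrightarrow> a = m"
  proof (rule predicate_Zorn)
    show "partial_order_on ?S (relation_of (\<lambda>a b. b \<le> a) ?S)"
      by (auto simp: partial_order_on_def preorder_on_def refl_on_def trans_def antisym_def relation_of_def)
    fix C assume C: "C \<in> Chains (relation_of (\<lambda>a b. b \<le> a) ?S)"
    then have CS: "c \<in> C \<Longrightarrow> sublinear c \<and> c \<le> p" and tot: "c \<in> C \<Longrightarrow> d \<in> C \<Longrightarrow> c \<le> d \<or> d \<le> c" for c d
      by (auto simp: Chains_def relation_of_def)
    show "\<exists>u\<in>?S. \<forall>a\<in>C. u \<le> a"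
    proof (cases "C = {}")
      case True then show ?thesis using p by auto
    next
      case False
      define r where "r x = (INF c\<in>C. c x)" for x
      have bdd: "bdd_below ((\<lambda>c. c x) ` C)" for x
      proof (rule bdd_belowI2[where m = "- p (- x)"])
        fix c assume c: "c \<in> C"
        have "- c (- x) \<le> c x" "c (- x) \<le> p (- x)"
          using sublinear_minus_le CS[OF c] by (auto simp: le_fun_def)
        then show "- p (- x) \<le> c x" by simp
      qed
      have le1: "r x \<le> c x" if "c \<in> C" for c x
        unfolding r_def using bdd that by (rule cINF_lower)
      have ge1: "k \<le> r x" if "\<And>c. c \<in> C \<Longrightarrow> k \<le> c x" for k x
        unfolding r_def using False that by (rule cINF_greatest)
      have sub: "c (x + y) \<le> c x + c y" and sc: "0 \<le> t \<Longrightarrow> c (t *\<^sub>R x) = t * c x" if "c \<in> C" for c x y t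
        using CS[OF that] by (auto simp: sublinear_def)
      have tri: "r (x + y) \<le> r x + r y" for x y
      proof -
        have "r (x + y) - c x \<le> r y" if c: "c \<in> C" for c
        proof (rule ge1)
          fix d assume d: "d \<in> C"
          \<comment> \<open>Two members of a chain are comparable, and the smaller of
            \<open>c\<close> and \<open>d\<close> bounds both terms at once.\<close>
          have "r (x + y) \<le> c x + d y"
          proof (cases "c \<le> d")
            case True
            then have "c y \<le> d y" by (simp add: le_fun_def)
            with le1[OF c, of "x + y"] sub[OF c, of x y] show ?thesis by linarith
          next
            case False
            then have "d x \<le> c x" using tot[OF c d] by (meson le_funD)
            with le1[OF d, of "x + y"] sub[OF d, of x y] show ?thesis by linarith
          qed
          then show "r (x + y) - c x \<le> d y" by simp
        qed
        then have "r (x + y) - r y \<le> r x"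
          by (intro ge1) (simp add: algebra_simps)
        then show ?thesis by simp
      qed
      obtain c0 where c0: "c0 \<in> C" using False by auto
      have "c 0 = 0" if "c \<in> C" for c using sc[OF that, of 0 0] by simp
      then have r0: "r 0 = 0"
        using c0 le1[OF c0, of 0] ge1[of 0 0] by force
      have half: "t * r x \<le> r (t *\<^sub>R x)" if t: "t > 0" for t x
        using t le1 by (intro ge1) (simp add: sc)
      have scal: "r (t *\<^sub>R x) = t * r x" if t: "t \<ge> 0" for t x
      proof (cases "t = 0")
        case False
        with t have t: "t > 0" by simp
        have "(1 / t) * r (t *\<^sub>R x) \<le> r ((1 / t) *\<^sub>R t *\<^sub>R x)"
          using t by (intro half) simp
        with t have "r (t *\<^sub>R x) \<le> t * r x" by (simp add: field_simps)
        with half[OF t, of x] show ?thesis by simp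
      qed (simp add: r0)
      have "r \<le> p" using le1[OF c0] CS[OF c0] by (auto simp: le_fun_def intro: order_trans)
      with tri scal le1 show ?thesis by (intro bexI[of _ r]) (auto simp: sublinear_def le_fun_def)
    qed
  qed
  then obtain F where F: "sublinear F" "F \<le> p" and "\<And>a. sublinear a \<Longrightarrow> a \<le> p \<Longrightarrow> a \<le> F \<Longrightarrow> a = F"
    by auto
  then have "linear F"
    by (intro minimal_sublinear_linear) (auto intro: order_trans)
  then show thesis using F that by auto
qed

text \<open>The one-sided conclusion fits cones: it is applied to a space of functions mapped by
  \<open>E\<close> into quadruples of real functions, and to the product of \<open>A\<close> with a
  half-line. Where the domain is symmetric, applying it to \<open>- a\<close> as well turns it into
  an equality.\<close>

theorem hahn_banach:
  fixes p :: "'v::real_vector \<Rightarrow> real" and E :: "'w::real_vector \<Rightarrow> 'v"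
  assumes "sublinear p"
    and "0 \<in> A"
    and "\<And>a b. a \<in> A \<Longrightarrow> b \<in> A \<Longrightarrow> a + b \<in> A \<and> E (a + b) = E a + E b \<and> u (a + b) = u a + u b"
    and "\<And>t a. a \<in> A \<Longrightarrow> 0 \<le> t \<Longrightarrow> t *\<^sub>R a \<in> A \<and> E (t *\<^sub>R a) = t *\<^sub>R E a \<and> u (t *\<^sub>R a) = t * u a"
    and "\<And>a. a \<in> A \<Longrightarrow> u a \<le> p (E a)"
  obtains F where "linear F" "F \<le> p" "\<And>a. a \<in> A \<Longrightarrow> u a \<le> F (E a)"
proof -
  obtain q where q: "sublinear q" "q \<le> p" "\<And>a. a \<in> A \<Longrightarrow> q (- E a) \<le> - u a"
    using sublinear_reduce[OF assms] by blast
  obtain F where F: "linear F" "F \<le> q" using exists_linear_le_sublinear[OF q(1)] .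
  have "u a \<le> F (E a)" if "a \<in> A" for a
  proof -
    have "F (- E a) \<le> q (- E a)" using F(2) by (simp add: le_fun_def)
    with q(3)[OF that] show ?thesis by (simp add: linear_neg[OF F(1)])
  qed
  with F q(2) that show thesis by (meson order_trans)
qed

section \<open>Riesz representation on compact Hausdorff spaces\<close>

lemma compact_t2_separation:
  fixes S T :: "'a::t2_space set"
  assumes "compact (UNIV :: 'a set)" "closed S" "closed T" "S \<inter> T = {}"
  shows "\<exists>h :: 'a \<Rightarrow> real. continuous_on UNIV h \<and> (\<forall>x. 0 \<le> h x \<and> h x \<le> 1) \<and>
    (\<forall>x\<in>S. h x = 0) \<and> (\<forall>x\<in>T. h x = 1)"
proof -
  have "normal_space (euclidean :: 'a topology)"
  proof (rule compact_Hausdorff_or_regular_imp_normal_space)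
    show "compact_space (euclidean :: 'a topology)" using assms(1) by (simp add: compact_space_def)
    have "Hausdorff_space (euclidean :: 'a topology)"
      using hausdorff by (auto simp: Hausdorff_space_def disjnt_def)
    then show "Hausdorff_space (euclidean :: 'a topology) \<or> regular_space (euclidean :: 'a topology)" ..
  qed
  then obtain h where h: "continuous_map euclidean (top_of_set {0..1::real}) h" "h ` S \<subseteq> {0}" "h ` T \<subseteq> {1}"
    by (rule Urysohn_lemma[of _ S T 0 1]) (use assms in \<open>auto simp: disjnt_def\<close>)
  from h(1) have "continuous_on UNIV h" "h x \<in> {0..1}" for x
    by (auto simp: continuous_map_in_subtopology image_subset_iff Pi_iff)
  with h show ?thesis by (intro exI[of _ h]) (auto simp: image_subset_iff)
qed

text \<open>\<open>\<Lambda>\<close> is total on real functions, but its laws bind it only on the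
  continuous ones.\<close>

locale positive_functional =
  fixes \<Lambda> :: "('a::t2_space \<Rightarrow> real) \<Rightarrow> real"
  assumes compact_UNIV: "compact (UNIV :: 'a set)"
    and add: "continuous_on UNIV f \<Longrightarrow> continuous_on UNIV g \<Longrightarrow> \<Lambda> (\<lambda>x. f x + g x) = \<Lambda> f + \<Lambda> g"
    and scale: "continuous_on UNIV f \<Longrightarrow> \<Lambda> (\<lambda>x. c * f x) = c * \<Lambda> f"
    and nonneg: "continuous_on UNIV f \<Longrightarrow> (\<And>x. 0 \<le> f x) \<Longrightarrow> 0 \<le> \<Lambda> f"
begin

lemma mono:
  assumes "continuous_on UNIV f" "continuous_on UNIV g" "\<And>x. f x \<le> g x"
  shows "\<Lambda> f \<le> \<Lambda> g"
proof -
  have "\<Lambda> (\<lambda>x. f x + (g x - f x)) = \<Lambda> f + \<Lambda> (\<lambda>x. g x - f x)"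
    using assms by (intro add continuous_intros)
  moreover have "0 \<le> \<Lambda> (\<lambda>x. g x - f x)"
    using assms by (intro nonneg continuous_intros) auto
  ultimately show ?thesis by simp
qed

text \<open>A test function only has to vanish off \<open>U\<close>; unlike in the usual definition
  its support may touch the boundary. The gap is closed by \<open>cut_le\<close>.\<close>

definition test :: "('a \<Rightarrow> real) \<Rightarrow> 'a set \<Rightarrow> bool" where
  "test f U \<longleftrightarrow> continuous_on UNIV f \<and> (\<forall>x. 0 \<le> f x \<and> f x \<le> indicator U x)"

lemma testI:
  "continuous_on UNIV f \<Longrightarrow> (\<And>x. 0 \<le> f x) \<Longrightarrow> (\<And>x. f x \<le> 1) \<Longrightarrow> (\<And>x. x \<notin> U \<Longrightarrow> f x = 0) \<Longrightarrow> test f U"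
  by (auto simp: test_def indicator_def)

lemma testD:
  assumes "test f U"
  shows "continuous_on UNIV f" "0 \<le> f x" "f x \<le> 1" "x \<notin> U \<Longrightarrow> f x = 0"
proof -
  have "0 \<le> f x \<and> f x \<le> indicator U x" using assms by (auto simp: test_def)
  then show "0 \<le> f x" "f x \<le> 1" "x \<notin> U \<Longrightarrow> f x = 0"
    by (auto simp: indicator_def of_bool_def split: if_splits)
qed (use assms in \<open>auto simp: test_def\<close>)

text \<open>The Riesz content, meant for open \<open>U\<close>; in \<open>ennreal\<close> the
  supremum exists unconditionally.\<close>

definition vol :: "'a set \<Rightarrow> ennreal" where
  "vol U = (SUP f\<in>{f. test f U}. ennreal (\<Lambda> f))"

lemma vol_ge: "test f U \<Longrightarrow> ennreal (\<Lambda> f) \<le> vol U"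
  unfolding vol_def by (auto intro: SUP_upper)

lemma vol_le: "(\<And>f. test f U \<Longrightarrow> ennreal (\<Lambda> f) \<le> c) \<Longrightarrow> vol U \<le> c"
  unfolding vol_def by (auto intro: SUP_least)

lemma vol_mono: "U \<subseteq> V \<Longrightarrow> vol U \<le> vol V"
  by (intro vol_le vol_ge testI) (auto dest: testD)

lemma vol_UNIV: "vol UNIV = ennreal (\<Lambda> (\<lambda>_. 1))"
proof (rule antisym)
  show "vol UNIV \<le> ennreal (\<Lambda> (\<lambda>_. 1))"
    by (intro vol_le ennreal_leI mono) (auto dest: testD)
  show "ennreal (\<Lambda> (\<lambda>_. 1)) \<le> vol UNIV"
    by (intro vol_ge testI) auto
qed

lemma vol_empty: "vol {} = 0"
proof -
  have "\<Lambda> f = 0" if "test f {}" for f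
  proof -
    have "f = (\<lambda>x. 0 * f x)" using testD[OF that] by auto
    then show ?thesis using scale[OF testD(1)[OF that], of 0] by simp
  qed
  then have "vol {} \<le> 0" by (intro vol_le) auto
  then show ?thesis by simp
qed

text \<open>Truncation at height \<open>e\<close> costs at most \<open>e\<close> times the
  functional at 1, and \<open>max (f x - e) 0\<close> lives on the compact set where
  \<open>e <= f x\<close>, inside \<open>U\<close>. Estimates of \<open>vol\<close> may thus use
  compactness.\<close>

lemma cut_le:
  assumes f: "test f U" and c: "\<And>e. e > 0 \<Longrightarrow> ennreal (\<Lambda> (\<lambda>x. max (f x - e) 0)) \<le> c"
  shows "ennreal (\<Lambda> f) \<le> c"
proof (rule ennreal_le_epsilon)
  fix e :: real assume e: "0 < e"
  have cf: "continuous_on UNIV f" using f by (rule testD)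
  have one: "0 \<le> \<Lambda> (\<lambda>_. 1)" by (intro nonneg) auto
  \<comment> \<open>The added 1 keeps the quotient defined when the functional vanishes at
    1.\<close>
  define d where "d = e / (\<Lambda> (\<lambda>_. 1) + 1)"
  have d: "d > 0" "d * \<Lambda> (\<lambda>_. 1) \<le> e" using e one by (auto simp: d_def field_simps)
  let ?g = "\<lambda>x. max (f x - d) 0"
  have cg: "continuous_on UNIV ?g" by (intro continuous_intros cf)
  have "\<Lambda> f \<le> \<Lambda> (\<lambda>x. ?g x + d * 1)"
    by (intro mono cf continuous_intros) auto
  also have "\<dots> = \<Lambda> ?g + \<Lambda> (\<lambda>x. d * 1)"
    by (intro add cg) auto
  also have "\<Lambda> (\<lambda>x. d * 1) = d * \<Lambda> (\<lambda>_. 1)"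
    by (intro scale) auto
  finally have "\<Lambda> f \<le> \<Lambda> ?g + e" using d by linarith
  then have "ennreal (\<Lambda> f) \<le> ennreal (\<Lambda> ?g + e)" by (rule ennreal_leI)
  also have "\<dots> = ennreal (\<Lambda> ?g) + ennreal e"
    using e cg by (intro ennreal_plus nonneg) auto
  also have "\<dots> \<le> c + ennreal e" using c[OF d(1)] by (rule add_right_mono)
  finally show "ennreal (\<Lambda> f) \<le> c + ennreal e" .
qed

lemma superlevel_compact: "continuous_on UNIV f \<Longrightarrow> compact {x :: 'a. (e::real) \<le> f x}"
  using compact_Int_closed[OF compact_UNIV closed_Collect_le[of "\<lambda>_. e" f]] by simp

text \<open>A Urysohn function for the disjoint closed sets \<open>?K - U\<close> and
  \<open>?K - V\<close> splits the truncated test function into a test function of \<open>U\<close>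
  and one of \<open>V\<close>.\<close>

lemma vol_Un: 
  assumes U: "open U" and V: "open V"
  shows "vol (U \<union> V) \<le> vol U + vol V"
proof (rule vol_le, rule cut_le, assumption)
  fix f e assume f: "test f (U \<union> V)" and e: "(e::real) > 0"
  note fD = testD[OF f]
  let ?K = "{x. e \<le> f x}" and ?g = "\<lambda>x. max (f x - e) 0"
  have K: "closed ?K" using superlevel_compact[OF fD(1)] by (rule compact_imp_closed)
  have disj: "(?K - U) \<inter> (?K - V) = {}"
  proof (rule equals0I)
    fix x assume "x \<in> (?K - U) \<inter> (?K - V)"
    then show False using fD(4)[of x] e by auto
  qed
  obtain h :: "'a \<Rightarrow> real" where h: "continuous_on UNIV h" "\<And>x. 0 \<le> h x \<and> h x \<le> 1"
    "\<And>x. x \<in> ?K - U \<Longrightarrow> h x = 0" "\<And>x. x \<in> ?K - V \<Longrightarrow> h x = 1"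
    using compact_t2_separation[OF compact_UNIV closed_Diff[OF K U] closed_Diff[OF K V] disj] by blast
  have cg: "continuous_on UNIV ?g" by (intro continuous_intros fD)
  have g1: "?g x \<le> 1" for x using fD(3)[of x] e by auto
  have t1: "test (\<lambda>x. ?g x * h x) U"
  proof (rule testI)
    show "continuous_on UNIV (\<lambda>x. ?g x * h x)" using cg h(1) by (rule continuous_on_mult)
    show "?g x * h x \<le> 1" for x using g1[of x] h(2)[of x] by (intro mult_le_one) auto
    show "x \<notin> U \<Longrightarrow> ?g x * h x = 0" for x using h(3)[of x] by (cases "e \<le> f x") auto
  qed (use h in auto)
  have t2: "test (\<lambda>x. ?g x * (1 - h x)) V"
  proof (rule testI)
    show "continuous_on UNIV (\<lambda>x. ?g x * (1 - h x))" using cg h(1) by (intro continuous_intros fD)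
    show "?g x * (1 - h x) \<le> 1" for x using g1[of x] h(2)[of x] by (intro mult_le_one) auto
    show "x \<notin> V \<Longrightarrow> ?g x * (1 - h x) = 0" for x using h(4)[of x] by (cases "e \<le> f x") auto
  qed (use h in auto)
  have "\<Lambda> ?g = \<Lambda> (\<lambda>x. ?g x * h x + ?g x * (1 - h x))"
    by (simp add: algebra_simps)
  also have "\<dots> = \<Lambda> (\<lambda>x. ?g x * h x) + \<Lambda> (\<lambda>x. ?g x * (1 - h x))"
    using testD(1)[OF t1] testD(1)[OF t2] by (rule add)
  finally have "ennreal (\<Lambda> ?g) = ennreal (\<Lambda> (\<lambda>x. ?g x * h x)) + ennreal (\<Lambda> (\<lambda>x. ?g x * (1 - h x)))"
    using t1 t2 by (auto intro!: ennreal_plus nonneg dest: testD)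
  also have "\<dots> \<le> vol U + vol V"
    using t1 t2 by (intro add_mono vol_ge)
  finally show "ennreal (\<Lambda> ?g) \<le> vol U + vol V" .
qed

lemma vol_finite_UN:
  assumes "finite D" "\<And>i. i \<in> D \<Longrightarrow> open (U i)"
  shows "vol (\<Union>i\<in>D. U i) \<le> (\<Sum>i\<in>D. vol (U i))"
  using assms
proof (induction D rule: finite_induct)
  case (insert i D)
  have "vol (\<Union>j\<in>insert i D. U j) \<le> vol (U i) + vol (\<Union>j\<in>D. U j)"
    using insert.prems vol_Un[of "U i" "\<Union>j\<in>D. U j"] by auto
  also have "\<dots> \<le> vol (U i) + (\<Sum>i\<in>D. vol (U i))"
    using insert by (intro add_left_mono) auto
  finally show ?case using insert by simp
qed (simp add: vol_empty)

text \<open>The compact set where \<open>e <= f x\<close> is covered by finitely many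
  \<open>U i\<close>, and the truncation is a test function of their union; this reduces the claim
  to the finite case.\<close>

lemma vol_UN:
  fixes U :: "nat \<Rightarrow> 'a set"
  assumes U: "\<And>i. open (U i)"
  shows "vol (\<Union>i. U i) \<le> (\<Sum>i. vol (U i))"
proof (rule vol_le, rule cut_le, assumption)
  fix f e assume f: "test f (\<Union>i. U i)" and e: "(e::real) > 0"
  note fD = testD[OF f]
  let ?K = "{x. e \<le> f x}" and ?g = "\<lambda>x. max (f x - e) 0"
  have "?K \<subseteq> (\<Union>i. U i)"
  proof
    fix x assume "x \<in> ?K"
    then show "x \<in> (\<Union>i. U i)" using fD(4)[of x] e by (cases "x \<in> (\<Union>i. U i)") auto
  qed
  then obtain D where D: "finite D" "?K \<subseteq> (\<Union>i\<in>D. U i)"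
    using compactE_image[OF superlevel_compact[OF fD(1)], of UNIV U] U by metis
  have "test ?g (\<Union>i\<in>D. U i)"
  proof (rule testI)
    show "continuous_on UNIV ?g" by (intro continuous_intros fD)
    show "?g x \<le> 1" for x using fD(3)[of x] e by auto
    show "?g x = 0" if "x \<notin> (\<Union>i\<in>D. U i)" for x
    proof -
      have "x \<notin> ?K" using that D by blast
      then show ?thesis by simp
    qed
  qed auto
  then have "ennreal (\<Lambda> ?g) \<le> vol (\<Union>i\<in>D. U i)" by (rule vol_ge)
  also have "\<dots> \<le> (\<Sum>i\<in>D. vol (U i))"
    using D U by (intro vol_finite_UN) auto
  also have "\<dots> \<le> (\<Sum>i. vol (U i))"
    using D by (intro sum_le_suminf) auto
  finally show "ennreal (\<Lambda> ?g) \<le> (\<Sum>i. vol (U i))" .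
qed

definition outer :: "'a set \<Rightarrow> ennreal" where
  "outer E = (INF U\<in>{U. open U \<and> E \<subseteq> U}. vol U)"

lemma outer_open: "open U \<Longrightarrow> outer U = vol U"
  unfolding outer_def by (intro antisym INF_lower INF_greatest) (auto intro: vol_mono)

lemma outer_mono: "E \<subseteq> F \<Longrightarrow> outer E \<le> outer F"
  unfolding outer_def by (intro INF_superset_mono) auto

lemma outer_finite: "outer E < top"
proof -
  have "outer E \<le> vol UNIV" using outer_mono[of E UNIV] outer_open[of UNIV] by simp
  then show ?thesis using vol_UNIV by (simp add: le_less_trans)
qed

lemma outer_approx:
  assumes "e > 0"
  obtains U where "open U" "E \<subseteq> U" "vol U \<le> outer E + ennreal e"
proof -
  have "outer E < outer E + ennreal e"
    using assms outer_finite[of E] by (simp add: ennreal_add_left_cancel_less ennreal_less_zero_iff)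
  then obtain U where "U \<in> {U. open U \<and> E \<subseteq> U}" "vol U < outer E + ennreal e"
    unfolding outer_def INF_less_iff by auto
  with that show thesis by auto
qed

lemma outer_UN:
  fixes E :: "nat \<Rightarrow> 'a set"
  shows "outer (\<Union>i. E i) \<le> (\<Sum>i. outer (E i))"
proof (rule ennreal_le_epsilon)
  fix e :: real assume e: "0 < e"
  have "\<exists>U. open U \<and> E i \<subseteq> U \<and> vol U \<le> outer (E i) + ennreal (e * (1/2) ^ Suc i)" for i
    using outer_approx[of "e * (1/2) ^ Suc i" "E i"] e by (metis divide_pos_pos mult_pos_pos zero_less_numeral zero_less_one zero_less_power)
  then obtain U where U: "\<And>i. open (U i)" "\<And>i. E i \<subseteq> U i"
      "\<And>i. vol (U i) \<le> outer (E i) + ennreal (e * (1/2) ^ Suc i)"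
    by metis
  have "(\<lambda>i. e * (1/2) ^ Suc i) sums (e * 1)"
    by (intro sums_mult power_half_series)
  then have s: "(\<Sum>i. ennreal (e * (1/2) ^ Suc i)) = ennreal e"
    using e by (intro suminf_ennreal_eq) auto
  have "outer (\<Union>i. E i) \<le> outer (\<Union>i. U i)"
    using U(2) by (intro outer_mono) blast
  also have "\<dots> = vol (\<Union>i. U i)" using U by (intro outer_open) auto
  also have "\<dots> \<le> (\<Sum>i. vol (U i))" using U by (intro vol_UN)
  also have "\<dots> \<le> (\<Sum>i. outer (E i) + ennreal (e * (1/2) ^ Suc i))"
    using U by (intro suminf_le) auto
  also have "\<dots> = (\<Sum>i. outer (E i)) + ennreal e"
    using s by (subst suminf_add[symmetric]) auto
  finally show "outer (\<Union>i. E i) \<le> (\<Sum>i. outer (E i)) + ennreal e" .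
qed

lemma outer_empty: "outer {} = 0"
  by (simp add: outer_open vol_empty)

lemma outer_measure_space_outer: "outer_measure_space (Pow UNIV) outer"
  by (auto simp: outer_measure_space_def positive_def increasing_def countably_subadditive_def
      outer_empty intro: outer_mono outer_UN)

lemma outer_Un: "outer (E \<union> F) \<le> outer E + outer F"
proof -
  have "outer (\<Union>i. if i = (0::nat) then E else if i = 1 then F else {}) \<le>
      (\<Sum>i. outer (if i = (0::nat) then E else if i = 1 then F else {}))"
    by (rule outer_UN)
  also have "(\<Union>i. if i = (0::nat) then E else if i = 1 then F else {}) = E \<union> F"
    by (auto split: if_splits)
  also have "(\<Sum>i. outer (if i = (0::nat) then E else if i = 1 then F else {})) = outer E + outer F"
    by (subst suminf_finite[of "{0, 1}"]) (auto simp: outer_empty)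
  finally show ?thesis .
qed

text \<open>Caratheodory's condition, first for an open set \<open>V\<close> in place of
  \<open>T\<close>: if \<open>?g\<close> is a truncated test function of the intersection and
  \<open>h\<close> a test function of the open set \<open>W\<close>, the two are never positive
  together, so their sum is a test function of \<open>V\<close>. Since \<open>W\<close> contains
  \<open>V - U\<close>, suprema over \<open>h\<close> and then over \<open>f\<close> give the
  inequality. Open supersets of \<open>T\<close> yield the general case.\<close>

lemma open_measurable:
  assumes U: "open U"
  shows "outer (T \<inter> U) + outer (T - U) \<le> outer T"
proof -
  have "outer (V \<inter> U) + outer (V - U) \<le> vol V" if V: "open V" for V
  proof -
    have "ennreal (\<Lambda> f) \<le> vol V - outer (V - U)" if f: "test f (V \<inter> U)" for f
    proof (rule cut_le[OF f])
      fix e :: real assume e: "e > 0"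
      note fD = testD[OF f]
      let ?g = "\<lambda>x. max (f x - e) 0"
      define W where "W = V - {x. e \<le> f x}"
      have W: "open W"
        unfolding W_def using V superlevel_compact[OF fD(1)] by (intro open_Diff compact_imp_closed)
      have VW: "V - U \<subseteq> W" 
      proof
        fix x assume "x \<in> V - U"
        then show "x \<in> W" using fD(4)[of x] e by (auto simp: W_def)
      qed
      have cg: "continuous_on UNIV ?g" by (intro continuous_intros fD)
      have "ennreal (\<Lambda> h) \<le> vol V - ennreal (\<Lambda> ?g)" if h: "test h W" for h
      proof -
        note hD = testD[OF h]
        have t: "test (\<lambda>x. ?g x + h x) V"
        proof (rule testI)
          show "continuous_on UNIV (\<lambda>x. ?g x + h x)" using cg hD(1) by (rule continuous_on_add)
          show "0 \<le> ?g x + h x" for x using hD(2)[of x] by auto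
          show "?g x + h x \<le> 1" for x
            using fD(3)[of x] hD(3)[of x] hD(4)[of x] e by (cases "e \<le> f x") (auto simp: W_def)
          show "?g x + h x = 0" if "x \<notin> V" for x
            using fD(4)[of x] hD(4)[of x] e that by (auto simp: W_def)
        qed
        have "ennreal (\<Lambda> h) + ennreal (\<Lambda> ?g) = ennreal (\<Lambda> h + \<Lambda> ?g)"
          using hD cg by (intro ennreal_plus[symmetric] nonneg) auto
        also have "\<Lambda> h + \<Lambda> ?g = \<Lambda> (\<lambda>x. ?g x + h x)"
          using add[OF cg hD(1)] by simp
        also have "ennreal \<dots> \<le> vol V" using t by (rule vol_ge)
        finally show ?thesis by (intro ennreal_le_minus_iff[THEN iffD2] disjI1) (auto simp: add.commute)
      qed
      then have le: "vol W \<le> vol V - ennreal (\<Lambda> ?g)" by (rule vol_le)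
      have gV: "ennreal (\<Lambda> ?g) \<le> vol V"
      proof (rule vol_ge, rule testI)
        show "?g x \<le> 1" for x using fD(3)[of x] e by auto
        show "?g x = 0" if "x \<notin> V" for x using fD(4)[of x] e that by auto
      qed (use cg in auto)
      have "outer (V - U) \<le> vol W"
        using outer_mono[OF VW] outer_open[OF W] by simp
      with le have "outer (V - U) \<le> vol V - ennreal (\<Lambda> ?g)" by (rule order_trans[rotated])
      then have "outer (V - U) + ennreal (\<Lambda> ?g) \<le> vol V"
        using add_right_mono[of "outer (V - U)" "vol V - ennreal (\<Lambda> ?g)" "ennreal (\<Lambda> ?g)"] gV
        by (simp add: diff_add_cancel_ennreal)
      then show "ennreal (\<Lambda> ?g) \<le> vol V - outer (V - U)"
        by (intro ennreal_le_minus_iff[THEN iffD2] disjI1) (simp add: add.commute)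
    qed
    then have le: "vol (V \<inter> U) \<le> vol V - outer (V - U)" by (rule vol_le)
    have "outer (V - U) \<le> vol V" using outer_mono[of "V - U" V] outer_open[OF V] by auto
    moreover have "outer (V \<inter> U) = vol (V \<inter> U)" using U V by (intro outer_open) auto
    ultimately show ?thesis
      using add_right_mono[OF le, of "outer (V - U)"] by (simp add: diff_add_cancel_ennreal)
  qed
  then have "outer (T \<inter> U) + outer (T - U) \<le> vol V" if "open V" "T \<subseteq> V" for V
    using that add_mono[OF outer_mono[of "T \<inter> U" "V \<inter> U"] outer_mono[of "T - U" "V - U"]]
    by (meson Diff_mono Int_mono order_refl order_trans)
  then show ?thesis unfolding outer_def[of T] by (intro INF_greatest) auto
qed

definition riesz_measure :: "'a measure" where
  "riesz_measure = measure_of UNIV (sets borel) outer"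

lemma sets_riesz [simp, measurable_cong]: "sets riesz_measure = sets borel"
  unfolding riesz_measure_def by (metis sets.sigma_sets_eq sets_measure_of space_borel sets.space_closed)

lemma space_riesz [simp]: "space riesz_measure = UNIV"
  using sets_eq_imp_space_eq[OF sets_riesz] by simp

text \<open>The Caratheodory system contains the open sets, hence all Borel sets, and the outer
  measure is countably additive there.\<close>

lemma emeasure_riesz: 
  assumes "B \<in> sets borel"
  shows "emeasure riesz_measure B = outer B"
proof -
  interpret P: sigma_algebra UNIV "Pow (UNIV :: 'a set)" by (rule sigma_algebra_Pow)
  let ?L = "lambda_system UNIV (Pow UNIV) outer"
  have ms: "measure_space UNIV ?L outer"
    by (rule P.caratheodory_lemma[OF outer_measure_space_outer])
  then interpret L: sigma_algebra UNIV ?L by (simp add: measure_space_def)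
  have op: "U \<in> ?L" if "open U" for U
  proof -
    have "outer (T \<inter> U) + outer (T - U) = outer T" for T
    proof (rule antisym[OF open_measurable[OF that]])
      have "outer T \<le> outer ((T \<inter> U) \<union> (T - U))" by (simp add: Int_Diff_Un)
      also have "\<dots> \<le> outer (T \<inter> U) + outer (T - U)" by (rule outer_Un)
      finally show "outer T \<le> outer (T \<inter> U) + outer (T - U)" .
    qed
    then show ?thesis by (subst P.lambda_system_eq) auto
  qed
  have sub: "sets borel \<subseteq> ?L"
  proof -
    have "sigma_sets UNIV {S. open S} \<subseteq> ?L"
      by (rule L.sigma_sets_subset) (use op in blast)
    then show ?thesis by (simp add: borel_def)
  qed
  have "countably_additive ?L outer" "positive ?L outer"
    using ms by (auto simp: measure_space_def)
  then have "countably_additive (sets borel) outer" "positive (sets borel) outer"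
    using sub unfolding countably_additive_def positive_def by (meson subset_trans subsetD)+
  then show ?thesis
    using assms by (intro emeasure_measure_of[OF riesz_measure_def]) auto
qed

lemma finite_riesz: "finite_measure riesz_measure"
  by (rule finite_measureI) (use outer_finite[of UNIV] in \<open>auto simp: emeasure_riesz\<close>)

lemma measure_riesz_UNIV: "measure riesz_measure UNIV = \<Lambda> (\<lambda>_. 1)"
  by (simp add: measure_def emeasure_riesz outer_open vol_UNIV nonneg)

lemma test_le_measure: "test f U \<Longrightarrow> open U \<Longrightarrow> \<Lambda> f \<le> measure riesz_measure U"
proof -
  interpret finite_measure riesz_measure by (rule finite_riesz)
  assume f: "test f U" and U: "open U"
  have "ennreal (\<Lambda> f) \<le> emeasure riesz_measure U"
    using vol_ge[OF f] outer_open[OF U] U by (simp add: emeasure_riesz)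
  then show ?thesis by (simp add: emeasure_eq_measure)
qed

lemma sum_functional:
  "finite I \<Longrightarrow> (\<And>i. i \<in> I \<Longrightarrow> continuous_on UNIV (f i)) \<Longrightarrow> \<Lambda> (\<lambda>x. \<Sum>i\<in>I. f i x) = (\<Sum>i\<in>I. \<Lambda> (f i))"
proof (induction I rule: finite_induct)
  case empty
  show ?case using scale[of "\<lambda>_. 0" 0] by simp
next
  case (insert i I)
  then show ?case by (simp add: add continuous_on_sum)
qed

lemma integrable_riesz:
  assumes "continuous_on UNIV (f :: 'a \<Rightarrow> real)"
  shows "integrable riesz_measure f"
proof -
  interpret finite_measure riesz_measure by (rule finite_riesz)
  have "bounded (range f)"
    using compact_continuous_image[OF assms compact_UNIV] by (rule compact_imp_bounded)
  then obtain B where "\<And>x. norm (f x) \<le> B" by (auto simp: bounded_iff)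
  moreover have "f \<in> borel_measurable riesz_measure"
    using borel_measurable_continuous_onI[OF assms] by (simp cong: measurable_cong_sets)
  ultimately show ?thesis by (intro integrable_const_bound[of _ B]) auto
qed

text \<open>Layer cake: \<open>f\<close> is the sum of the slices \<open>s k\<close> between the heights \<open>k/n\<close> and \<open>(k+1)/n\<close>.\<close>

lemma riesz_le_unit:
  assumes f: "continuous_on UNIV f" "\<And>x. 0 \<le> f x" "\<And>x. f x \<le> 1"
  shows "\<Lambda> f \<le> (LINT x|riesz_measure. f x)"
proof -
  interpret finite_measure riesz_measure by (rule finite_riesz)
  have bound: "\<Lambda> f - (LINT x|riesz_measure. f x) \<le> inverse (real n) * measure riesz_measure UNIV" if n: "n > 0" for n :: nat
  proof -
    define s where "s k x = min (max (f x - k / n) 0) (1 / n)" for k :: nat and x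
    define a where "a k = measure riesz_measure {x. k / n < f x}" for k :: nat
    have op: "open {x. real k / real n < f x}" for k :: nat
      using f(1) by (intro open_Collect_less continuous_intros)
    have cs: "continuous_on UNIV (s k)" for k
      unfolding s_def by (intro continuous_intros f)
    have "(\<Sum>k<N. s k x) = min (f x) (N / n)" for x N
    proof (induction N)
      case (Suc N)
      have "real (Suc N) / real n = real N / real n + 1 / real n" by (simp add: add_divide_distrib)
      moreover have "min (f x) t + min (max (f x - t) 0) d = min (f x) (t + d)" if "d \<ge> 0" for t d :: real
        using that by (auto simp: min_def max_def)
      ultimately show ?case using Suc by (simp add: s_def)
    qed (use f in simp)
    then have sum: "f = (\<lambda>x. \<Sum>k<n. s k x)" using n f(3) by auto
    \<comment> \<open>The function \<open>n * s k\<close> is squeezed between the indicators of two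
      successive superlevel sets. Testing bounds \<open>n\<close> times the functional above by
      \<open>a k\<close>, integrating bounds \<open>n\<close> times the integral below by
      \<open>a (Suc k)\<close>; the differences telescope.\<close>
    have "\<Lambda> (s k) - (LINT x|riesz_measure. s k x) \<le> inverse n * (a k - a (Suc k))" for k
    proof -
      have "test (\<lambda>x. n * s k x) {x. k / n < f x}"
      proof (rule testI)
        show "continuous_on UNIV (\<lambda>x. n * s k x)" by (intro continuous_intros cs)
      qed (use n in \<open>auto simp: s_def min_def max_def field_simps\<close>)
      then have "\<Lambda> (\<lambda>x. n * s k x) \<le> a k"
        unfolding a_def using op by (rule test_le_measure)
      then have 1: "n * \<Lambda> (s k) \<le> a k" by (simp add: scale[OF cs])
      have "a (Suc k) = (LINT x|riesz_measure. indicator {x. real (Suc k) / real n < f x} x)"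
        using op[of "Suc k"] by (simp add: a_def)
      also have "\<dots> \<le> (LINT x|riesz_measure. n * s k x)"
      proof (rule integral_mono)
        show "integrable riesz_measure (indicator {x. real (Suc k) / real n < f x} :: _ \<Rightarrow> real)"
          using op[of "Suc k"] by (simp add: integrable_indicator_iff emeasure_eq_measure)
        show "integrable riesz_measure (\<lambda>x. n * s k x)"
          by (intro integrable_riesz continuous_intros cs)
        show "indicator {x. real (Suc k) / real n < f x} x \<le> real n * s k x" for x
        proof (cases "real (Suc k) / real n < f x")
          case True
          have "real (Suc k) / real n = real k / real n + 1 / real n" by (simp add: add_divide_distrib)
          with True have "s k x = 1 / n" by (simp add: s_def)
          then show ?thesis using n by (simp add: indicator_def)
        qed (simp add: s_def)
      qed
      finally have 2: "a (Suc k) \<le> n * (LINT x|riesz_measure. s k x)" by simp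
      show ?thesis using 1 2 n by (simp add: field_simps)
    qed
    then have "(\<Sum>k<n. \<Lambda> (s k) - (LINT x|riesz_measure. s k x)) \<le> (\<Sum>k<n. inverse n * (a k - a (Suc k)))"
      by (intro sum_mono)
    also have "\<dots> = inverse n * (a 0 - a n)"
      by (simp add: sum_distrib_left[symmetric] sum_lessThan_telescope')
    also have "\<dots> \<le> inverse n * measure riesz_measure UNIV"
      using finite_measure_mono[of "{x. 0 < f x}" UNIV] by (intro mult_left_mono) (auto simp: a_def intro: order_trans[of _ "measure riesz_measure {x. 0 < f x}"])
    also have "(\<Sum>k<n. \<Lambda> (s k) - (LINT x|riesz_measure. s k x)) = \<Lambda> f - (LINT x|riesz_measure. f x)"
    proof -
      have "\<Lambda> f = (\<Sum>k<n. \<Lambda> (s k))" 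
        by (subst sum) (intro sum_functional cs finite_lessThan)
      moreover have "(LINT x|riesz_measure. f x) = (\<Sum>k<n. LINT x|riesz_measure. s k x)"
        by (subst sum) (intro Bochner_Integration.integral_sum integrable_riesz cs)
      ultimately show ?thesis by (simp add: sum_subtractf)
    qed
    finally show ?thesis .
  qed
  have "(\<lambda>n. inverse (real n) * measure riesz_measure UNIV) \<longlonglongrightarrow> 0 * measure riesz_measure UNIV"
    by (intro tendsto_mult lim_inverse_n tendsto_const)
  then have "\<Lambda> f - (LINT x|riesz_measure. f x) \<le> 0 * measure riesz_measure UNIV"
    using bound by (intro tendsto_lowerbound[where F = sequentially]) (auto intro!: eventually_sequentiallyI[of 1])
  then show ?thesis by simp
qed

text \<open>For values in [0,1] the one-sided bound is applied to \<open>f\<close> and to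
  \<open>1 - f\<close>; the total mass equals the functional at 1, so both are equalities. An affine
  rescaling reaches every bounded \<open>f\<close>.\<close>

theorem riesz_representation:
  assumes f: "continuous_on UNIV f"
  shows "(LINT x|riesz_measure. f x) = \<Lambda> f"
proof -
  interpret finite_measure riesz_measure by (rule finite_riesz)
  have unit: "(LINT x|riesz_measure. f x) = \<Lambda> f"
    if f: "continuous_on UNIV f" "\<And>x. 0 \<le> f x" "\<And>x. f x \<le> 1" for f
  proof (rule antisym)
    show "\<Lambda> f \<le> (LINT x|riesz_measure. f x)" using f by (rule riesz_le_unit)
    have "\<Lambda> (\<lambda>x. 1 + (-1) * f x) \<le> (LINT x|riesz_measure. 1 + (-1) * f x)"
      using f by (intro riesz_le_unit continuous_intros) auto
    moreover have "\<Lambda> (\<lambda>x. 1 + (-1) * f x) = \<Lambda> (\<lambda>_. 1) + \<Lambda> (\<lambda>x. (-1) * f x)"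
      by (rule add) (intro continuous_intros f)+
    moreover have "\<Lambda> (\<lambda>x. (-1) * f x) = (-1) * \<Lambda> f" by (rule scale[OF f(1)])
    ultimately show "(LINT x|riesz_measure. f x) \<le> \<Lambda> f"
      using integrable_riesz[OF f(1)] measure_riesz_UNIV by simp
  qed
  have "bounded (range f)"
    using compact_continuous_image[OF assms compact_UNIV] by (rule compact_imp_bounded)
  then obtain B where B: "B > 0" "\<And>x. \<bar>f x\<bar> \<le> B" by (auto simp: bounded_pos)
  define g where "g x = (1 / (2 * B)) * f x + 1/2" for x
  have "0 \<le> g x \<and> g x \<le> 1" for x using B(1) B(2)[of x] by (auto simp: g_def field_simps abs_le_iff)
  moreover have cg: "continuous_on UNIV g" unfolding g_def by (intro continuous_intros f)
  ultimately have g: "(LINT x|riesz_measure. g x) = \<Lambda> g" by (intro unit) auto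
  have c: "(LINT x|riesz_measure. 1) = \<Lambda> (\<lambda>_. 1)" by (intro unit) auto
  have eq: "f = (\<lambda>x. (2 * B) * g x + (- B) * 1)" using B by (auto simp: g_def field_simps)
  have "\<Lambda> f = \<Lambda> (\<lambda>x. (2 * B) * g x) + \<Lambda> (\<lambda>x. (- B) * 1)"
    by (subst eq) (intro add continuous_intros cg)
  also have "\<dots> = (2 * B) * \<Lambda> g + (- B) * \<Lambda> (\<lambda>_. 1)"
    using scale[OF cg, of "2 * B"] scale[of "\<lambda>_. 1" "- B"] by simp
  also have "\<dots> = (LINT x|riesz_measure. (2 * B) * g x + (- B) * 1)"
    using integrable_riesz[OF cg] g c by simp
  finally show ?thesis using eq by simp
qed

text \<open>Outer regularity is built into \<open>outer\<close>. Inner regularity follows by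
  complements: an open set that barely exceeds \<open>- B\<close> has a closed, hence compact,
  complement that nearly fills \<open>B\<close>.\<close>

lemma regular_riesz: "regular_borel_measure riesz_measure"
  unfolding regular_borel_measure_def
proof (intro conjI ballI finite_riesz sets_riesz)
  interpret finite_measure riesz_measure by (rule finite_riesz)
  fix B :: "'a set" assume B: "B \<in> sets borel"
  show "emeasure riesz_measure B = (INF U\<in>{U. open U \<and> B \<subseteq> U}. emeasure riesz_measure U)"
    unfolding emeasure_riesz[OF B] outer_def by (intro INF_cong) (auto simp: emeasure_riesz outer_open)
  show "emeasure riesz_measure B = (SUP K\<in>{K. compact K \<and> K \<subseteq> B}. emeasure riesz_measure K)"
  proof (rule antisym)
    show "(SUP K\<in>{K. compact K \<and> K \<subseteq> B}. emeasure riesz_measure K) \<le> emeasure riesz_measure B"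
      using B by (intro SUP_least emeasure_mono) auto
    show "emeasure riesz_measure B \<le> (SUP K\<in>{K. compact K \<and> K \<subseteq> B}. emeasure riesz_measure K)"
    proof (rule ennreal_le_epsilon)
      fix e :: real assume e: "0 < e"
      obtain U where U: "open U" "- B \<subseteq> U" "vol U \<le> outer (- B) + ennreal e"
        using outer_approx[OF e] .
      have "emeasure riesz_measure U \<le> emeasure riesz_measure (- B) + ennreal e"
        using U B by (simp add: emeasure_riesz outer_open)
      then have m: "measure riesz_measure U \<le> measure riesz_measure (- B) + e"
        using e by (simp add: emeasure_eq_measure ennreal_plus[symmetric] del: ennreal_plus)
      have K: "compact (- U)" using U(1) compact_Int_closed[OF compact_UNIV, of "- U"] by auto
      have "measure riesz_measure (- B) = measure riesz_measure UNIV - measure riesz_measure B"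
        "measure riesz_measure (- U) = measure riesz_measure UNIV - measure riesz_measure U"
        using finite_measure_compl[of B] finite_measure_compl[of U] B U(1) by (auto simp: Compl_eq_Diff_UNIV)
      with m have "measure riesz_measure B \<le> measure riesz_measure (- U) + e" by simp
      then have "emeasure riesz_measure B \<le> emeasure riesz_measure (- U) + ennreal e"
        using e by (simp add: emeasure_eq_measure ennreal_plus[symmetric] del: ennreal_plus)
      also have "\<dots> \<le> (SUP K\<in>{K. compact K \<and> K \<subseteq> B}. emeasure riesz_measure K) + ennreal e"
        using K U(2) by (intro add_right_mono SUP_upper) auto
      finally show "emeasure riesz_measure B \<le> (SUP K\<in>{K. compact K \<and> K \<subseteq> B}. emeasure riesz_measure K) + ennreal e" .
    qed
  qed
qed

end

section \<open>Continuous functions as a complex vector space\<close>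

lemma bcontfun_compact:
  fixes f :: "'a::topological_space \<Rightarrow> 'b::metric_space"
  assumes "compact (UNIV :: 'a set)" "continuous_on UNIV f"
  shows "apply_bcontfun (Bcontfun f) = f"
  using assms compact_imp_bounded[OF compact_continuous_image[OF assms(2,1)]]
  by (intro Bcontfun_inverse) (auto simp: bcontfun_def)

lemma apply_bcontfun_sum: "apply_bcontfun (sum f I) x = (\<Sum>i\<in>I. apply_bcontfun (f i) x)"
  by (induction I rule: infinite_finite_induct) auto

definition complex_subspace :: "('a::topological_space \<Rightarrow>\<^sub>C complex) set \<Rightarrow> bool" where
  "complex_subspace A \<longleftrightarrow> 0 \<in> A \<and> (\<forall>f\<in>A. \<forall>h\<in>A. f + h \<in> A) \<and> (\<forall>c. \<forall>f\<in>A. const_bcontfun c * f \<in> A)"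

lemma scaleR_eq_const_mult: "r *\<^sub>R (f :: 'a::topological_space \<Rightarrow>\<^sub>C complex) = const_bcontfun (complex_of_real r) * f"
  by (rule bcontfun_eqI) (simp add: scaleR_conv_of_real)

lemma complex_subspace_sum:
  "complex_subspace A \<Longrightarrow> (\<And>s. s \<in> S \<Longrightarrow> F s \<in> A) \<Longrightarrow> (\<Sum>s\<in>S. const_bcontfun (c s) * F s) \<in> A"
  by (induction S rule: infinite_finite_induct) (auto simp: complex_subspace_def)

lemma complex_subspace_diff: "complex_subspace A \<Longrightarrow> f \<in> A \<Longrightarrow> h \<in> A \<Longrightarrow> f - h \<in> A"
proof -
  assume A: "complex_subspace A" "f \<in> A" "h \<in> A"
  have "f - h = f + const_bcontfun (- 1) * h" by (rule bcontfun_eqI) simp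
  with A show ?thesis unfolding complex_subspace_def by metis
qed

section \<open>Extension of functionals to measures\<close>

text \<open>For \<open>c = \<i> ^ k\<close> this is the real function that the \<open>k\<close>-th
  measure integrates in the real part of \<open>complex_measure_integral\<close>.\<close>

lift_definition rot_Re :: "complex \<Rightarrow> ('a::topological_space \<Rightarrow>\<^sub>C complex) \<Rightarrow> 'a \<Rightarrow>\<^sub>C real"
  is "\<lambda>c f x. Re (c * f x)"
proof -
  fix c and f :: "'a \<Rightarrow> complex" assume f: "f \<in> bcontfun"
  then obtain B where "\<And>x. norm (f x) \<le> B" by (auto simp: bcontfun_def bounded_iff)
  then have "norm (Re (c * f x)) \<le> cmod c * B" for x
    using abs_Re_le_cmod[of "c * f x"] mult_left_mono[of "cmod (f x)" B "cmod c"] by (simp add: norm_mult)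
  with f show "(\<lambda>x. Re (c * f x)) \<in> bcontfun"
    by (intro bcontfun_normI[where b = "cmod c * B"]) (auto simp: bcontfun_def intro!: continuous_intros)
qed

text \<open>A linear functional dominated by \<open>K * pos_sup\<close> is positive, because the
  positive part of \<open>- f\<close> vanishes for \<open>f >= 0\<close>, and its value at 1 is at
  most \<open>K\<close>. This choice makes Hahn-Banach yield measures of controlled mass.\<close>

definition pos_sup :: "('a::topological_space \<Rightarrow>\<^sub>C real) \<Rightarrow> real" where
  "pos_sup f = (SUP x. max 0 (f x))"

lemma pos_sup_upper: "max 0 (apply_bcontfun f x) \<le> pos_sup f"
proof -
  have "max 0 (apply_bcontfun f x) \<le> norm f" for x using norm_bounded[of f x] by (simp add: abs_le_iff)
  then show ?thesis unfolding pos_sup_def by (intro cSUP_upper bdd_aboveI2[where M = "norm f"]) auto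
qed

lemma pos_sup_least: "(\<And>x. max 0 (apply_bcontfun f x) \<le> c) \<Longrightarrow> pos_sup f \<le> c"
  unfolding pos_sup_def by (intro cSUP_least) auto

lemma sublinear_pos_sup: "sublinear pos_sup"
  unfolding sublinear_def
proof (intro conjI allI impI)
  fix f g :: "'a \<Rightarrow>\<^sub>C real"
  show "pos_sup (f + g) \<le> pos_sup f + pos_sup g"
  proof (rule pos_sup_least)
    fix x show "max 0 (apply_bcontfun (f + g) x) \<le> pos_sup f + pos_sup g"
      using pos_sup_upper[of f x] pos_sup_upper[of g x] by simp
  qed
next
  fix t :: real and f :: "'a \<Rightarrow>\<^sub>C real" assume t: "0 \<le> t"
  have le: "pos_sup (t *\<^sub>R f) \<le> t * pos_sup f" if t: "0 \<le> t" for t and f :: "'a \<Rightarrow>\<^sub>C real"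
  proof (rule pos_sup_least)
    fix x
    have "0 \<le> pos_sup f" "f x \<le> pos_sup f" using pos_sup_upper[of f x] by auto
    with t show "max 0 (apply_bcontfun (t *\<^sub>R f) x) \<le> t * pos_sup f" by (simp add: mult_left_mono)
  qed
  show "pos_sup (t *\<^sub>R f) = t * pos_sup f"
  proof (cases "t = 0")
    case True
    then show ?thesis using le[of 0 f] pos_sup_upper[of "0 *\<^sub>R f"] by simp
  next
    case False
    with t have t: "t > 0" by simp
    have "pos_sup ((1 / t) *\<^sub>R t *\<^sub>R f) \<le> (1 / t) * pos_sup (t *\<^sub>R f)"
      using t by (intro le) simp
    then have "t * pos_sup f \<le> pos_sup (t *\<^sub>R f)" using t by (simp add: field_simps)
    with le[of t f] t show ?thesis by simp
  qed
qed

type_synonym 'a quad = "('a \<Rightarrow>\<^sub>C real) \<times> ('a \<Rightarrow>\<^sub>C real) \<times> ('a \<Rightarrow>\<^sub>C real) \<times> ('a \<Rightarrow>\<^sub>C real)"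

text \<open>
  A Hahn-Banach extension dominated by the sum of the four positive parts is a sum of four
  \<^emph>\<open>positive\<close> functionals, so that no separate Jordan decomposition is needed.
\<close>

theorem exists_measure_extends:
  fixes A :: "('a::t2_space \<Rightarrow>\<^sub>C complex) set"
  assumes comp: "compact (UNIV :: 'a set)" and A: "complex_subspace A"
    and add: "\<And>f h. f \<in> A \<Longrightarrow> h \<in> A \<Longrightarrow> \<phi> (f + h) = \<phi> f + \<phi> h"
    and scale: "\<And>c f. f \<in> A \<Longrightarrow> \<phi> (const_bcontfun c * f) = c * \<phi> f"
    and K: "0 \<le> K" "\<And>f. f \<in> A \<Longrightarrow> cmod (\<phi> f) \<le> K * norm f"
  obtains \<mu> where "measure_extends A \<mu> \<phi>" "\<And>k. k < 4 \<Longrightarrow> measure (\<mu> k) UNIV \<le> K"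
proof -
  let ?s = "pos_sup :: ('a \<Rightarrow>\<^sub>C real) \<Rightarrow> real"
  define p :: "'a quad \<Rightarrow> real" where "p = (\<lambda>(a, b, c, d). K * (?s a + ?s b + ?s c + ?s d))"
  define E :: "('a \<Rightarrow>\<^sub>C complex) \<Rightarrow> 'a quad" where
    "E f = (rot_Re 1 f, rot_Re \<i> f, rot_Re (- 1) f, rot_Re (- \<i>) f)" for f
  have rot_add: "rot_Re c (f + h) = rot_Re c f + rot_Re c h" for c f h
    by (rule bcontfun_eqI) (simp add: rot_Re.rep_eq algebra_simps)
  have rot_scale: "rot_Re c (t *\<^sub>R f) = t *\<^sub>R rot_Re c f" for c t f
    by (rule bcontfun_eqI) (simp add: rot_Re.rep_eq algebra_simps)
  have s_add: "?s (f + g) \<le> ?s f + ?s g" and s_scale: "0 \<le> t \<Longrightarrow> ?s (t *\<^sub>R f) = t * ?s f" for f g t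
    using sublinear_pos_sup by (auto simp: sublinear_def)
  have p: "sublinear p"
    unfolding sublinear_def
  proof (intro conjI allI impI)
    fix x y :: "'a quad"
    obtain a b c d a' b' c' d' where xy: "x = (a, b, c, d)" "y = (a', b', c', d')"
      by (metis prod_cases4)
    have "?s (a + a') + ?s (b + b') + ?s (c + c') + ?s (d + d') \<le>
      (?s a + ?s b + ?s c + ?s d) + (?s a' + ?s b' + ?s c' + ?s d')"
      using s_add[of a a'] s_add[of b b'] s_add[of c c'] s_add[of d d'] by linarith
    from mult_left_mono[OF this K(1)] show "p (x + y) \<le> p x + p y"
      by (simp add: xy p_def distrib_left)
  next
    fix t :: real and x :: "'a quad" assume "0 \<le> t"
    then show "p (t *\<^sub>R x) = t * p x"
      by (cases x) (simp add: p_def s_scale algebra_simps)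
  qed
  \<comment> \<open>The modulus is at most the sum of the absolute values of real and imaginary
    part, and each of these is attained by one of two opposite rotations. Hence
    \<open>Re (\<phi> f) <= p (E f)\<close> on \<open>A\<close>.\<close>
  have norm_le: "norm f \<le> ?s (rot_Re 1 f) + ?s (rot_Re \<i> f) + ?s (rot_Re (- 1) f) + ?s (rot_Re (- \<i>) f)" for f
  proof (rule norm_bound)
    fix x
    have "0 \<le> ?s (rot_Re c f) \<and> Re (c * f x) \<le> ?s (rot_Re c f)" for c
      using pos_sup_upper[of "rot_Re c f" x] by (simp add: rot_Re.rep_eq)
    from this[of 1] this[of \<i>] this[of "- 1"] this[of "- \<i>"]
    show "cmod (f x) \<le> ?s (rot_Re 1 f) + ?s (rot_Re \<i> f) + ?s (rot_Re (- 1) f) + ?s (rot_Re (- \<i>) f)"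
      using cmod_le[of "f x"] by (auto simp: abs_if split: if_splits)
  qed
  obtain F where F: "linear F" "F \<le> p" "\<And>f. f \<in> A \<Longrightarrow> Re (\<phi> f) \<le> F (E f)"
  proof (rule hahn_banach[OF p, of A E "\<lambda>f. Re (\<phi> f)"])
    show "0 \<in> A" using A by (simp add: complex_subspace_def)
    show "a + b \<in> A \<and> E (a + b) = E a + E b \<and> Re (\<phi> (a + b)) = Re (\<phi> a) + Re (\<phi> b)"
      if "a \<in> A" "b \<in> A" for a b
      using that A add[OF that] by (simp add: complex_subspace_def E_def rot_add)
    show "t *\<^sub>R a \<in> A \<and> E (t *\<^sub>R a) = t *\<^sub>R E a \<and> Re (\<phi> (t *\<^sub>R a)) = t * Re (\<phi> a)"
      if "a \<in> A" "0 \<le> t" for t a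
      using that A scale[of a "complex_of_real t"]
      by (simp add: complex_subspace_def E_def rot_scale scaleR_eq_const_mult[symmetric])
        (simp add: complex_subspace_def scaleR_eq_const_mult)
    show "Re (\<phi> a) \<le> p (E a)" if "a \<in> A" for a
      using complex_Re_le_cmod[of "\<phi> a"] K(2)[OF that] mult_left_mono[OF norm_le[of a] K(1)]
      by (simp add: E_def p_def)
  qed blast
  \<comment> \<open>Applying the one-sided bound to \<open>- f\<close> as well gives
    equality.\<close>
  have Fe: "F (E f) = Re (\<phi> f)" if f: "f \<in> A" for f
  proof -
    have m: "const_bcontfun (- 1) * f \<in> A" using A f by (simp add: complex_subspace_def)
    have "const_bcontfun (- 1) * f = (-1) *\<^sub>R f" by (simp add: scaleR_eq_const_mult)
    then have "E (const_bcontfun (- 1) * f) = - E f"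
      using rot_scale[of _ "- 1" f] by (simp add: E_def)
    then have "- Re (\<phi> f) \<le> - F (E f)"
      using F(3)[OF m] scale[OF f, of "- 1"] by (simp add: linear_neg[OF F(1)])
    with F(3)[OF f] show ?thesis by simp
  qed
  \<comment> \<open>The injection into slot \<open>k\<close>; restricting \<open>F\<close> to that
    slot gives the \<open>k\<close>-th positive functional.\<close>
  define J :: "nat \<Rightarrow> ('a \<Rightarrow>\<^sub>C real) \<Rightarrow> 'a quad" where
    "J k g = (if k = 0 then g else 0, if k = 1 then g else 0, if k = 2 then g else 0, if k = 3 then g else 0)" for k g
  have J_add: "J k (f + g) = J k f + J k g" and J_scale: "J k (t *\<^sub>R f) = t *\<^sub>R J k f" for k f g t
    by (auto simp: J_def)
  have s0: "?s 0 = 0" using s_scale[of 0 0] by simp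
  have pJ: "p (J k g) \<le> K * ?s g" for k g
    using K(1) pos_sup_upper[of g] by (auto simp: J_def p_def s0 intro!: mult_nonneg_nonneg)
  define L where "L k g = F (J k (Bcontfun g))" for k g
  have B: "apply_bcontfun (Bcontfun g) = g" if "continuous_on UNIV g" for g :: "'a \<Rightarrow> real"
    using bcontfun_compact[OF comp that] .
  have pos: "positive_functional (L k)" for k
  proof
    show "L k (\<lambda>x. f x + g x) = L k f + L k g" if "continuous_on UNIV f" "continuous_on UNIV g" for f g
    proof -
      have "Bcontfun (\<lambda>x. f x + g x) = Bcontfun f + Bcontfun g"
        using that by (intro bcontfun_eqI) (simp add: B continuous_on_add)
      then show ?thesis by (simp add: L_def J_add linear_add[OF F(1)])
    qed
    show "L k (\<lambda>x. c * f x) = c * L k f" if "continuous_on UNIV f" for f c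
    proof -
      have "Bcontfun (\<lambda>x. c * f x) = c *\<^sub>R Bcontfun f"
        using that by (intro bcontfun_eqI) (simp add: B continuous_on_mult_left)
      then show ?thesis by (simp add: L_def J_scale linear_scale[OF F(1)])
    qed
    show "0 \<le> L k f" if f: "continuous_on UNIV f" "\<And>x. 0 \<le> f x" for f
    proof -
      let ?f = "Bcontfun f"
      have "- F (J k ?f) = F (J k ((- 1) *\<^sub>R ?f))"
        by (simp only: J_scale linear_scale[OF F(1)]) simp
      also have "\<dots> \<le> p (J k ((- 1) *\<^sub>R ?f))" using F(2) by (rule le_funD)
      also have "\<dots> \<le> K * ?s ((- 1) *\<^sub>R ?f)" by (rule pJ)
      also have "\<dots> \<le> K * 0"
        using f K(1) by (intro mult_left_mono pos_sup_least) (simp_all add: B)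
      finally show ?thesis by (simp add: L_def)
    qed
  qed (rule comp)
  define \<mu> where "\<mu> k = positive_functional.riesz_measure (L k)" for k
  have int: "(LINT x|\<mu> k. g x) = L k g" if "continuous_on UNIV g" for k g
    unfolding \<mu>_def using pos that by (rule positive_functional.riesz_representation)
  have fin: "finite_measure (\<mu> k)" and sets: "sets (\<mu> k) = sets borel" for k
    unfolding \<mu>_def using positive_functional.finite_riesz[OF pos] positive_functional.sets_riesz[OF pos] by auto
  have integrable: "integrable (\<mu> k) (apply_bcontfun f)" for k and f :: "'a \<Rightarrow>\<^sub>C complex"
  proof -
    have "apply_bcontfun f \<in> borel_measurable (\<mu> k)"
      by (simp add: measurable_cong_sets[OF sets refl] borel_measurable_continuous_onI)
    then show ?thesis
      using finite_measure.integrable_const_bound[OF fin, of _ "norm f"] norm_bounded[of f] by auto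
  qed
  have ReC: "Re (complex_measure_integral \<mu> (apply_bcontfun f)) = F (E f)" for f
  proof -
    have "Re (\<i> ^ k * (LINT x|\<mu> k. f x)) = F (J k (rot_Re (\<i> ^ k) f))" for k
    proof -
      have c: "continuous_on UNIV (\<lambda>x. Re (\<i> ^ k * f x))" by (intro continuous_intros) simp
      have "Re (\<i> ^ k * (LINT x|\<mu> k. f x)) = Re (LINT x|\<mu> k. \<i> ^ k * f x)" by simp
      also have "\<dots> = (LINT x|\<mu> k. Re (\<i> ^ k * f x))"
        using integrable by (intro integral_Re[symmetric]) auto
      also have "\<dots> = L k (\<lambda>x. Re (\<i> ^ k * f x))" using c by (rule int)
      also have "Bcontfun (\<lambda>x. Re (\<i> ^ k * f x)) = rot_Re (\<i> ^ k) f"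
        using B[OF c] by (intro bcontfun_eqI) (simp add: rot_Re.rep_eq)
      then have "L k (\<lambda>x. Re (\<i> ^ k * f x)) = F (J k (rot_Re (\<i> ^ k) f))" by (simp add: L_def)
      finally show ?thesis .
    qed
    then have "Re (complex_measure_integral \<mu> (apply_bcontfun f)) = (\<Sum>k<4. F (J k (rot_Re (\<i> ^ k) f)))"
      unfolding complex_measure_integral_def Re_sum by simp
    also have "\<dots> = F (\<Sum>k<4. J k (rot_Re (\<i> ^ k) f))"
      by (simp add: linear_sum[OF F(1)])
    also have "(\<Sum>k<4. J k (rot_Re (\<i> ^ k) f)) = E f"
      by (simp add: eval_nat_numeral J_def E_def)
    finally show ?thesis .
  qed
  have "complex_measure_integral \<mu> (apply_bcontfun f) = \<phi> f" if f: "f \<in> A" for f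
  proof (rule complex_eqI)
    show "Re (complex_measure_integral \<mu> (apply_bcontfun f)) = Re (\<phi> f)" using ReC Fe[OF f] by simp
    \<comment> \<open>The real part of the identity at \<open>\<i> f\<close> is, up to sign, its
      imaginary part at \<open>f\<close>.\<close>
    have "const_bcontfun \<i> * f \<in> A" using A f by (simp add: complex_subspace_def)
    then have "Re (complex_measure_integral \<mu> (apply_bcontfun (const_bcontfun \<i> * f))) = Re (\<phi> (const_bcontfun \<i> * f))"
      by (simp only: ReC Fe)
    moreover have "complex_measure_integral \<mu> (apply_bcontfun (const_bcontfun \<i> * f)) = \<i> * complex_measure_integral \<mu> (apply_bcontfun f)"
      by (simp add: complex_measure_integral_def sum_distrib_left algebra_simps)
    ultimately show "Im (complex_measure_integral \<mu> (apply_bcontfun f)) = Im (\<phi> f)"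
      using scale[OF f, of \<i>] by simp
  qed
  moreover have "regular_complex_measure \<mu>"
    unfolding regular_complex_measure_def \<mu>_def using positive_functional.regular_riesz[OF pos] by simp
  ultimately have ext: "measure_extends A \<mu> \<phi>" by (simp add: measure_extends_def)
  have mass: "measure (\<mu> k) UNIV \<le> K" for k
  proof -
    have "measure (\<mu> k) UNIV = F (J k (Bcontfun (\<lambda>_. 1)))"
      unfolding \<mu>_def by (simp add: positive_functional.measure_riesz_UNIV[OF pos] L_def)
    also have "\<dots> \<le> p (J k (Bcontfun (\<lambda>_. 1)))" using F(2) by (rule le_funD)
    also have "\<dots> \<le> K * ?s (Bcontfun (\<lambda>_. 1))" by (rule pJ)
    also have "\<dots> \<le> K * 1"
      using K(1) by (intro mult_left_mono pos_sup_least) (simp_all add: B)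
    finally show ?thesis by simp
  qed
  show thesis using ext mass by (rule that)
qed

section \<open>Integration of continuous families of functions\<close>

lemma finite_disjoint_refinement:
  fixes U :: "'i \<Rightarrow> 'a::topological_space set"
  assumes "finite S" "\<And>s. s \<in> S \<Longrightarrow> open (U s)"
  shows "\<exists>E. (\<forall>s\<in>S. E s \<in> sets borel \<and> E s \<subseteq> U s) \<and> disjoint_family_on E S \<and> (\<Union>s\<in>S. E s) = (\<Union>s\<in>S. U s)"
  using assms
proof (induction S rule: finite_induct)
  case empty
  then show ?case by (auto simp: disjoint_family_on_def)
next
  case (insert s S)
  then obtain E where E: "\<And>s. s \<in> S \<Longrightarrow> E s \<in> sets borel \<and> E s \<subseteq> U s" "disjoint_family_on E S"
      "(\<Union>s\<in>S. E s) = (\<Union>s\<in>S. U s)" by auto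
  define E' where "E' = E(s := U s - (\<Union>s\<in>S. U s))"
  have s: "U s - (\<Union>s\<in>S. U s) \<in> sets borel"
    using insert.prems by (intro sets.Diff borel_open open_UN) auto
  have eq: "E' t = E t" if "t \<in> S" for t using that insert.hyps by (auto simp: E'_def)
  have "disjoint_family_on E' (insert s S)"
    unfolding disjoint_family_on_insert[OF insert.hyps(2)]
  proof
    show "disjoint_family_on E' S" using E(2) eq by (simp add: disjoint_family_on_def)
    have "(\<Union>t\<in>S. E' t) = (\<Union>s\<in>S. U s)" using eq E(3) by simp
    then show "E' s \<inter> \<Union> (E' ` S) = {}" by (auto simp: E'_def)
  qed
  moreover have "(\<Union>t\<in>insert s S. E' t) = (\<Union>t\<in>insert s S. U t)"
  proof -
    have "(\<Union>t\<in>S. E' t) = (\<Union>s\<in>S. U s)" using eq E(3) by simp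
    then show ?thesis by (auto simp: E'_def)
  qed
  moreover have "\<forall>t\<in>insert s S. E' t \<in> sets borel \<and> E' t \<subseteq> U t"
    using s eq E(1) by (auto simp: E'_def)
  ultimately show ?case by blast
qed

text \<open>The cell \<open>E s\<close> is cut out of the neighbourhood where \<open>F\<close> is
  close to \<open>F s\<close>. The node \<open>s\<close> may fall outside its own cell; closeness to
  \<open>F s\<close> is all that Riemann sums use.\<close>

lemma compact_partition:
  fixes F :: "'a::topological_space \<Rightarrow> 'b::metric_space"
  assumes comp: "compact (UNIV :: 'a set)" and F: "continuous_on UNIV F" and e: "e > 0"
  obtains S E where "finite S" "\<And>s. s \<in> S \<Longrightarrow> E s \<in> sets borel" "disjoint_family_on E S"
    "(\<Union>s\<in>S. E s) = UNIV" "\<And>s x. s \<in> S \<Longrightarrow> x \<in> E s \<Longrightarrow> dist (F x) (F s) < e"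
proof -
  define U where "U s = {x. dist (F x) (F s) < e}" for s
  have U: "open (U s)" for s
    unfolding U_def using F by (intro open_Collect_less continuous_intros)
  obtain S where S: "finite S" "UNIV \<subseteq> (\<Union>s\<in>S. U s)"
  proof -
    have "UNIV \<subseteq> (\<Union>s\<in>UNIV. U s)" using e by (auto simp: U_def)
    with that show thesis using compactE_image[OF comp, of UNIV U] U by metis
  qed
  obtain E where E: "\<forall>s\<in>S. E s \<in> sets borel \<and> E s \<subseteq> U s" "disjoint_family_on E S" "(\<Union>s\<in>S. E s) = (\<Union>s\<in>S. U s)"
    using finite_disjoint_refinement[of S U, OF S(1) U] by (elim exE conjE)
  show thesis
    by (rule that[OF S(1) _ E(2)]) (use E S in \<open>auto simp: U_def\<close>)
qed

text \<open>What integration uses of a complex measure; it is stable under permuting the components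
  and under padding by null measures.\<close>

definition finite_borel :: "(nat \<Rightarrow> 'a::topological_space measure) \<Rightarrow> bool" where
  "finite_borel \<mu> \<longleftrightarrow> (\<forall>k<4. finite_measure (\<mu> k) \<and> sets (\<mu> k) = sets borel)"

text \<open>An upper bound for the total variation; the four components need not be a minimal
  decomposition.\<close>

definition mass :: "(nat \<Rightarrow> 'a measure) \<Rightarrow> real" where
  "mass \<mu> = (\<Sum>k<4. measure (\<mu> k) UNIV)"

lemma mass_nonneg: "0 \<le> mass \<mu>"
  by (simp add: mass_def sum_nonneg)

lemma regular_imp_finite_borel: "regular_complex_measure \<mu> \<Longrightarrow> finite_borel \<mu>"
  by (simp add: regular_complex_measure_def regular_borel_measure_def finite_borel_def)

lemma integrable_continuous_compact:
  fixes u :: "'a::topological_space \<Rightarrow> 'b::{banach, second_countable_topology}"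
  assumes "finite_measure M" "sets M = sets borel" "compact (UNIV :: 'a set)" "continuous_on UNIV u"
  shows "integrable M u"
proof -
  obtain B where "\<And>x. norm (u x) \<le> B"
    using compact_imp_bounded[OF compact_continuous_image[OF assms(4,3)]] by (auto simp: bounded_iff)
  moreover have "u \<in> borel_measurable M"
    using assms by (simp add: measurable_cong_sets[OF assms(2) refl] borel_measurable_continuous_onI)
  ultimately show ?thesis
    by (intro finite_measure.integrable_const_bound[OF assms(1), of _ B]) auto
qed

lemma riemann_sum_measure:
  fixes u :: "'a::topological_space \<Rightarrow> complex"
  assumes M: "finite_measure M" "sets M = sets borel" and comp: "compact (UNIV :: 'a set)"
    and E: "finite S" "\<And>s. s \<in> S \<Longrightarrow> E s \<in> sets borel" "disjoint_family_on E S" "(\<Union>s\<in>S. E s) = UNIV"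
    and u: "continuous_on UNIV u" "\<And>s x. s \<in> S \<Longrightarrow> x \<in> E s \<Longrightarrow> cmod (u x - u s) \<le> d"
  shows "cmod ((LINT x|M. u x) - (\<Sum>s\<in>S. measure M (E s) * u s)) \<le> d * measure M UNIV"
proof -
  interpret finite_measure M by fact
  define g where "g x = (\<Sum>s\<in>S. indicator (E s) x *\<^sub>R u s)" for x
  have sp: "space M = UNIV" using sets_eq_imp_space_eq[OF M(2)] by simp
  have E': "E s \<in> sets M" if "s \<in> S" for s using E(2)[OF that] M(2) by simp
  have ind: "integrable M (\<lambda>x. indicator (E s) x *\<^sub>R u s)" if "s \<in> S" for s
    using E'[OF that] by (intro integrable_scaleR_left) (simp add: integrable_indicator_iff emeasure_eq_measure)
  have g: "integrable M g" unfolding g_def using ind by (intro Bochner_Integration.integrable_sum)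
  have "(LINT x|M. g x) = (\<Sum>s\<in>S. LINT x|M. indicator (E s) x *\<^sub>R u s)"
    unfolding g_def using ind by (rule Bochner_Integration.integral_sum)
  also have "\<dots> = (\<Sum>s\<in>S. measure M (E s) * u s)"
  proof (rule sum.cong[OF refl])
    fix s assume s: "s \<in> S"
    have "(LINT x|M. indicator (E s) x *\<^sub>R u s) = (LINT x|M. indicator (E s) x) *\<^sub>R u s"
      using E'[OF s] by (intro integral_scaleR_left) (simp add: integrable_indicator_iff emeasure_eq_measure)
    then show "(LINT x|M. indicator (E s) x *\<^sub>R u s) = measure M (E s) * u s"
      using E'[OF s] sp by (simp add: scaleR_conv_of_real)
  qed
  finally have ig: "(LINT x|M. g x) = (\<Sum>s\<in>S. measure M (E s) * u s)" .
  have iu: "integrable M u" using M comp u(1) by (rule integrable_continuous_compact)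
  have close: "cmod (u x - g x) \<le> d" for x
  proof -
    obtain s where s: "s \<in> S" "x \<in> E s" using E(4) by blast
    have "indicator (E t) x = (if t = s then 1 else 0 :: real)" if "t \<in> S" for t
      using s that E(3) by (auto simp: disjoint_family_on_def indicator_def)
    then have "g x = (\<Sum>t\<in>S. (if t = s then 1 else 0 :: real) *\<^sub>R u t)"
      unfolding g_def by (intro sum.cong) auto
    also have "\<dots> = (\<Sum>t\<in>S. if t = s then u t else 0)" by (intro sum.cong) auto
    finally have "g x = u s" using s E(1) by simp
    with u(2)[OF s] show ?thesis by simp
  qed
  have "cmod (LINT x|M. u x - g x) \<le> (LINT x|M. d)"
    using iu g close by (intro order_trans[OF integral_norm_bound] integral_mono) auto
  then show ?thesis using iu g ig sp by (simp add: mult.commute)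
qed

text \<open>One set of nodes and weights serves every scalar integrand \<open>u\<close> that varies
  at most \<open>K\<close> times as fast as \<open>F\<close>: all point evaluations of a
  function-valued \<open>F\<close> and all bounded functionals of it. The bound on the weights later
  turns averages of isometries into operators bounded by \<open>mass\<close>.\<close>

definition riemann_approx ::
  "(nat \<Rightarrow> 'a::topological_space measure) \<Rightarrow> ('a \<Rightarrow> 'b::metric_space) \<Rightarrow> real \<Rightarrow> 'a set \<Rightarrow> ('a \<Rightarrow> complex) \<Rightarrow> bool" where
  "riemann_approx \<mu> F e S c \<longleftrightarrow> finite S \<and> (\<Sum>s\<in>S. cmod (c s)) \<le> mass \<mu> \<and>
     (\<forall>u K. continuous_on UNIV u \<longrightarrow> 0 \<le> K \<longrightarrow> (\<forall>x y. cmod (u x - u y) \<le> K * dist (F x) (F y)) \<longrightarrow>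
       cmod (complex_measure_integral \<mu> u - (\<Sum>s\<in>S. c s * u s)) \<le> K * e)"

lemma riemann_approxD:
  assumes "riemann_approx \<mu> F e S c"
  shows "finite S" "(\<Sum>s\<in>S. cmod (c s)) \<le> mass \<mu>"
    "\<And>u K. continuous_on UNIV u \<Longrightarrow> 0 \<le> K \<Longrightarrow> (\<And>x y. cmod (u x - u y) \<le> K * dist (F x) (F y)) \<Longrightarrow>
       cmod (complex_measure_integral \<mu> u - (\<Sum>s\<in>S. c s * u s)) \<le> K * e"
  using assms by (auto simp: riemann_approx_def)

theorem riemann_sum:
  fixes F :: "'a::topological_space \<Rightarrow> 'b::metric_space"
  assumes \<mu>: "finite_borel \<mu>" and comp: "compact (UNIV :: 'a set)" and F: "continuous_on UNIV F" and d: "d > 0"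
  obtains S c where "riemann_approx \<mu> F d S c"
proof -
  \<comment> \<open>The oscillation on the cells is multiplied by \<open>mass\<close>; the added 1
    covers \<open>mass \<mu> = 0\<close>.\<close>
  define e where "e = d / (mass \<mu> + 1)"
  have e: "e > 0" "e * mass \<mu> \<le> d"
    using d mass_nonneg[of \<mu>] by (auto simp: e_def field_simps)
  obtain S E where E: "finite S" "\<And>s. s \<in> S \<Longrightarrow> E s \<in> sets borel" "disjoint_family_on E S"
    "(\<Union>s\<in>S. E s) = UNIV" "\<And>s x. s \<in> S \<Longrightarrow> x \<in> E s \<Longrightarrow> dist (F x) (F s) < e"
    using compact_partition[OF comp F e(1)] by metis
  define c where "c s = (\<Sum>k<4. \<i> ^ k * measure (\<mu> k) (E s))" for s
  have fm: "finite_measure (\<mu> k)" and sets: "sets (\<mu> k) = sets borel" if "k < 4" for k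
    using \<mu> that by (auto simp: finite_borel_def)
  have ik: "cmod (\<i> ^ k) = 1" for k by (simp add: norm_power)
  have tot: "(\<Sum>s\<in>S. measure (\<mu> k) (E s)) = measure (\<mu> k) UNIV" if "k < 4" for k
  proof -
    interpret finite_measure "\<mu> k" by (rule fm[OF that])
    have "E ` S \<subseteq> sets (\<mu> k)" using E(2) sets[OF that] by auto
    from finite_measure_finite_Union[OF E(1) this E(3)] show ?thesis by (simp add: E(4))
  qed
  have "(\<Sum>s\<in>S. cmod (c s)) \<le> (\<Sum>s\<in>S. \<Sum>k<4. measure (\<mu> k) (E s))"
    unfolding c_def by (intro sum_mono order_trans[OF norm_sum]) (simp add: norm_mult ik)
  also have "\<dots> = (\<Sum>k<4. \<Sum>s\<in>S. measure (\<mu> k) (E s))" by (rule sum.swap)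
  also have "\<dots> = mass \<mu>" unfolding mass_def by (intro sum.cong) (auto simp: tot)
  finally have cm: "(\<Sum>s\<in>S. cmod (c s)) \<le> mass \<mu>" .
  have app: "cmod (complex_measure_integral \<mu> u - (\<Sum>s\<in>S. c s * u s)) \<le> K * e * mass \<mu>"
    if u: "continuous_on UNIV u" "0 \<le> K" "\<And>x y. cmod (u x - u y) \<le> K * dist (F x) (F y)" for u K
  proof -
    have d: "cmod (u x - u s) \<le> K * e" if "s \<in> S" "x \<in> E s" for s x
      using u(3)[of x s] mult_left_mono[of "dist (F x) (F s)" e K] E(5)[OF that] u(2) by simp
    have "(\<Sum>s\<in>S. c s * u s) = (\<Sum>s\<in>S. \<Sum>k<4. \<i> ^ k * (measure (\<mu> k) (E s) * u s))"
      by (simp add: c_def sum_distrib_right mult.assoc)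
    also have "\<dots> = (\<Sum>k<4. \<i> ^ k * (\<Sum>s\<in>S. measure (\<mu> k) (E s) * u s))"
      by (subst sum.swap) (simp add: sum_distrib_left)
    finally have "complex_measure_integral \<mu> u - (\<Sum>s\<in>S. c s * u s) =
      (\<Sum>k<4. \<i> ^ k * ((LINT x|\<mu> k. u x) - (\<Sum>s\<in>S. measure (\<mu> k) (E s) * u s)))"
      by (simp add: complex_measure_integral_def sum_subtractf right_diff_distrib)
    also have "cmod \<dots> \<le> (\<Sum>k<4. K * e * measure (\<mu> k) UNIV)"
    proof (rule sum_norm_le)
      fix k :: nat assume "k \<in> {..<4}"
      then have k: "k < 4" by simp
      show "cmod (\<i> ^ k * ((LINT x|\<mu> k. u x) - (\<Sum>s\<in>S. measure (\<mu> k) (E s) * u s))) \<le> K * e * measure (\<mu> k) UNIV"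
        using riemann_sum_measure[OF fm[OF k] sets[OF k] comp E(1-4) u(1) d] by (simp add: norm_mult ik)
    qed
    finally show ?thesis by (simp add: mass_def sum_distrib_left)
  qed
  have "cmod (complex_measure_integral \<mu> u - (\<Sum>s\<in>S. c s * u s)) \<le> K * d"
    if "continuous_on UNIV u" "0 \<le> K" "\<And>x y. cmod (u x - u y) \<le> K * dist (F x) (F y)" for u K
    using app[OF that] mult_left_mono[OF e(2) that(2)] by (simp add: mult.assoc)
  then show thesis using E(1) cm by (intro that) (auto simp: riemann_approx_def)
qed

text \<open>A weak integral, given by its values; that they form a continuous function is part of
  \<open>family_integral_apply\<close>.\<close>

definition family_integral ::
  "(nat \<Rightarrow> 'a::topological_space measure) \<Rightarrow> ('a \<Rightarrow> 'b::topological_space \<Rightarrow>\<^sub>C complex) \<Rightarrow> 'b \<Rightarrow>\<^sub>C complex" where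
  "family_integral \<mu> F = Bcontfun (\<lambda>y. complex_measure_integral \<mu> (\<lambda>x. F x y))"

lemma continuous_on_family_eval:
  fixes F :: "'a::topological_space \<Rightarrow> 'b::topological_space \<Rightarrow>\<^sub>C complex"
  assumes F: "continuous_on UNIV F"
  shows "continuous_on UNIV (\<lambda>x. apply_bcontfun (F x) y)"
proof -
  have "continuous_on UNIV (\<lambda>h :: 'b \<Rightarrow>\<^sub>C complex. apply_bcontfun h y)"
    by (rule lipschitz_on_continuous_on[of 1]) (auto simp: lipschitz_on_def intro: dist_bounded)
  from continuous_on_compose2[OF this F] show ?thesis by simp
qed

lemma riemann_approx_pointwise:
  fixes F :: "'a::topological_space \<Rightarrow> 'b::topological_space \<Rightarrow>\<^sub>C complex"
  assumes S: "riemann_approx \<mu> F e S c" and F: "continuous_on UNIV F"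
  shows "cmod (complex_measure_integral \<mu> (\<lambda>x. F x y) - apply_bcontfun (\<Sum>s\<in>S. const_bcontfun (c s) * F s) y) \<le> e"
proof -
  have "cmod (F x y - F z y) \<le> 1 * dist (F x) (F z)" for x z
    using dist_bounded[of "F x" y "F z"] by (simp add: dist_norm)
  from riemann_approxD(3)[OF S continuous_on_family_eval[OF F] _ this] show ?thesis
    by (simp add: apply_bcontfun_sum)
qed

text \<open>Finite sums with nodes independent of \<open>y\<close> converge to the pointwise
  integrals uniformly in \<open>y\<close>, so the limit is continuous.\<close>

lemma family_integral_apply:
  fixes F :: "'a::topological_space \<Rightarrow> 'b::topological_space \<Rightarrow>\<^sub>C complex"
  assumes \<mu>: "finite_borel \<mu>" and comp: "compact (UNIV :: 'a set)" and comp': "compact (UNIV :: 'b set)"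
    and F: "continuous_on UNIV F"
  shows "apply_bcontfun (family_integral \<mu> F) y = complex_measure_integral \<mu> (\<lambda>x. F x y)"
proof -
  let ?v = "\<lambda>y. complex_measure_integral \<mu> (\<lambda>x. F x y)"
  have "\<exists>G :: 'b \<Rightarrow>\<^sub>C complex. \<forall>y. cmod (?v y - G y) \<le> inverse (real (Suc n))" for n
  proof -
    have "0 < inverse (real (Suc n))" by simp
    then obtain S c where S: "riemann_approx \<mu> F (inverse (real (Suc n))) S c"
      by (rule riemann_sum[OF \<mu> comp F])
    from riemann_approx_pointwise[OF S F] show ?thesis by blast
  qed
  then obtain G :: "nat \<Rightarrow> 'b \<Rightarrow>\<^sub>C complex" where G: "\<And>n y. cmod (?v y - G n y) \<le> inverse (real (Suc n))"
    by metis
  have "uniform_limit UNIV (\<lambda>n. apply_bcontfun (G n)) ?v sequentially"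
  proof (rule uniform_limitI)
    fix e :: real assume "e > 0"
    have "\<forall>\<^sub>F n in sequentially. inverse (real (Suc n)) < e"
      using \<open>e > 0\<close> by (intro order_tendstoD[OF LIMSEQ_inverse_real_of_nat])
    then show "\<forall>\<^sub>F n in sequentially. \<forall>x\<in>UNIV. dist (G n x) (?v x) < e"
      by eventually_elim (use G in \<open>auto simp: dist_norm norm_minus_commute intro: le_less_trans\<close>)
  qed
  then have "continuous_on UNIV ?v"
    by (rule uniform_limit_theorem[rotated]) auto
  then show ?thesis unfolding family_integral_def using bcontfun_compact[OF comp'] by metis
qed

lemma family_integral_approx:
  fixes F :: "'a::topological_space \<Rightarrow> 'b::topological_space \<Rightarrow>\<^sub>C complex"
  assumes \<mu>: "finite_borel \<mu>" and comp: "compact (UNIV :: 'a set)" "compact (UNIV :: 'b set)"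
    and F: "continuous_on UNIV F" and S: "riemann_approx \<mu> F e S c"
  shows "norm (family_integral \<mu> F - (\<Sum>s\<in>S. const_bcontfun (c s) * F s)) \<le> e"
  using riemann_approx_pointwise[OF S F]
  by (intro norm_bound) (simp add: family_integral_apply[OF \<mu> comp F])

lemma family_integral_in_closed_subspace:
  fixes F :: "'a::topological_space \<Rightarrow> 'b::topological_space \<Rightarrow>\<^sub>C complex"
  assumes \<mu>: "finite_borel \<mu>" and comp: "compact (UNIV :: 'a set)" "compact (UNIV :: 'b set)"
    and F: "continuous_on UNIV F" and A: "closed A" "complex_subspace A" "\<And>x. F x \<in> A"
  shows "family_integral \<mu> F \<in> A"
proof -
  have "\<exists>h\<in>A. dist h (family_integral \<mu> F) < e" if e: "e > 0" for e
  proof -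
    have "e / 2 > 0" using e by simp
    then obtain S c where "riemann_approx \<mu> F (e / 2) S c" by (rule riemann_sum[OF \<mu> comp(1) F])
    then have "norm (family_integral \<mu> F - (\<Sum>s\<in>S. const_bcontfun (c s) * F s)) \<le> e / 2"
      by (rule family_integral_approx[OF \<mu> comp F])
    then show ?thesis
      using complex_subspace_sum[OF A(2), of S F c] A(3) e
      by (intro bexI[of _ "\<Sum>s\<in>S. const_bcontfun (c s) * F s"]) (auto simp: dist_norm norm_minus_commute)
  qed
  then have "family_integral \<mu> F \<in> closure A" by (simp add: closure_approachable)
  with A(1) show ?thesis by (simp add: closure_closed)
qed

text \<open>Both sides are within \<open>K * d\<close> of the same finite sum:
  \<open>\<psi> (F x)\<close> varies at most \<open>K\<close> times as fast as \<open>F\<close>, and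
  the integral itself is norm-close to the sum.\<close>

lemma functional_family_integral:
  fixes F :: "'a::topological_space \<Rightarrow> 'b::topological_space \<Rightarrow>\<^sub>C complex"
  assumes \<mu>: "finite_borel \<mu>" and comp: "compact (UNIV :: 'a set)" "compact (UNIV :: 'b set)"
    and F: "continuous_on UNIV F" and A: "closed A" "complex_subspace A" "\<And>x. F x \<in> A"
    and add: "\<And>f h. f \<in> A \<Longrightarrow> h \<in> A \<Longrightarrow> \<psi> (f + h) = \<psi> f + \<psi> h"
    and scale: "\<And>c f. f \<in> A \<Longrightarrow> \<psi> (const_bcontfun c * f) = c * \<psi> f"
    and K: "0 \<le> K" "\<And>f. f \<in> A \<Longrightarrow> cmod (\<psi> f) \<le> K * norm f"
  shows "\<psi> (family_integral \<mu> F) = complex_measure_integral \<mu> (\<lambda>x. \<psi> (F x))"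
proof -
  let ?I = "family_integral \<mu> F"
  have I: "?I \<in> A" using assms by (intro family_integral_in_closed_subspace)
  have diff: "\<psi> (f - h) = \<psi> f - \<psi> h" if "f \<in> A" "h \<in> A" for f h
    using add[OF complex_subspace_diff[OF A(2) that] that(2)] by simp
  have lip: "cmod (\<psi> f - \<psi> h) \<le> K * dist f h" if "f \<in> A" "h \<in> A" for f h
    using K(2)[OF complex_subspace_diff[OF A(2) that]] diff[OF that] by (simp add: dist_norm)
  have sum: "\<psi> (\<Sum>s\<in>S. const_bcontfun (c s) * F s) = (\<Sum>s\<in>S. c s * \<psi> (F s))" for S c
  proof (induction S rule: infinite_finite_induct)
    case (insert s S)
    then show ?case
      using add[of "const_bcontfun (c s) * F s" "\<Sum>s\<in>S. const_bcontfun (c s) * F s"]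
        complex_subspace_sum[OF A(2), of S F c] A(2,3) scale[OF A(3)] by (simp add: complex_subspace_def)
  qed (use scale[of 0 0] A(2) in \<open>auto simp: complex_subspace_def\<close>)
  have cont: "continuous_on UNIV (\<lambda>x. \<psi> (F x))"
  proof -
    have "continuous_on A \<psi>"
      using lip K(1) by (intro lipschitz_on_continuous_on[of K]) (auto simp: lipschitz_on_def dist_norm)
    from continuous_on_compose2[OF this F] A(3) show ?thesis by auto
  qed
  have "cmod (\<psi> ?I - complex_measure_integral \<mu> (\<lambda>x. \<psi> (F x))) \<le> 0 + e" if e: "e > 0" for e
  proof -
    define d where "d = e / (2 * (K + 1))"
    have "2 * (K + 1) * d = e" "d > 0" using e K(1) by (auto simp: d_def)
    then have d: "d > 0" "K * d + K * d \<le> e" by (simp_all add: algebra_simps)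
    obtain S c where A1: "riemann_approx \<mu> F d S c" by (rule riemann_sum[OF \<mu> comp(1) F d(1)])
    note S = family_integral_approx[OF \<mu> comp F A1] riemann_approxD(3)[OF A1]
    have "cmod (complex_measure_integral \<mu> (\<lambda>x. \<psi> (F x)) - (\<Sum>s\<in>S. c s * \<psi> (F s))) \<le> K * d"
      using cont K(1) lip A(3) by (intro S(2)) auto
    moreover have "cmod (\<psi> ?I - (\<Sum>s\<in>S. c s * \<psi> (F s))) \<le> K * d"
    proof -
      have "cmod (\<psi> ?I - \<psi> (\<Sum>s\<in>S. const_bcontfun (c s) * F s)) \<le> K * dist ?I (\<Sum>s\<in>S. const_bcontfun (c s) * F s)"
        using I complex_subspace_sum[OF A(2), of S F c] A(3) by (intro lip) auto
      also have "\<dots> \<le> K * d" using S(1) K(1) by (intro mult_left_mono) (auto simp: dist_norm)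
      finally show ?thesis by (simp add: sum)
    qed
    ultimately have "dist (\<psi> ?I) (complex_measure_integral \<mu> (\<lambda>x. \<psi> (F x))) \<le> K * d + K * d"
      by (intro dist_triangle_le[of _ "\<Sum>s\<in>S. c s * \<psi> (F s)"]) (auto simp: dist_norm norm_minus_commute intro: add_mono)
    with d(2) show ?thesis by (simp add: dist_norm)
  qed
  then have "cmod (\<psi> ?I - complex_measure_integral \<mu> (\<lambda>x. \<psi> (F x))) \<le> 0"
    by (rule field_le_epsilon)
  then show ?thesis by simp
qed

section \<open>Convolution operators on an invariant algebra\<close>

text \<open>The tube lemma: near \<open>x\<close>, joint continuity is uniform over the compact
  second factor, which is closeness in the sup-norm.\<close>

lemma continuous_on_curry_bcontfun:
  fixes K :: "'a::topological_space \<Rightarrow> 'b::topological_space \<Rightarrow>\<^sub>C 'c::metric_space"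
  assumes comp: "compact (UNIV :: 'b set)" and K: "continuous_on UNIV (\<lambda>(x, y). K x y)"
  shows "continuous_on UNIV K"
  unfolding continuous_on_def
proof (intro ballI tendstoI)
  fix x :: 'a and e :: real assume e: "e > 0"
  have "continuous_on (UNIV \<times> UNIV) (\<lambda>(x, y). K x y)" using K by simp
  then obtain X where X: "x \<in> X" "open X"
    "\<forall>z\<in>X \<inter> UNIV. \<forall>t\<in>UNIV. dist (case (z, t) of (x, y) \<Rightarrow> K x y) (case (x, t) of (x, y) \<Rightarrow> K x y) \<le> e / 2"
    using comp UNIV_I half_gt_zero[OF e] by (rule continuous_on_prod_compactE)
  have "dist (K z) (K x) < e" if "z \<in> X" for z
  proof -
    have "dist (K z) (K x) \<le> e / 2" using X(3) that by (intro dist_bound) auto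
    with e show ?thesis by simp
  qed
  with X show "\<forall>\<^sub>F z in at x within UNIV. dist (K z) (K x) < e"
    by (auto simp: eventually_at_topological)
qed

lemma continuous_on_bcontfun_comp [continuous_intros]:
  "continuous_on S g \<Longrightarrow> continuous_on S (\<lambda>x. apply_bcontfun f (g x))"
  by (rule continuous_on_compose2[of UNIV "apply_bcontfun f"]) auto

lemma continuous_left_trans:
  fixes f :: "'g::{topological_group_add, t2_space} \<Rightarrow>\<^sub>C complex"
  assumes "compact (UNIV :: 'g set)"
  shows "continuous_on UNIV (\<lambda>g. left_trans g f)"
  using assms
  by (rule continuous_on_curry_bcontfun)
    (auto simp: left_trans.rep_eq split_beta intro!: continuous_intros)

lemma continuous_right_trans:
  fixes f :: "'g::{topological_group_add, t2_space} \<Rightarrow>\<^sub>C complex"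
  assumes "compact (UNIV :: 'g set)"
  shows "continuous_on UNIV (\<lambda>g. right_trans g f)"
  using assms
  by (rule continuous_on_curry_bcontfun)
    (auto simp: right_trans.rep_eq split_beta intro!: continuous_intros)

lemma left_trans_norm_le: "norm (left_trans g f) \<le> norm f"
  by (rule norm_bound) (simp add: left_trans.rep_eq norm_bounded)

lemma left_trans_add: "left_trans g (f + h) = left_trans g f + left_trans g h"
  and left_trans_mult: "left_trans g (f * h) = left_trans g f * left_trans g h"
  and left_trans_const: "left_trans g (const_bcontfun c) = const_bcontfun c"
  and left_trans_left_trans: "left_trans g (left_trans k f) = left_trans (k + g) f"
  and left_trans_zero: "left_trans 0 f = f"
  by (rule bcontfun_eqI; simp add: left_trans.rep_eq add.assoc)+

lemma closed_bcontfun_complete: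
  fixes S :: "('a::topological_space \<Rightarrow>\<^sub>C 'b::complete_space) set"
  assumes "closed S"
  shows "complete S"
  unfolding complete_def
proof (intro allI impI)
  fix f :: "nat \<Rightarrow> 'a \<Rightarrow>\<^sub>C 'b" assume f: "(\<forall>n. f n \<in> S) \<and> Cauchy f"
  then obtain g where "uniform_limit UNIV f g sequentially"
    using uniformly_convergent_eq_cauchy[of "\<lambda>_. True" f]
    unfolding Cauchy_def uniform_limit_sequentially_iff
    by (metis dist_fun_lt_imp_dist_val_lt)
  from uniform_limit_bcontfunE[OF this sequentially_bot]
  obtain l where "f \<longlonglongrightarrow> l" by metis
  with f assms show "\<exists>l\<in>S. f \<longlonglongrightarrow> l" by (metis closed_sequentially)
qed

lemma continuous_map_complex_mult:
  fixes f g :: "'a \<Rightarrow> complex"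
  assumes "continuous_map X euclidean f" "continuous_map X euclidean g"
  shows "continuous_map X euclidean (\<lambda>x. f x * g x)"
proof -
  have "continuous_map X (prod_topology euclidean euclidean) (\<lambda>x. (f x, g x))"
    unfolding continuous_map_paired using assms by simp
  moreover have "continuous_map (prod_topology euclidean euclidean) euclidean (\<lambda>p. fst p * snd p :: complex)"
    by (simp add: continuous_intros)
  ultimately have "continuous_map X euclidean ((\<lambda>p. fst p * snd p :: complex) \<circ> (\<lambda>x. (f x, g x)))"
    by (rule continuous_map_compose)
  then show ?thesis by (simp add: o_def)
qed

locale invariant_algebra_compact =
  fixes A :: "('g::{topological_group_add, t2_space} \<Rightarrow>\<^sub>C complex) set"
  assumes comp: "compact (UNIV :: 'g set)" and inv: "invariant_algebra A"
begin

lemma closed_A: "closed A" and const_A: "const_bcontfun c \<in> A"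
  and add_A: "f \<in> A \<Longrightarrow> h \<in> A \<Longrightarrow> f + h \<in> A" and mult_A: "f \<in> A \<Longrightarrow> h \<in> A \<Longrightarrow> f * h \<in> A"
  and left_A: "f \<in> A \<Longrightarrow> left_trans g f \<in> A" and right_A: "f \<in> A \<Longrightarrow> right_trans g f \<in> A"
  using inv by (auto simp: invariant_algebra_def image_subset_iff)

lemma subspace_A: "complex_subspace A"
  unfolding complex_subspace_def using const_A[of 0] by (auto intro: add_A mult_A const_A)

lemma zero_A: "0 \<in> A"
  using subspace_A by (simp add: complex_subspace_def)

lemma scaleR_A: "f \<in> A \<Longrightarrow> r *\<^sub>R f \<in> A"
  by (simp add: scaleR_eq_const_mult mult_A const_A)

lemma diff_A: "f \<in> A \<Longrightarrow> h \<in> A \<Longrightarrow> f - h \<in> A"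
  using complex_subspace_diff[OF subspace_A] .

lemma dual_add: "\<phi> \<in> dual_space A \<Longrightarrow> f \<in> A \<Longrightarrow> h \<in> A \<Longrightarrow> \<phi> (f + h) = \<phi> f + \<phi> h"
  and dual_scale: "\<phi> \<in> dual_space A \<Longrightarrow> f \<in> A \<Longrightarrow> \<phi> (const_bcontfun c * f) = c * \<phi> f"
  and dual_extensional: "\<phi> \<in> dual_space A \<Longrightarrow> \<phi> \<in> extensional A"
  and dual_continuous: "\<phi> \<in> dual_space A \<Longrightarrow> continuous_on A \<phi>"
  by (auto simp: dual_space_def linear_functional_def)

lemma linear_functional_diff:
  assumes "linear_functional A \<phi>" "f \<in> A" "h \<in> A"
  shows "\<phi> (f - h) = \<phi> f - \<phi> h"
proof -
  have "\<phi> ((f - h) + h) = \<phi> (f - h) + \<phi> h"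
    using assms diff_A by (simp only: linear_functional_def)
  then show ?thesis by simp
qed

lemma dual_bounded:
  assumes \<phi>: "\<phi> \<in> dual_space A"
  obtains K where "0 \<le> K" "\<And>f. f \<in> A \<Longrightarrow> cmod (\<phi> f) \<le> K * norm f"
proof -
  have z: "\<phi> 0 = 0" using dual_scale[OF \<phi> zero_A, of 0] by simp
  obtain d where d: "d > 0" "\<And>f. f \<in> A \<Longrightarrow> norm f < d \<Longrightarrow> cmod (\<phi> f) < 1"
    using dual_continuous[OF \<phi>] zero_A unfolding continuous_on_iff
    by (metis dist_0_norm dist_commute z zero_less_one)
  have "cmod (\<phi> f) \<le> 2 / d * norm f" if f: "f \<in> A" for f
  proof (cases "f = 0")
    case False
    define r where "r = d / (2 * norm f)"
    have r: "r > 0" using d False by (simp add: r_def)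
    have "norm (r *\<^sub>R f) < d" using d False by (simp add: r_def)
    then have "cmod (\<phi> (r *\<^sub>R f)) < 1" using d scaleR_A[OF f] by blast
    then have "r * cmod (\<phi> f) < 1"
      using dual_scale[OF \<phi> f, of "complex_of_real r"] r by (simp add: scaleR_eq_const_mult norm_mult)
    then show ?thesis using d False by (simp add: r_def field_simps)
  qed (simp add: z)
  moreover have "0 \<le> 2 / d" using d by simp
  ultimately show thesis using that by blast
qed

text \<open>
  If \<open>\<parallel>h\<parallel> < 1\<close> and \<open>\<phi> h = 1\<close>, the geometric series \<open>g = h + h g\<close> in \<open>A\<close> gives
  \<open>\<phi> g = 1 + \<phi> g\<close>.
\<close>

lemma mult_functional_bound:
  assumes \<phi>: "\<phi> \<in> mult_functionals A" and f: "f \<in> A"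
  shows "cmod (\<phi> f) \<le> norm f"
proof (rule ccontr)
  assume "\<not> ?thesis"
  then have less: "norm f < cmod (\<phi> f)" by simp
  then have nz: "\<phi> f \<noteq> 0" by auto
  define h where "h = const_bcontfun (inverse (\<phi> f)) * f"
  have hA: "h \<in> A" unfolding h_def using f by (intro mult_A const_A)
  have "norm h \<le> inverse (cmod (\<phi> f)) * norm f"
    unfolding h_def
    by (rule norm_bound) (simp add: norm_mult norm_inverse norm_bounded mult_left_mono)
  also have "\<dots> < 1" using less nz by (simp add: field_simps)
  finally have h1: "norm h < 1" .
  have ph: "\<phi> h = 1"
    using \<phi> f nz by (simp add: h_def mult_functionals_def linear_functional_def)
  \<comment> \<open>The geometric series is summed as the fixed point of
    \<open>g \<mapsto> h + h * g\<close>, a contraction of the complete set \<open>A\<close> with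
    factor \<open>norm h\<close>.\<close>
  have "\<exists>!g\<in>A. h + h * g = g"
  proof (rule Banach_fix[of A "norm h"])
    show "complete A" using closed_A by (rule closed_bcontfun_complete)
    show "A \<noteq> {}" using f by auto
    show "(\<lambda>g. h + h * g) ` A \<subseteq> A" using hA by (auto intro: add_A mult_A)
    show "dist (h + h * x) (h + h * y) \<le> norm h * dist x y" if "x \<in> A" "y \<in> A" for x y
      using norm_mult_ineq[of h "x - y"] by (simp add: dist_norm algebra_simps)
  qed (use h1 in auto)
  then obtain g where g: "g \<in> A" "h + h * g = g" by auto
  have "\<phi> (h + h * g) = \<phi> h + \<phi> h * \<phi> g"
    using \<phi> hA g(1) mult_A[OF hA g(1)] by (auto simp: mult_functionals_def linear_functional_def)
  then show False using g(2) ph by simp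
qed

lemma mult_functional_linear: "\<phi> \<in> mult_functionals A \<Longrightarrow> linear_functional A \<phi>"
  by (simp add: mult_functionals_def)

lemma mult_functional_mult: "\<phi> \<in> mult_functionals A \<Longrightarrow> f \<in> A \<Longrightarrow> h \<in> A \<Longrightarrow> \<phi> (f * h) = \<phi> f * \<phi> h"
  by (simp add: mult_functionals_def)

lemma mult_functional_one:
  assumes "\<phi> \<in> mult_functionals A"
  shows "\<phi> (const_bcontfun 1) = 1"
proof -
  obtain f where f: "f \<in> A" "\<phi> f \<noteq> 0" using assms by (auto simp: mult_functionals_def)
  have "const_bcontfun 1 * f = f" by (rule bcontfun_eqI) simp
  then have "\<phi> f = \<phi> (const_bcontfun 1) * \<phi> f"
    using mult_functional_mult[OF assms const_A[of 1] f(1)] by simp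
  with f(2) show ?thesis by simp
qed

lemma mult_functional_dual: "\<phi> \<in> mult_functionals A \<Longrightarrow> \<phi> \<in> dual_space A"
proof -
  assume \<phi>: "\<phi> \<in> mult_functionals A"
  have "cmod (\<phi> f - \<phi> h) \<le> 1 * dist f h" if "f \<in> A" "h \<in> A" for f h
    using mult_functional_bound[OF \<phi> diff_A[OF that]] linear_functional_diff[OF mult_functional_linear[OF \<phi>] that]
    by (simp add: dist_norm)
  then have "continuous_on A \<phi>"
    by (intro lipschitz_on_continuous_on[of 1]) (auto simp: lipschitz_on_def dist_norm)
  with \<phi> show ?thesis by (simp add: dual_space_def mult_functional_linear)
qed

section \<open>Representing measures and the operators \<open>conv_op\<close>\<close>

lemma dual_measure:
  assumes \<phi>: "\<phi> \<in> dual_space A"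
  obtains \<mu> where "measure_extends A \<mu> \<phi>"
proof -
  obtain K where K: "0 \<le> K" "\<And>f. f \<in> A \<Longrightarrow> cmod (\<phi> f) \<le> K * norm f" using dual_bounded[OF \<phi>] by blast
  show thesis
    by (rule exists_measure_extends[OF comp subspace_A dual_add[OF \<phi>] dual_scale[OF \<phi>] K]) (use that in blast)+
qed

text \<open>Norm at most 1 gives mass at most 1 for each of the four measures, a bound uniform in
  \<open>\<phi>\<close>.\<close>

lemma mult_functional_measure:
  assumes \<phi>: "\<phi> \<in> mult_functionals A"
  obtains \<mu> where "measure_extends A \<mu> \<phi>" "mass \<mu> \<le> 4"
proof -
  have b: "cmod (\<phi> f) \<le> 1 * norm f" if "f \<in> A" for f using mult_functional_bound[OF \<phi> that] by simp
  note \<phi>' = mult_functional_dual[OF \<phi>]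
  obtain \<mu> where \<mu>: "measure_extends A \<mu> \<phi>" "\<And>k. k < 4 \<Longrightarrow> measure (\<mu> k) UNIV \<le> 1"
    using exists_measure_extends[OF comp subspace_A dual_add[OF \<phi>'] dual_scale[OF \<phi>'] zero_le_one b] by metis
  have "mass \<mu> \<le> (\<Sum>k<4::nat. 1)" unfolding mass_def using \<mu>(2) by (intro sum_mono) auto
  with \<mu>(1) show thesis by (intro that) auto
qed

text \<open>The explicit formula for \<open>R_op\<close>, which replaces the definite description
  once \<open>R_op_eq\<close> is known; it is meaningful on \<open>A\<close> only.\<close>

definition conv_op :: "(('g \<Rightarrow>\<^sub>C complex) \<Rightarrow> complex) \<Rightarrow> ('g \<Rightarrow>\<^sub>C complex) \<Rightarrow> 'g \<Rightarrow>\<^sub>C complex" where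
  "conv_op \<phi> f = Bcontfun (\<lambda>g. \<phi> (left_trans g f))"

lemma conv_op_apply:
  assumes \<phi>: "\<phi> \<in> dual_space A" and f: "f \<in> A"
  shows "apply_bcontfun (conv_op \<phi> f) g = \<phi> (left_trans g f)"
proof -
  have "continuous_on UNIV (\<lambda>g. \<phi> (left_trans g f))"
    using left_A[OF f] by (intro continuous_on_compose2[OF dual_continuous[OF \<phi>] continuous_left_trans[OF comp]]) auto
  then show ?thesis unfolding conv_op_def using bcontfun_compact[OF comp] by metis
qed

text \<open>The kernel \<open>f (g + h)\<close> is a left translate of \<open>f\<close> in the
  variable \<open>h\<close> and a right translate in \<open>g\<close>; the second reading places the
  values of the operator in \<open>A\<close>.\<close>

lemma conv_op_eq_integral:
  assumes \<phi>: "\<phi> \<in> dual_space A" and f: "f \<in> A" and \<mu>: "measure_extends A \<mu> \<phi>"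
  shows "conv_op \<phi> f = family_integral \<mu> (\<lambda>h. right_trans h f)"
proof (rule bcontfun_eqI)
  fix g
  have "finite_borel \<mu>" using \<mu> by (auto simp: measure_extends_def intro: regular_imp_finite_borel)
  then have "apply_bcontfun (family_integral \<mu> (\<lambda>h. right_trans h f)) g = complex_measure_integral \<mu> (\<lambda>h. right_trans h f g)"
    using comp continuous_right_trans[OF comp] by (intro family_integral_apply)
  also have "\<dots> = complex_measure_integral \<mu> (left_trans g f)"
    by (simp add: right_trans.rep_eq left_trans.rep_eq)
  also have "\<dots> = \<phi> (left_trans g f)" using \<mu> left_A[OF f] by (simp add: measure_extends_def)
  finally show "apply_bcontfun (conv_op \<phi> f) g = apply_bcontfun (family_integral \<mu> (\<lambda>h. right_trans h f)) g"
    using conv_op_apply[OF \<phi> f] by simp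
qed

lemma conv_op_A:
  assumes \<phi>: "\<phi> \<in> dual_space A" and f: "f \<in> A"
  shows "conv_op \<phi> f \<in> A"
proof -
  obtain \<mu> where \<mu>: "measure_extends A \<mu> \<phi>" using dual_measure[OF \<phi>] .
  have "finite_borel \<mu>" using \<mu> by (auto simp: measure_extends_def intro: regular_imp_finite_borel)
  then show ?thesis unfolding conv_op_eq_integral[OF \<phi> f \<mu>]
    using comp continuous_right_trans[OF comp] closed_A subspace_A right_A[OF f]
    by (intro family_integral_in_closed_subspace)
qed

text \<open>A bounded functional passes under the integral of the right translates, so the double
  integral depends on the measures only through the functionals. This gives the definite description
  its value.\<close>

lemma convolution_eq:
  assumes \<psi>: "\<psi> \<in> dual_space A" and \<phi>: "\<phi> \<in> dual_space A" and f: "f \<in> A"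
  shows "convolution A \<psi> \<phi> f = \<psi> (conv_op \<phi> f)"
proof -
  obtain K where K: "0 \<le> K" "\<And>f. f \<in> A \<Longrightarrow> cmod (\<psi> f) \<le> K * norm f" using dual_bounded[OF \<psi>] by blast
  have val: "complex_measure_integral \<nu> (\<lambda>h. complex_measure_integral \<mu> (\<lambda>g. apply_bcontfun f (g + h))) = \<psi> (conv_op \<phi> f)"
    if \<mu>: "measure_extends A \<mu> \<psi>" and \<nu>: "measure_extends A \<nu> \<phi>" for \<mu> \<nu>
  proof -
    have fb: "finite_borel \<nu>" using \<nu> by (auto simp: measure_extends_def intro: regular_imp_finite_borel)
    have "complex_measure_integral \<mu> (\<lambda>g. apply_bcontfun f (g + h)) = \<psi> (right_trans h f)" for h
      using \<mu> right_A[OF f, of h] by (simp add: measure_extends_def right_trans.rep_eq)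
    moreover have "\<psi> (family_integral \<nu> (\<lambda>h. right_trans h f)) = complex_measure_integral \<nu> (\<lambda>h. \<psi> (right_trans h f))"
      by (rule functional_family_integral[OF fb comp comp continuous_right_trans[OF comp] closed_A subspace_A
            right_A[OF f] dual_add[OF \<psi>] dual_scale[OF \<psi>] K])
    ultimately show ?thesis using conv_op_eq_integral[OF \<phi> f \<nu>] by simp
  qed
  obtain \<mu> where \<mu>: "measure_extends A \<mu> \<psi>" using dual_measure[OF \<psi>] .
  obtain \<nu> where \<nu>: "measure_extends A \<nu> \<phi>" using dual_measure[OF \<phi>] .
  have "(THE z. \<exists>\<mu> \<nu>. measure_extends A \<mu> \<psi> \<and> measure_extends A \<nu> \<phi> \<and>
     z = complex_measure_integral \<nu> (\<lambda>h. complex_measure_integral \<mu> (\<lambda>g. apply_bcontfun f (g + h)))) = \<psi> (conv_op \<phi> f)"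
  proof (rule the_equality)
    show "\<exists>\<mu> \<nu>. measure_extends A \<mu> \<psi> \<and> measure_extends A \<nu> \<phi> \<and>
       \<psi> (conv_op \<phi> f) = complex_measure_integral \<nu> (\<lambda>h. complex_measure_integral \<mu> (\<lambda>g. apply_bcontfun f (g + h)))"
      using \<mu> \<nu> val[OF \<mu> \<nu>] by metis
  qed (use val in metis)
  with f show ?thesis by (simp add: convolution_def)
qed

text \<open>Point evaluations separate \<open>A\<close>; they give the uniqueness part of
  \<open>R_op_eq\<close>.\<close>

lemma evaluation_dual: "(\<lambda>f\<in>A. apply_bcontfun f g) \<in> dual_space A"
proof -
  have "continuous_on A (\<lambda>f. apply_bcontfun f g)"
    by (rule lipschitz_on_continuous_on[of 1]) (auto simp: lipschitz_on_def intro: dist_bounded)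
  then have "continuous_on A (\<lambda>f\<in>A. apply_bcontfun f g)"
    by (rule continuous_on_eq) simp
  then show ?thesis
    by (auto simp: dual_space_def linear_functional_def add_A mult_A const_A)
qed

lemma conv_op_add:
  assumes "\<phi> \<in> dual_space A" "f \<in> A" "h \<in> A"
  shows "conv_op \<phi> (f + h) = conv_op \<phi> f + conv_op \<phi> h"
  using assms by (intro bcontfun_eqI) (simp add: conv_op_apply add_A left_trans_add dual_add left_A)

lemma conv_op_scale:
  assumes "\<phi> \<in> dual_space A" "f \<in> A"
  shows "conv_op \<phi> (const_bcontfun c * f) = const_bcontfun c * conv_op \<phi> f"
  using assms
  by (intro bcontfun_eqI)
    (simp add: conv_op_apply mult_A const_A left_trans_mult left_trans_const dual_scale left_A)

lemma conv_op_diff: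
  assumes "\<phi> \<in> dual_space A" "f \<in> A" "h \<in> A"
  shows "conv_op \<phi> (f - h) = conv_op \<phi> f - conv_op \<phi> h"
  using conv_op_add[OF assms(1) diff_A[OF assms(2,3)] assms(3)] by simp

lemma R_op_eq:
  assumes \<phi>: "\<phi> \<in> dual_space A"
  shows "R_op A \<phi> = restrict (conv_op \<phi>) A"
  unfolding R_op_def
proof (rule the_equality)
  obtain K where K: "0 \<le> K" "\<And>f. f \<in> A \<Longrightarrow> cmod (\<phi> f) \<le> K * norm f" using dual_bounded[OF \<phi>] by blast
  have "norm (conv_op \<phi> f) \<le> K * norm f" if f: "f \<in> A" for f
  proof (rule norm_bound)
    fix g
    have "cmod (\<phi> (left_trans g f)) \<le> K * norm (left_trans g f)" by (rule K(2)[OF left_A[OF f]])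
    also have "\<dots> \<le> K * norm f" by (intro mult_left_mono left_trans_norm_le K(1))
    finally show "cmod (conv_op \<phi> f g) \<le> K * norm f" by (simp add: conv_op_apply[OF \<phi> f])
  qed
  then have "restrict (conv_op \<phi>) A \<in> BL_alg A"
    by (auto simp: bounded_ops_def conv_op_A[OF \<phi>] conv_op_add[OF \<phi>] conv_op_scale[OF \<phi>] add_A mult_A const_A)
  then show "restrict (conv_op \<phi>) A \<in> BL_alg A \<and>
    (\<forall>\<psi>\<in>dual_space A. \<forall>f\<in>A. \<psi> (restrict (conv_op \<phi>) A f) = convolution A \<psi> \<phi> f)"
    using convolution_eq[OF _ \<phi>] by simp
  fix T assume T: "T \<in> BL_alg A \<and> (\<forall>\<psi>\<in>dual_space A. \<forall>f\<in>A. \<psi> (T f) = convolution A \<psi> \<phi> f)"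
  show "T = restrict (conv_op \<phi>) A"
  proof (rule extensionalityI[of _ A])
    show "T \<in> extensional A" using T by (simp add: bounded_ops_def PiE_def)
    fix f assume f: "f \<in> A"
    have Tf: "T f \<in> A" using T f by (auto simp: bounded_ops_def)
    show "T f = restrict (conv_op \<phi>) A f"
    proof (rule bcontfun_eqI)
      fix g
      have "(\<lambda>f\<in>A. apply_bcontfun f g) (T f) = (\<lambda>f\<in>A. apply_bcontfun f g) (conv_op \<phi> f)"
        using T evaluation_dual f convolution_eq[OF evaluation_dual \<phi> f] by simp
      then show "apply_bcontfun (T f) g = apply_bcontfun (restrict (conv_op \<phi>) A f) g"
        using Tf f conv_op_A[OF \<phi> f] by simp
    qed
  qed auto
qed

lemma conv_op_mult:
  assumes \<phi>: "\<phi> \<in> mult_functionals A" and "f \<in> A" "h \<in> A"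
  shows "conv_op \<phi> (f * h) = conv_op \<phi> f * conv_op \<phi> h"
  using assms mult_functional_dual[OF \<phi>]
  by (intro bcontfun_eqI) (simp add: conv_op_apply mult_A left_trans_mult mult_functional_mult left_A)

lemma conv_op_left_trans:
  assumes \<phi>: "\<phi> \<in> dual_space A" and f: "f \<in> A"
  shows "conv_op \<phi> (left_trans g f) = left_trans g (conv_op \<phi> f)"
  using assms
  by (intro bcontfun_eqI) (simp add: conv_op_apply left_A left_trans_left_trans left_trans.rep_eq[of _ "conv_op \<phi> f"])

lemma conv_op_const:
  assumes \<phi>: "\<phi> \<in> mult_functionals A"
  shows "conv_op \<phi> (const_bcontfun 1) = const_bcontfun 1"
  by (rule bcontfun_eqI)
    (simp add: conv_op_apply[OF mult_functional_dual[OF \<phi>] const_A] left_trans_const mult_functional_one[OF \<phi>])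

text \<open>By \<open>convolution_eq\<close> the convolution is \<open>\<phi>\<close> after
  \<open>conv_op \<psi>\<close>, a composition of unital homomorphisms.\<close>

lemma convolution_mult_functional:
  assumes \<phi>: "\<phi> \<in> mult_functionals A" and \<psi>: "\<psi> \<in> mult_functionals A"
  shows "convolution A \<phi> \<psi> \<in> mult_functionals A"
proof -
  note d = mult_functional_dual[OF \<phi>] mult_functional_dual[OF \<psi>]
  note c = convolution_eq[OF d]
  have "convolution A \<phi> \<psi> \<in> extensional A" by (simp add: convolution_def)
  moreover have "convolution A \<phi> \<psi> (const_bcontfun 1) \<noteq> 0"
    by (simp add: c const_A conv_op_const[OF \<psi>] mult_functional_one[OF \<phi>])
  moreover have "convolution A \<phi> \<psi> (f + h) = convolution A \<phi> \<psi> f + convolution A \<phi> \<psi> h"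
    "convolution A \<phi> \<psi> (f * h) = convolution A \<phi> \<psi> f * convolution A \<phi> \<psi> h" if "f \<in> A" "h \<in> A" for f h
    using that by (simp_all add: c add_A mult_A conv_op_add[OF d(2)] conv_op_mult[OF \<psi>] conv_op_A[OF d(2)]
        dual_add[OF d(1)] mult_functional_mult[OF \<phi>])
  moreover have "convolution A \<phi> \<psi> (const_bcontfun k * f) = k * convolution A \<phi> \<psi> f" if "f \<in> A" for k f
    using that by (simp add: c mult_A const_A conv_op_scale[OF d(2)] conv_op_A[OF d(2)] dual_scale[OF d(1)])
  ultimately show ?thesis
    using const_A[of 1] unfolding mult_functionals_def linear_functional_def by blast
qed

text \<open>\<open>conv_op \<psi>\<close> commutes with left translations, so \<open>\<phi>\<close>
  applied to \<open>conv_op \<psi> (left_trans g f)\<close> is the value at \<open>g\<close> of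
  \<open>conv_op \<phi> (conv_op \<psi> f)\<close>.\<close>

lemma R_op_convolution:
  assumes \<phi>: "\<phi> \<in> mult_functionals A" and \<psi>: "\<psi> \<in> mult_functionals A"
  shows "R_op A (convolution A \<phi> \<psi>) = compose A (R_op A \<phi>) (R_op A \<psi>)"
proof -
  note d = mult_functional_dual[OF \<phi>] mult_functional_dual[OF \<psi>]
    mult_functional_dual[OF convolution_mult_functional[OF \<phi> \<psi>]]
  have "conv_op (convolution A \<phi> \<psi>) f = conv_op \<phi> (conv_op \<psi> f)" if f: "f \<in> A" for f
    by (rule bcontfun_eqI)
      (simp add: conv_op_apply d f conv_op_A convolution_eq left_A conv_op_left_trans)
  then show ?thesis by (auto simp: R_op_eq d compose_def conv_op_A)
qed

lemma R_op_endomorphism: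
  assumes \<phi>: "\<phi> \<in> mult_functionals A"
  shows "R_op A \<phi> \<in> invariant_endomorphisms A"
proof -
  note d = mult_functional_dual[OF \<phi>]
  have bl: "R_op A \<phi> \<in> BL_alg A"
  proof -
    have "norm (conv_op \<phi> f) \<le> 1 * norm f" if f: "f \<in> A" for f
    proof (rule norm_bound)
      fix g show "cmod (conv_op \<phi> f g) \<le> 1 * norm f"
        using mult_functional_bound[OF \<phi> left_A[OF f], of g] left_trans_norm_le[of g f]
        by (simp add: conv_op_apply[OF d f])
    qed
    then have "\<exists>K. \<forall>f\<in>A. norm (conv_op \<phi> f) \<le> K * norm f" by blast
    then show ?thesis
      by (auto simp: R_op_eq[OF d] bounded_ops_def conv_op_A[OF d] conv_op_add[OF d] conv_op_scale[OF d] add_A mult_A const_A)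
  qed
  have "const_bcontfun 1 \<noteq> (0 :: 'g \<Rightarrow>\<^sub>C complex)"
    by (metis const_bcontfun.rep_eq zero_bcontfun.rep_eq zero_neq_one)
  then have "\<exists>f\<in>A. R_op A \<phi> f \<noteq> 0"
    using const_A[of 1] by (intro bexI[of _ "const_bcontfun 1"]) (auto simp: R_op_eq[OF d] conv_op_const[OF \<phi>])
  with bl show ?thesis
    by (auto simp: invariant_endomorphisms_def R_op_eq[OF d] mult_A left_A conv_op_mult[OF \<phi>] conv_op_left_trans[OF d])
qed

section \<open>Endomorphisms recovered from their values at the unit\<close>

definition at_zero :: "(('g \<Rightarrow>\<^sub>C complex) \<Rightarrow> ('g \<Rightarrow>\<^sub>C complex)) \<Rightarrow> ('g \<Rightarrow>\<^sub>C complex) \<Rightarrow> complex" where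
  "at_zero T = (\<lambda>f\<in>A. apply_bcontfun (T f) 0)"

lemma at_zero_R_op:
  assumes \<phi>: "\<phi> \<in> mult_functionals A"
  shows "at_zero (R_op A \<phi>) = \<phi>"
proof (rule extensionalityI[of _ A])
  show "\<phi> \<in> extensional A" using dual_extensional[OF mult_functional_dual[OF \<phi>]] .
  show "at_zero (R_op A \<phi>) f = \<phi> f" if "f \<in> A" for f
    using that by (simp add: at_zero_def R_op_eq mult_functional_dual[OF \<phi>] conv_op_apply left_trans_zero)
qed (simp add: at_zero_def)

text \<open>Commutation with translations moves every point to the unit, so the functional
  \<open>at_zero T\<close> determines \<open>T\<close> on \<open>A\<close>.\<close>

lemma endomorphism_at:
  assumes T: "T \<in> invariant_endomorphisms A" and f: "f \<in> A"
  shows "apply_bcontfun (T f) g = at_zero T (left_trans g f)"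
proof -
  have "at_zero T (left_trans g f) = apply_bcontfun (left_trans g (T f)) 0"
    using T f left_A[OF f] by (simp add: at_zero_def invariant_endomorphisms_def)
  then show ?thesis by (simp add: left_trans.rep_eq)
qed

lemma at_zero_mult_functional:
  assumes T: "T \<in> invariant_endomorphisms A"
  shows "at_zero T \<in> mult_functionals A"
proof -
  have add: "T (f + h) = T f + T h" and scale: "T (const_bcontfun c * f) = const_bcontfun c * T f"
    and mult: "T (f * h) = T f * T h" if "f \<in> A" "h \<in> A" for f h c
    using T that by (auto simp: invariant_endomorphisms_def bounded_ops_def)
  obtain f where f: "f \<in> A" "T f \<noteq> 0" using T by (auto simp: invariant_endomorphisms_def)
  then obtain g where "apply_bcontfun (T f) g \<noteq> 0"
    by (metis bcontfun_eqI zero_bcontfun.rep_eq)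
  \<comment> \<open>A nonzero value of \<open>T f\<close> at \<open>g\<close> is a nonzero value of
    the functional at a translate of \<open>f\<close>.\<close>
  then have "at_zero T (left_trans g f) \<noteq> 0" using endomorphism_at[OF T f(1)] by simp
  with left_A[OF f(1), of g] have "\<exists>f\<in>A. at_zero T f \<noteq> 0" by blast
  moreover have "at_zero T (f + h) = at_zero T f + at_zero T h" "at_zero T (f * h) = at_zero T f * at_zero T h"
    if "f \<in> A" "h \<in> A" for f h
    using that by (simp_all add: at_zero_def add_A mult_A add mult)
  moreover have "at_zero T (const_bcontfun c * f) = c * at_zero T f" if "f \<in> A" for c f
    using that scale[OF that that, of c] mult_A[OF const_A[of c] that] by (simp add: at_zero_def)
  moreover have "at_zero T \<in> extensional A" by (simp add: at_zero_def)
  ultimately show ?thesis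
    unfolding mult_functionals_def linear_functional_def by blast
qed

lemma R_op_at_zero:
  assumes T: "T \<in> invariant_endomorphisms A"
  shows "R_op A (at_zero T) = T"
proof (rule extensionalityI[of _ A])
  note d = mult_functional_dual[OF at_zero_mult_functional[OF T]]
  show "T \<in> extensional A" using T by (simp add: invariant_endomorphisms_def bounded_ops_def PiE_def)
  show "R_op A (at_zero T) \<in> extensional A" by (simp add: R_op_eq[OF d])
  show "R_op A (at_zero T) f = T f" if f: "f \<in> A" for f
    by (rule bcontfun_eqI) (simp add: R_op_eq[OF d] f conv_op_apply[OF d f] endomorphism_at[OF T f])
qed

section \<open>The weak-star topology on multiplicative functionals\<close>

lemma topspace_weak_star: "topspace (weak_star_topology A) = mult_functionals A"
  using dual_extensional[OF mult_functional_dual] by (auto simp: weak_star_topology_def PiE_UNIV_domain PiE_def)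

lemma continuous_map_weak_star_eval:
  "f \<in> A \<Longrightarrow> continuous_map (weak_star_topology A) euclidean (\<lambda>\<phi>. \<phi> f)"
  unfolding weak_star_topology_def
  by (intro continuous_map_from_subtopology continuous_map_product_projection)

text \<open>
  The translates of \<open>f\<close> form a compact set on which \<open>\<M>\<^sub>A\<close> is equicontinuous, so pointwise
  closeness on a finite net of translates is uniform closeness of \<open>conv_op \<psi> f\<close>.
\<close>

lemma conv_op_weak_star_continuous:
  assumes \<phi>: "\<phi> \<in> mult_functionals A" and f: "f \<in> A" and e: "e > 0"
  obtains U where "openin (weak_star_topology A) U" "\<phi> \<in> U"
    "\<And>\<psi>. \<psi> \<in> U \<Longrightarrow> norm (conv_op \<psi> f - conv_op \<phi> f) < e"
proof -
  have "e / 4 > 0" using e by simp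
  then obtain S E where S: "finite S" "(\<Union>s\<in>S. E s) = UNIV"
    "\<And>s x. s \<in> S \<Longrightarrow> x \<in> E s \<Longrightarrow> dist (left_trans x f) (left_trans s f) < e / 4"
    by (rule compact_partition[OF comp continuous_left_trans[OF comp, of f]]) blast
  define V where "V s = {\<psi> \<in> topspace (weak_star_topology A). \<psi> (left_trans s f) \<in> ball (\<phi> (left_trans s f)) (e / 4)}" for s
  have V: "openin (weak_star_topology A) (V s)" for s
    unfolding V_def
    using continuous_map_weak_star_eval[OF left_A[OF f, of s]] by (rule openin_continuous_map_preimage) simp
  define U where "U = (\<Inter>s\<in>S. V s) \<inter> topspace (weak_star_topology A)"
  have "norm (conv_op \<psi> f - conv_op \<phi> f) < e" if "\<psi> \<in> U" for \<psi>
  proof -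
    have \<psi>: "\<psi> \<in> mult_functionals A" using that by (simp add: U_def topspace_weak_star)
    have lip: "cmod (\<theta> h - \<theta> k) \<le> dist h k" if "\<theta> \<in> mult_functionals A" "h \<in> A" "k \<in> A" for \<theta> h k
      using mult_functional_bound[OF that(1) diff_A[OF that(2,3)]]
        linear_functional_diff[OF mult_functional_linear[OF that(1)] that(2,3)] by (simp add: dist_norm)
    \<comment> \<open>Three errors of \<open>e / 4\<close>: two from the 1-Lipschitz functionals
      when \<open>g\<close> is replaced by its node, one from the closeness at the node.\<close>
    have "norm (conv_op \<psi> f - conv_op \<phi> f) \<le> 3 * (e / 4)"
    proof (rule norm_bound)
      fix g
      obtain s where s: "s \<in> S" "g \<in> E s" using S(2) by blast
      let ?g = "left_trans g f" and ?s = "left_trans s f"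
      have "\<psi> ?s \<in> ball (\<phi> ?s) (e / 4)" using that s by (auto simp: U_def V_def)
      then have 1: "cmod (\<psi> ?s - \<phi> ?s) \<le> e / 4" by (simp add: dist_norm norm_minus_commute)
      have 2: "cmod (\<psi> ?g - \<psi> ?s) \<le> e / 4" "cmod (\<phi> ?s - \<phi> ?g) \<le> e / 4"
        using lip[OF \<psi> left_A[OF f, of g] left_A[OF f, of s]] lip[OF \<phi> left_A[OF f, of s] left_A[OF f, of g]] S(3)[OF s]
        by (simp_all add: dist_commute)
      have "\<psi> ?g - \<phi> ?g = (\<psi> ?g - \<psi> ?s) + (\<psi> ?s - \<phi> ?s) + (\<phi> ?s - \<phi> ?g)" by simp
      then have "cmod (\<psi> ?g - \<phi> ?g) \<le> cmod (\<psi> ?g - \<psi> ?s) + cmod (\<psi> ?s - \<phi> ?s) + cmod (\<phi> ?s - \<phi> ?g)"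
        by (metis norm_triangle_ineq norm_triangle_mono order_refl)
      then show "cmod (apply_bcontfun (conv_op \<psi> f - conv_op \<phi> f) g) \<le> 3 * (e / 4)"
        using 1 2 by (simp add: conv_op_apply mult_functional_dual \<phi> \<psi> f)
    qed
    with e show ?thesis by simp
  qed
  moreover have "openin (weak_star_topology A) U"
    unfolding U_def using S(1) V by (rule openin_INT)
  moreover have "\<phi> \<in> U" using \<phi> e by (auto simp: U_def V_def topspace_weak_star)
  ultimately show thesis by (intro that)
qed

lemma topspace_strong_endomorphisms:
  "topspace (strong_op_topology (top_of_set A) (invariant_endomorphisms A)) = invariant_endomorphisms A"
  by (auto simp: strong_op_topology_def invariant_endomorphisms_def bounded_ops_def)

text \<open>Continuity of the inverse only involves evaluation at the unit, which is continuous for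
  the norm; the other direction is \<open>conv_op_weak_star_continuous\<close>.\<close>

theorem homeomorphic_R_op:
  "homeomorphic_map (weak_star_topology A)
     (strong_op_topology (top_of_set A) (invariant_endomorphisms A)) (R_op A)"
proof -
  have "homeomorphic_maps (weak_star_topology A)
     (strong_op_topology (top_of_set A) (invariant_endomorphisms A)) (R_op A) at_zero"
    unfolding homeomorphic_maps_def topspace_weak_star topspace_strong_endomorphisms
  proof (intro conjI ballI)
    show "continuous_map (weak_star_topology A) (strong_op_topology (top_of_set A) (invariant_endomorphisms A)) (R_op A)"
      unfolding strong_op_topology_def continuous_map_in_subtopology continuous_map_componentwise
        topspace_weak_star
    proof (intro conjI ballI)
      show "R_op A ` mult_functionals A \<subseteq> extensional (topspace (top_of_set A))"
        using R_op_eq[OF mult_functional_dual] by auto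
      show "R_op A \<in> mult_functionals A \<rightarrow> invariant_endomorphisms A" using R_op_endomorphism by auto
      fix f assume "f \<in> topspace (top_of_set A)"
      then have f: "f \<in> A" by simp
      show "continuous_map (weak_star_topology A) euclidean (\<lambda>\<phi>. R_op A \<phi> f)"
        unfolding Met_TC.continuous_map_to_metric mtopology_is_euclidean[symmetric]
      proof (intro ballI allI impI)
        fix \<phi> and e :: real assume "\<phi> \<in> topspace (weak_star_topology A)" and e: "0 < e"
        then have \<phi>: "\<phi> \<in> mult_functionals A" by (simp add: topspace_weak_star)
        obtain U where U: "openin (weak_star_topology A) U" "\<phi> \<in> U"
          "\<And>\<psi>. \<psi> \<in> U \<Longrightarrow> norm (conv_op \<psi> f - conv_op \<phi> f) < e"
          using conv_op_weak_star_continuous[OF \<phi> f e] by blast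
        have "\<psi> \<in> mult_functionals A" if "\<psi> \<in> U" for \<psi>
          using openin_subset[OF U(1)] that by (auto simp: topspace_weak_star)
        then have "\<forall>\<psi>\<in>U. R_op A \<psi> f \<in> Met_TC.mball (R_op A \<phi> f) e"
          using U(3) f \<phi> by (auto simp: R_op_eq mult_functional_dual dist_norm norm_minus_commute)
        with U(1,2) show "\<exists>U. openin (weak_star_topology A) U \<and> \<phi> \<in> U \<and> (\<forall>\<psi>\<in>U. R_op A \<psi> f \<in> Met_TC.mball (R_op A \<phi> f) e)"
          by blast
      qed
      show "(\<lambda>\<phi>. R_op A \<phi> f) \<in> mult_functionals A \<rightarrow> A"
        using f conv_op_A mult_functional_dual by (auto simp: R_op_eq)
    qed
    show "continuous_map (strong_op_topology (top_of_set A) (invariant_endomorphisms A)) (weak_star_topology A) at_zero"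
      unfolding weak_star_topology_def continuous_map_in_subtopology continuous_map_componentwise
        topspace_strong_endomorphisms
    proof (intro conjI ballI)
      show "at_zero ` invariant_endomorphisms A \<subseteq> extensional A" by (auto simp: at_zero_def)
      show "at_zero \<in> invariant_endomorphisms A \<rightarrow> mult_functionals A" using at_zero_mult_functional by auto
      fix f assume f: "f \<in> A"
      have "continuous_map (strong_op_topology (top_of_set A) (invariant_endomorphisms A)) (top_of_set A) (\<lambda>T. T f)"
        unfolding strong_op_topology_def using f
        by (intro continuous_map_from_subtopology continuous_map_product_projection) simp
      moreover have "continuous_map (top_of_set A) euclidean (\<lambda>h. apply_bcontfun h 0)"
        using lipschitz_on_continuous_on[of 1 A "\<lambda>h. apply_bcontfun h 0"]
        by (auto simp: lipschitz_on_def intro: dist_bounded)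
      ultimately have "continuous_map (strong_op_topology (top_of_set A) (invariant_endomorphisms A)) euclidean (\<lambda>T. apply_bcontfun (T f) 0)"
        by (rule continuous_map_compose[unfolded o_def])
      then show "continuous_map (strong_op_topology (top_of_set A) (invariant_endomorphisms A)) euclidean (\<lambda>T. at_zero T f)"
        using f by (simp add: at_zero_def)
    qed
  qed (use at_zero_R_op R_op_at_zero in auto)
  then show ?thesis by (rule homeomorphic_maps_imp_map)
qed

text \<open>Being nonzero is not a closed condition, but for a multiplicative functional it amounts
  to the value 1 at the constant 1. With this replacement the conditions are equations between
  finitely many coordinates, and the set is closed in a product of discs.\<close>

lemma compact_weak_star: "compact_space (weak_star_topology A)"
proof -
  let ?P = "product_topology (\<lambda>_. euclidean :: complex topology) A"
  let ?M = "mult_functionals A"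
  have ev: "continuous_map ?P euclidean (\<lambda>\<phi>. \<phi> f)" if "f \<in> A" for f
    using that by (rule continuous_map_product_projection)
  have cl: "closedin ?P {\<phi> \<in> topspace ?P. u \<phi> = 0}" if "continuous_map ?P euclidean u" for u :: "_ \<Rightarrow> complex"
    using closedin_continuous_map_preimage[OF that, of "{0}"] by simp
  define C1 where "C1 = (\<Inter>(f, h)\<in>A \<times> A. {\<phi> \<in> topspace ?P. \<phi> (f + h) - (\<phi> f + \<phi> h) = 0})"
  define C2 where "C2 = (\<Inter>(c, f)\<in>UNIV \<times> A. {\<phi> \<in> topspace ?P. \<phi> (const_bcontfun c * f) - c * \<phi> f = 0})"
  define C3 where "C3 = (\<Inter>(f, h)\<in>A \<times> A. {\<phi> \<in> topspace ?P. \<phi> (f * h) - \<phi> f * \<phi> h = 0})"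
  define C4 where "C4 = {\<phi> \<in> topspace ?P. \<phi> (const_bcontfun 1) - 1 = 0}"
  have const: "continuous_map ?P euclidean (\<lambda>_. c)" for c :: complex by simp
  have ne: "A \<times> A \<noteq> {}" "(UNIV :: complex set) \<times> A \<noteq> {}" using zero_A by auto
  have "closedin ?P C1"
    unfolding C1_def split_beta
    by (intro closedin_INT[OF ne(1)] cl continuous_map_diff continuous_map_add ev add_A) auto
  moreover have "closedin ?P C2"
    unfolding C2_def split_beta
    by (intro closedin_INT[OF ne(2)] cl continuous_map_diff continuous_map_complex_mult ev mult_A const_A const) auto
  moreover have "closedin ?P C3"
    unfolding C3_def split_beta
    by (intro closedin_INT[OF ne(1)] cl continuous_map_diff continuous_map_complex_mult ev mult_A) auto
  moreover have "closedin ?P C4"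
    unfolding C4_def by (intro cl continuous_map_diff ev const_A const)
  ultimately have "closedin ?P (C1 \<inter> C2 \<inter> C3 \<inter> C4)" by (intro closedin_Int)
  moreover have "C1 \<inter> C2 \<inter> C3 \<inter> C4 = ?M"
  proof
    show "?M \<subseteq> C1 \<inter> C2 \<inter> C3 \<inter> C4"
    proof
      fix \<phi> assume \<phi>: "\<phi> \<in> ?M"
      have "\<phi> \<in> topspace ?P" using dual_extensional[OF mult_functional_dual[OF \<phi>]] by (simp add: PiE_def)
      then show "\<phi> \<in> C1 \<inter> C2 \<inter> C3 \<inter> C4"
        using mult_functional_one[OF \<phi>] mult_functional_mult[OF \<phi>]
          dual_add[OF mult_functional_dual[OF \<phi>]] dual_scale[OF mult_functional_dual[OF \<phi>]]
        by (auto simp: C1_def C2_def C3_def C4_def simp del: topspace_product_topology)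
    qed
    show "C1 \<inter> C2 \<inter> C3 \<inter> C4 \<subseteq> ?M"
    proof
      fix \<phi> assume \<phi>: "\<phi> \<in> C1 \<inter> C2 \<inter> C3 \<inter> C4"
      have "\<phi> \<in> extensional A" "\<phi> (const_bcontfun 1) \<noteq> 0"
        using \<phi> by (auto simp: C4_def PiE_def)
      moreover have "\<phi> (f + h) = \<phi> f + \<phi> h" "\<phi> (f * h) = \<phi> f * \<phi> h" if "f \<in> A" "h \<in> A" for f h
        using \<phi> that by (auto simp: C1_def C3_def simp del: topspace_product_topology)
      moreover have "\<phi> (const_bcontfun c * f) = c * \<phi> f" if "f \<in> A" for c f
        using \<phi> that by (auto simp: C2_def simp del: topspace_product_topology)
      ultimately show "\<phi> \<in> ?M"
        using const_A[of 1] unfolding mult_functionals_def linear_functional_def by blast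
    qed
  qed
  ultimately have closed: "closedin ?P ?M" by simp
  have "compactin ?P (PiE A (\<lambda>f. cball 0 (norm f)))"
    unfolding compactin_PiE by (simp add: compactin_euclidean_iff)
  moreover have "?M \<subseteq> PiE A (\<lambda>f. cball 0 (norm f))"
    using dual_extensional[OF mult_functional_dual] mult_functional_bound by (auto simp: PiE_def)
  ultimately have "compactin ?P ?M" using closed by (rule closed_compactin)
  then show ?thesis unfolding weak_star_topology_def by (simp add: compact_space_subtopology)
qed

end

section \<open>Square-integrable functions\<close>

lemma borel_measurable_cnj [measurable (raw)]:
  "f \<in> borel_measurable M \<Longrightarrow> (\<lambda>x. cnj (f x)) \<in> borel_measurable M"
  by (rule measurable_compose[OF _ borel_measurable_continuous_onI[of cnj]]) (auto intro!: continuous_intros)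

locale l2_finite = finite_measure m for m :: "'a measure"
begin

abbreviation sq :: "('a \<Rightarrow> complex) set" where "sq \<equiv> square_integrable m"

text \<open>The L2 seminorm on representatives; the analysis is done with functions, and classes
  come in afterwards.\<close>

definition N :: "('a \<Rightarrow> complex) \<Rightarrow> real" where
  "N f = sqrt (LINT x|m. (cmod (f x))\<^sup>2)"

lemma sq_measurable [measurable_dest]: "f \<in> sq \<Longrightarrow> f \<in> borel_measurable m"
  and sq_integrable: "f \<in> sq \<Longrightarrow> integrable m (\<lambda>x. (cmod (f x))\<^sup>2)"
  by (auto simp: square_integrable_def)

lemma sq_mult_integrable:
  assumes f: "f \<in> sq" and h: "h \<in> sq"
  shows "integrable m (\<lambda>x. cmod (f x) * cmod (h x))"
proof (rule Bochner_Integration.integrable_bound)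
  show "integrable m (\<lambda>x. (cmod (f x))\<^sup>2 + (cmod (h x))\<^sup>2)"
    using f h by (intro Bochner_Integration.integrable_add sq_integrable)
  show "(\<lambda>x. cmod (f x) * cmod (h x)) \<in> borel_measurable m"
    using sq_measurable[OF f] sq_measurable[OF h] by simp
  show "AE x in m. norm (cmod (f x) * cmod (h x)) \<le> norm ((cmod (f x))\<^sup>2 + (cmod (h x))\<^sup>2)"
  proof (rule AE_I2)
    fix x
    have "2 * (cmod (f x) * cmod (h x)) \<le> (cmod (f x))\<^sup>2 + (cmod (h x))\<^sup>2"
      using sum_squares_bound[of "cmod (f x)" "cmod (h x)"] by simp
    moreover have "0 \<le> cmod (f x) * cmod (h x)" by simp
    ultimately show "norm (cmod (f x) * cmod (h x)) \<le> norm ((cmod (f x))\<^sup>2 + (cmod (h x))\<^sup>2)"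
      unfolding real_norm_def by linarith
  qed
qed

lemma sq_inner_integrable:
  assumes f: "f \<in> sq" and h: "h \<in> sq"
  shows "integrable m (\<lambda>x. f x * cnj (h x))"
  using sq_mult_integrable[OF assms]
proof (rule Bochner_Integration.integrable_bound)
  show "(\<lambda>x. f x * cnj (h x)) \<in> borel_measurable m"
    using sq_measurable[OF f] sq_measurable[OF h] by measurable
qed (auto simp: norm_mult)

lemma sq_add:
  assumes f: "f \<in> sq" and h: "h \<in> sq"
  shows "(\<lambda>x. f x + h x) \<in> sq"
proof -
  have "integrable m (\<lambda>x. (cmod (f x + h x))\<^sup>2)"
  proof (rule Bochner_Integration.integrable_bound)
    show "integrable m (\<lambda>x. 2 * (cmod (f x))\<^sup>2 + 2 * (cmod (h x))\<^sup>2)"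
      using f h by (intro Bochner_Integration.integrable_add integrable_mult_right sq_integrable)
    show "(\<lambda>x. (cmod (f x + h x))\<^sup>2) \<in> borel_measurable m"
      using sq_measurable[OF f] sq_measurable[OF h] by simp
    show "AE x in m. norm ((cmod (f x + h x))\<^sup>2) \<le> norm (2 * (cmod (f x))\<^sup>2 + 2 * (cmod (h x))\<^sup>2)"
    proof (rule AE_I2)
      fix x
      have "(cmod (f x + h x))\<^sup>2 \<le> (cmod (f x) + cmod (h x))\<^sup>2"
        by (intro power_mono norm_triangle_ineq) simp
      also have "\<dots> \<le> 2 * (cmod (f x))\<^sup>2 + 2 * (cmod (h x))\<^sup>2"
        using sum_squares_bound[of "cmod (f x)" "cmod (h x)"] by (simp add: power2_sum)
      finally show "norm ((cmod (f x + h x))\<^sup>2) \<le> norm (2 * (cmod (f x))\<^sup>2 + 2 * (cmod (h x))\<^sup>2)" by simp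
    qed
  qed
  then show ?thesis using sq_measurable[OF f] sq_measurable[OF h] by (simp add: square_integrable_def)
qed

lemma sq_scale:
  assumes f: "f \<in> sq"
  shows "(\<lambda>x. c * f x) \<in> sq"
  using sq_measurable[OF f] sq_integrable[OF f]
  by (simp add: square_integrable_def norm_mult power_mult_distrib)

lemma sq_diff:
  assumes f: "f \<in> sq" and h: "h \<in> sq"
  shows "(\<lambda>x. f x - h x) \<in> sq"
  using sq_add[OF f sq_scale[OF h, of "- 1"]] by simp

lemma N_nonneg: "0 \<le> N f"
  by (simp add: N_def)

lemma N_power2: "(N f)\<^sup>2 = (LINT x|m. (cmod (f x))\<^sup>2)"
  by (simp add: N_def)

lemma N_cong:
  assumes "f \<in> borel_measurable m" "h \<in> borel_measurable m" "AE x in m. f x = h x"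
  shows "N f = N h"
  unfolding N_def using assms by (intro arg_cong[where f = sqrt] integral_cong_AE) auto

lemma N_scale: "N (\<lambda>x. c * f x) = cmod c * N f"
  by (simp add: N_def norm_mult power_mult_distrib real_sqrt_mult)

lemma N_zero: "N (\<lambda>_. 0) = 0"
  by (simp add: N_def)

lemma N_minus: "N (\<lambda>x. f x - h x) = N (\<lambda>x. h x - f x)"
  by (simp add: N_def norm_minus_commute)

lemma Cauchy_Schwarz_cmod:
  assumes f: "f \<in> sq" and h: "h \<in> sq"
  shows "(LINT x|m. cmod (f x) * cmod (h x)) \<le> N f * N h"
proof -
  define a where "a = (LINT x|m. cmod (f x) * cmod (h x))"
  define F where "F = (LINT x|m. (cmod (f x))\<^sup>2)"
  define H where "H = (LINT x|m. (cmod (h x))\<^sup>2)"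
  have F0: "0 \<le> F" and H0: "0 \<le> H" and a0: "0 \<le> a" by (simp_all add: F_def H_def a_def)
  have key: "0 \<le> t\<^sup>2 * F - 2 * t * a + H" for t
  proof -
    have "0 \<le> (LINT x|m. (t * cmod (f x) - cmod (h x))\<^sup>2)" by simp
    also have "\<dots> = (LINT x|m. t\<^sup>2 * (cmod (f x))\<^sup>2 - 2 * t * (cmod (f x) * cmod (h x)) + (cmod (h x))\<^sup>2)"
      by (intro Bochner_Integration.integral_cong) (simp_all add: power2_diff power_mult_distrib algebra_simps)
    also have "\<dots> = t\<^sup>2 * F - 2 * t * a + H"
      using sq_integrable[OF f] sq_integrable[OF h] sq_mult_integrable[OF f h]
      by (simp add: F_def H_def a_def)
    finally show ?thesis .
  qed
  have "a\<^sup>2 \<le> F * H"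
  proof (cases "F = 0")
    case True
    have "a = 0"
    proof (rule ccontr)
      assume "a \<noteq> 0"
      with a0 have "a > 0" by simp
      \<comment> \<open>With \<open>F = 0\<close> the quadratic is affine in \<open>t\<close>; this
        \<open>t\<close> gives it the value \<open>- 1\<close>.\<close>
      then show False using key[of "(H + 1) / (2 * a)"] True by simp
    qed
    with True show ?thesis by simp
  next
    case False
    with F0 have "F > 0" by simp
    \<comment> \<open>The quadratic has its minimum at \<open>t = a / F\<close>.\<close>
    then show ?thesis using key[of "a / F"] by (simp add: field_simps power2_eq_square)
  qed
  then have "sqrt (a\<^sup>2) \<le> sqrt (F * H)" by (rule real_sqrt_le_mono)
  then show ?thesis using a0 by (simp add: N_def F_def H_def a_def real_sqrt_mult)
qed

lemma Cauchy_Schwarz_L2: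
  assumes f: "f \<in> sq" and h: "h \<in> sq"
  shows "cmod (LINT x|m. f x * cnj (h x)) \<le> N f * N h"
proof -
  have "cmod (LINT x|m. f x * cnj (h x)) \<le> (LINT x|m. cmod (f x * cnj (h x)))"
    by (rule integral_norm_bound)
  also have "\<dots> = (LINT x|m. cmod (f x) * cmod (h x))" by (simp add: norm_mult)
  also have "\<dots> \<le> N f * N h" using assms by (rule Cauchy_Schwarz_cmod)
  finally show ?thesis .
qed

lemma N_triangle:
  assumes f: "f \<in> sq" and h: "h \<in> sq"
  shows "N (\<lambda>x. f x + h x) \<le> N f + N h"
proof (rule power2_le_imp_le)
  have "(N (\<lambda>x. f x + h x))\<^sup>2 \<le> (LINT x|m. (cmod (f x))\<^sup>2 + 2 * (cmod (f x) * cmod (h x)) + (cmod (h x))\<^sup>2)"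
    unfolding N_power2
  proof (rule integral_mono)
    show "integrable m (\<lambda>x. (cmod (f x + h x))\<^sup>2)" using sq_integrable[OF sq_add[OF f h]] .
    show "integrable m (\<lambda>x. (cmod (f x))\<^sup>2 + 2 * (cmod (f x) * cmod (h x)) + (cmod (h x))\<^sup>2)"
      using sq_integrable[OF f] sq_integrable[OF h] sq_mult_integrable[OF f h] by simp
    fix x
    have "(cmod (f x + h x))\<^sup>2 \<le> (cmod (f x) + cmod (h x))\<^sup>2"
      by (intro power_mono norm_triangle_ineq) simp
    then show "(cmod (f x + h x))\<^sup>2 \<le> (cmod (f x))\<^sup>2 + 2 * (cmod (f x) * cmod (h x)) + (cmod (h x))\<^sup>2"
      by (simp add: power2_sum algebra_simps)
  qed
  also have "\<dots> = (N f)\<^sup>2 + 2 * (LINT x|m. cmod (f x) * cmod (h x)) + (N h)\<^sup>2"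
    using sq_integrable[OF f] sq_integrable[OF h] sq_mult_integrable[OF f h] by (simp add: N_power2)
  also have "\<dots> \<le> (N f + N h)\<^sup>2"
    using Cauchy_Schwarz_cmod[OF f h] by (simp add: power2_sum)
  finally show "(N (\<lambda>x. f x + h x))\<^sup>2 \<le> (N f + N h)\<^sup>2" .
qed (simp add: N_nonneg)

lemma N_triangle_diff:
  assumes "f \<in> sq" "g \<in> sq" "h \<in> sq"
  shows "N (\<lambda>x. f x - h x) \<le> N (\<lambda>x. f x - g x) + N (\<lambda>x. g x - h x)"
  using N_triangle[OF sq_diff[OF assms(1,2)] sq_diff[OF assms(2,3)]] by simp

lemma N_eq_0:
  assumes f: "f \<in> sq" and "N f = 0"
  shows "AE x in m. f x = 0"
proof -
  have "(LINT x|m. (cmod (f x))\<^sup>2) = 0" using assms by (simp add: N_def)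
  then show ?thesis using integral_nonneg_eq_0_iff_AE[OF sq_integrable[OF f]] by simp
qed

lemma bounded_sq:
  assumes "f \<in> borel_measurable m" "\<And>x. cmod (f x) \<le> B"
  shows "f \<in> sq" "N f \<le> B * sqrt (measure m (space m))"
proof -
  have B: "0 \<le> B" using assms(2)[of undefined] norm_ge_zero order_trans by blast
  have sqB: "(cmod (f x))\<^sup>2 \<le> B\<^sup>2" for x using assms(2) by (intro power_mono) auto
  have i: "integrable m (\<lambda>x. (cmod (f x))\<^sup>2)"
    using assms(1) sqB by (intro integrable_const_bound[of _ "B\<^sup>2"]) auto
  then show "f \<in> sq" using assms(1) by (simp add: square_integrable_def)
  have "(LINT x|m. (cmod (f x))\<^sup>2) \<le> (LINT x|m. B\<^sup>2)" using i sqB by (intro integral_mono) auto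
  then have "N f \<le> sqrt (B\<^sup>2 * measure m (space m))"
    unfolding N_def by (intro real_sqrt_le_mono) (simp add: mult.commute)
  then show "N f \<le> B * sqrt (measure m (space m))" using B by (simp add: real_sqrt_mult)
qed

lemma one_sq: "(\<lambda>_. 1) \<in> sq"
  by (rule bounded_sq(1)[of _ 1]) auto

text \<open>
  A subsequence with \<open>\<parallel>g\<^sub>k\<^sub>+\<^sub>1 - g\<^sub>k\<parallel> \<le> 2\<^sup>-\<^sup>k\<close> converges almost everywhere, because on a finite measure
  space the increments are also summable in \<open>L\<^sup>1\<close>; Fatou's lemma bounds the distance to the limit.
\<close>

lemma AE_convergent_of_summable_N:
  assumes g: "\<And>k. g k \<in> sq" and d: "\<And>k::nat. N (\<lambda>x. g (Suc k) x - g k x) \<le> (1/2) ^ k"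
  shows "AE x in m. convergent (\<lambda>k. g k x)"
proof -
  define D where "D k x = cmod (g (Suc k) x - g k x)" for k x
  have Dm: "(\<lambda>x. D k x) \<in> borel_measurable m" for k
    unfolding D_def using sq_measurable[OF g] by simp
  have i: "integrable m (D k)" and le: "(LINT x|m. D k x) \<le> N (\<lambda>_. 1) * (1/2) ^ k" for k
  proof -
    have "integrable m (\<lambda>x. cmod (g (Suc k) x - g k x) * cmod 1)"
      by (rule sq_mult_integrable[OF sq_diff[OF g g] one_sq])
    then show "integrable m (D k)" by (simp add: D_def[abs_def])
    have "(LINT x|m. cmod (g (Suc k) x - g k x) * cmod 1) \<le> N (\<lambda>x. g (Suc k) x - g k x) * N (\<lambda>_. 1)"
      by (rule Cauchy_Schwarz_cmod[OF sq_diff[OF g g] one_sq])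
    also have "\<dots> \<le> (1/2) ^ k * N (\<lambda>_. 1)" by (intro mult_right_mono d N_nonneg)
    finally show "(LINT x|m. D k x) \<le> N (\<lambda>_. 1) * (1/2) ^ k" by (simp add: D_def mult.commute)
  qed
  have "(\<integral>\<^sup>+x. (\<Sum>k. ennreal (D k x)) \<partial>m) = (\<Sum>k. \<integral>\<^sup>+x. ennreal (D k x) \<partial>m)"
    using Dm by (intro nn_integral_suminf) simp
  also have "\<dots> = (\<Sum>k. ennreal (LINT x|m. D k x))"
    by (intro suminf_cong nn_integral_eq_integral i) (simp add: D_def)
  also have "\<dots> \<le> (\<Sum>k. ennreal (N (\<lambda>_. 1) * (1/2) ^ k))"
    by (intro suminf_le ennreal_leI le) auto
  also have "\<dots> = ennreal (\<Sum>k. N (\<lambda>_. 1) * (1/2) ^ k)"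
    by (rule suminf_ennreal2) (auto intro!: summable_mult summable_geometric simp: N_nonneg)
  also have "\<dots> < \<infinity>" by simp
  finally have "(\<integral>\<^sup>+x. (\<Sum>k. ennreal (D k x)) \<partial>m) \<noteq> \<infinity>" by simp
  then have "AE x in m. (\<Sum>k. ennreal (D k x)) \<noteq> \<infinity>"
    using Dm by (intro nn_integral_noteq_infinite) simp_all
  then show ?thesis
  proof eventually_elim
    case (elim x)
    then have "summable (\<lambda>k. D k x)"
      by (intro summable_suminf_not_top) (auto simp: D_def)
    then have "summable (\<lambda>k. g (Suc k) x - g k x)"
      unfolding D_def by (rule summable_norm_cancel)
    then have "convergent (\<lambda>n. \<Sum>k<n. g (Suc k) x - g k x)"
      by (simp add: summable_iff_convergent)
    then have "convergent (\<lambda>n. (g n x - g 0 x) + g 0 x)"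
      unfolding sum_lessThan_telescope[of "\<lambda>k. g k x"] by (intro convergent_add convergent_const)
    then show "convergent (\<lambda>k. g k x)" by simp
  qed
qed

text \<open>Fatou's lemma. Square integrability of the limit is obtained along with the bound, by
  comparison with a fixed square-integrable \<open>f\<close>.\<close>

lemma N_limit_le:
  assumes g: "\<And>k::nat. g k \<in> sq" and h: "h \<in> borel_measurable m"
    and conv: "AE x in m. (\<lambda>k. g k x) \<longlonglongrightarrow> h x"
    and f: "f \<in> sq" and le: "\<forall>\<^sub>F k in sequentially. N (\<lambda>x. g k x - f x) \<le> c"
  shows "(\<lambda>x. h x - f x) \<in> sq" "N (\<lambda>x. h x - f x) \<le> c"
proof -
  obtain k0 where "N (\<lambda>x. g k0 x - f x) \<le> c" using le by (auto simp: eventually_sequentially)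
  then have c: "0 \<le> c" using N_nonneg order_trans by blast
  have fm: "f \<in> borel_measurable m" and gm: "g k \<in> borel_measurable m" for k
    using sq_measurable[OF f] sq_measurable[OF g] by auto
  have "(\<integral>\<^sup>+x. ennreal ((cmod (h x - f x))\<^sup>2) \<partial>m) = (\<integral>\<^sup>+x. liminf (\<lambda>k. ennreal ((cmod (g k x - f x))\<^sup>2)) \<partial>m)"
  proof (rule nn_integral_cong_AE)
    show "AE x in m. ennreal ((cmod (h x - f x))\<^sup>2) = liminf (\<lambda>k. ennreal ((cmod (g k x - f x))\<^sup>2))"
      using conv
    proof eventually_elim
      case (elim x)
      then have "(\<lambda>k. ennreal ((cmod (g k x - f x))\<^sup>2)) \<longlonglongrightarrow> ennreal ((cmod (h x - f x))\<^sup>2)"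
        by (intro tendsto_ennrealI tendsto_intros)
      then show ?case by (intro lim_imp_Liminf[symmetric]) simp_all
    qed
  qed
  also have "\<dots> \<le> liminf (\<lambda>k. \<integral>\<^sup>+x. ennreal ((cmod (g k x - f x))\<^sup>2) \<partial>m)"
    using gm fm by (intro nn_integral_liminf) simp
  also have "\<dots> = liminf (\<lambda>k. ennreal ((N (\<lambda>x. g k x - f x))\<^sup>2))"
    using sq_integrable[OF sq_diff[OF g f]] by (simp add: nn_integral_eq_integral N_power2)
  also have "\<dots> \<le> liminf (\<lambda>k. ennreal (c\<^sup>2))"
    using le by (intro Liminf_mono) (auto elim!: eventually_mono intro!: ennreal_leI power_mono N_nonneg)
  also have "\<dots> = ennreal (c\<^sup>2)" by (simp add: Liminf_const)
  finally have nn: "(\<integral>\<^sup>+x. ennreal ((cmod (h x - f x))\<^sup>2) \<partial>m) \<le> ennreal (c\<^sup>2)" .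
  have m2: "(\<lambda>x. (cmod (h x - f x))\<^sup>2) \<in> borel_measurable m" using h fm by simp
  have i: "integrable m (\<lambda>x. (cmod (h x - f x))\<^sup>2)"
    using m2 nn by (intro integrableI_bounded) (auto intro: le_less_trans)
  then show s: "(\<lambda>x. h x - f x) \<in> sq" using h fm by (simp add: square_integrable_def)
  have "ennreal (LINT x|m. (cmod (h x - f x))\<^sup>2) \<le> ennreal (c\<^sup>2)"
    using nn i by (simp add: nn_integral_eq_integral)
  then have "(N (\<lambda>x. h x - f x))\<^sup>2 \<le> c\<^sup>2" by (simp add: N_power2)
  then show "N (\<lambda>x. h x - f x) \<le> c" using c by (rule power2_le_imp_le)
qed

theorem riesz_fischer:
  assumes f: "\<And>n::nat. f n \<in> sq"
    and cauchy: "\<And>e. 0 < e \<Longrightarrow> \<exists>M. \<forall>i\<ge>M. \<forall>j\<ge>M. N (\<lambda>x. f i x - f j x) < e"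
  obtains h where "h \<in> sq" "\<And>e. 0 < e \<Longrightarrow> \<exists>M. \<forall>i\<ge>M. N (\<lambda>x. f i x - h x) < e"
proof -
  have "\<exists>M. \<forall>i\<ge>M. \<forall>j\<ge>M. N (\<lambda>x. f i x - f j x) < (1/2) ^ k" for k :: nat
    by (rule cauchy) simp
  then obtain M where M: "\<And>k i j. M k \<le> i \<Longrightarrow> M k \<le> j \<Longrightarrow> N (\<lambda>x. f i x - f j x) < (1/2) ^ k"
    by metis
  \<comment> \<open>Partial sums make the thresholds monotone: \<open>r l\<close> is at least
    \<open>M k\<close> whenever \<open>k <= l\<close>.\<close>
  define r where "r k = (\<Sum>i\<le>k. M i)" for k :: nat
  have rM: "M k \<le> r l" if "k \<le> l" for k l
    unfolding r_def using that by (intro member_le_sum) auto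
  define g where "g k = f (r k)" for k
  have g: "g k \<in> sq" for k by (simp add: g_def f)
  have gm: "g k \<in> borel_measurable m" for k using sq_measurable[OF g] .
  have "N (\<lambda>x. g (Suc k) x - g k x) \<le> (1/2) ^ k" for k
    unfolding g_def using M[OF rM rM, of k "Suc k" k] by simp
  with g have "AE x in m. convergent (\<lambda>k. g k x)" by (rule AE_convergent_of_summable_N)
  then have conv: "AE x in m. (\<lambda>k. g k x) \<longlonglongrightarrow> lim (\<lambda>k. g k x)"
    by eventually_elim (simp add: convergent_LIMSEQ_iff)
  define h where "h x = lim (\<lambda>k. g k x)" for x
  have h: "h \<in> borel_measurable m" unfolding h_def using gm by (rule borel_measurable_lim_metric)
  have conv: "AE x in m. (\<lambda>k. g k x) \<longlonglongrightarrow> h x" using conv by (simp add: h_def)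
  \<comment> \<open>The comparison is with any late term \<open>f i\<close>, not only with terms of
    the subsequence, so the whole sequence converges to \<open>h\<close>.\<close>
  have ev: "\<forall>\<^sub>F l in sequentially. N (\<lambda>x. g l x - f i x) \<le> (1/2) ^ k" if "M k \<le> i" for k i
    unfolding eventually_sequentially g_def using M[OF rM that] by (intro exI[of _ k]) (auto intro: less_imp_le)
  note lim = N_limit_le[OF g h conv f ev]
  have "(\<lambda>x. (h x - f (M 0) x) + f (M 0) x) \<in> sq"
    using lim(1)[of 0 "M 0"] f by (intro sq_add) simp_all
  then have hs: "h \<in> sq" by simp
  have "\<exists>M. \<forall>i\<ge>M. N (\<lambda>x. f i x - h x) < e" if e: "0 < e" for e
  proof -
    obtain k where k: "(1/2) ^ k < e" using real_arch_pow_inv[OF e, of "1/2"] by auto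
    have "N (\<lambda>x. f i x - h x) < e" if "M k \<le> i" for i
      using lim(2)[OF that] k by (subst N_minus) simp
    then show ?thesis by blast
  qed
  with hs show thesis by (rule that)
qed

section \<open>L2 classes as a complete metric space\<close>

lemma l2_class_self: "f \<in> sq \<Longrightarrow> f \<in> l2_class m f"
  by (simp add: l2_class_def)

text \<open>The choice made by \<open>l2_rep\<close> is harmless: the operations on classes respect
  equality almost everywhere.\<close>

lemma l2_rep_class:
  assumes "f \<in> sq"
  shows "l2_rep (l2_class m f) \<in> sq" "AE x in m. l2_rep (l2_class m f) x = f x"
proof -
  have "l2_rep (l2_class m f) \<in> l2_class m f"
    unfolding l2_rep_def using someI[of "\<lambda>f'. f' \<in> l2_class m f", OF l2_class_self[OF assms]] .
  then show "l2_rep (l2_class m f) \<in> sq" "AE x in m. l2_rep (l2_class m f) x = f x"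
    by (auto simp: l2_class_def)
qed

lemma l2_class_cong: "AE x in m. f x = h x \<Longrightarrow> l2_class m f = l2_class m h"
  unfolding l2_class_def by (auto elim: eventually_elim2)

lemma l2_class_eq_iff:
  assumes "f \<in> sq" "h \<in> sq"
  shows "l2_class m f = l2_class m h \<longleftrightarrow> (AE x in m. f x = h x)"
proof
  assume "l2_class m f = l2_class m h"
  then have "f \<in> l2_class m h" using l2_class_self[OF assms(1)] by simp
  then show "AE x in m. f x = h x" by (simp add: l2_class_def)
qed (rule l2_class_cong)

lemma l2_class_space: "f \<in> sq \<Longrightarrow> l2_class m f \<in> l2_space m"
  by (simp add: l2_space_def)

lemma l2_space_rep:
  assumes "F \<in> l2_space m"
  shows "l2_rep F \<in> sq" "l2_class m (l2_rep F) = F"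
proof -
  obtain f where f: "f \<in> sq" "F = l2_class m f" using assms by (auto simp: l2_space_def)
  show "l2_rep F \<in> sq" "l2_class m (l2_rep F) = F"
    using l2_rep_class[OF f(1)] l2_class_cong f(2) by auto
qed

lemma l2_spaceE:
  assumes "F \<in> l2_space m"
  obtains f where "f \<in> sq" "F = l2_class m f"
  using assms by (auto simp: l2_space_def)

lemma l2_dist_class:
  assumes f: "f \<in> sq" and h: "h \<in> sq"
  shows "l2_dist m (l2_class m f) (l2_class m h) = N (\<lambda>x. f x - h x)"
proof -
  note r = l2_rep_class[OF f] l2_rep_class[OF h]
  have "AE x in m. l2_rep (l2_class m f) x - l2_rep (l2_class m h) x = f x - h x"
    using r(2,4) by eventually_elim simp
  then have "N (\<lambda>x. l2_rep (l2_class m f) x - l2_rep (l2_class m h) x) = N (\<lambda>x. f x - h x)"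
    using sq_measurable r(1,3) f h by (intro N_cong) auto
  then show ?thesis by (simp add: l2_dist_def N_def)
qed

lemma l2_norm_class:
  assumes f: "f \<in> sq"
  shows "l2_norm m (l2_class m f) = N f"
proof -
  have "N (l2_rep (l2_class m f)) = N f"
    using l2_rep_class[OF f] sq_measurable f by (intro N_cong) auto
  then show ?thesis by (simp add: l2_norm_def N_def)
qed

lemma l2_inner_class:
  assumes f: "f \<in> sq" and h: "h \<in> sq"
  shows "l2_inner m (l2_class m f) (l2_class m h) = (LINT x|m. f x * cnj (h x))"
proof -
  note r = l2_rep_class[OF f] l2_rep_class[OF h]
  have "AE x in m. l2_rep (l2_class m f) x * cnj (l2_rep (l2_class m h) x) = f x * cnj (h x)"
    using r(2,4) by eventually_elim simp
  then show ?thesis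
    unfolding l2_inner_def using sq_measurable[OF r(1)] sq_measurable[OF r(3)] sq_measurable[OF f] sq_measurable[OF h]
    by (intro integral_cong_AE borel_measurable_times borel_measurable_cnj)
qed

lemma l2_add_class:
  assumes f: "f \<in> sq" and h: "h \<in> sq"
  shows "l2_add m (l2_class m f) (l2_class m h) = l2_class m (\<lambda>x. f x + h x)"
  unfolding l2_add_def
proof (rule l2_class_cong)
  show "AE x in m. l2_rep (l2_class m f) x + l2_rep (l2_class m h) x = f x + h x"
    using l2_rep_class(2)[OF f] l2_rep_class(2)[OF h] by eventually_elim simp
qed

lemma l2_scale_class:
  assumes f: "f \<in> sq"
  shows "l2_scale m c (l2_class m f) = l2_class m (\<lambda>x. c * f x)"
  unfolding l2_scale_def
proof (rule l2_class_cong)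
  show "AE x in m. c * l2_rep (l2_class m f) x = c * f x"
    using l2_rep_class(2)[OF f] by eventually_elim simp
qed

lemma l2_metric: "Metric_space (l2_space m) (l2_dist m)"
proof
  show "0 \<le> l2_dist m F H" for F H by (simp add: l2_dist_def)
  show "l2_dist m F H = l2_dist m H F" for F H by (simp add: l2_dist_def norm_minus_commute)
  fix F H assume F: "F \<in> l2_space m" and H: "H \<in> l2_space m"
  obtain f where f: "f \<in> sq" "F = l2_class m f" using F by (rule l2_spaceE)
  obtain h where h: "h \<in> sq" "H = l2_class m h" using H by (rule l2_spaceE)
  show "l2_dist m F H = 0 \<longleftrightarrow> F = H"
  proof
    assume "l2_dist m F H = 0"
    then have "N (\<lambda>x. f x - h x) = 0" using f h by (simp add: l2_dist_class)
    from N_eq_0[OF sq_diff[OF f(1) h(1)] this] show "F = H"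
      using f h by (simp add: l2_class_eq_iff)
  next
    assume "F = H"
    then show "l2_dist m F H = 0" by (simp add: l2_dist_def)
  qed
  fix K assume "K \<in> l2_space m"
  then obtain k where k: "k \<in> sq" "K = l2_class m k" by (rule l2_spaceE)
  show "l2_dist m F K \<le> l2_dist m F H + l2_dist m H K"
    using f h k N_triangle_diff by (simp add: l2_dist_class)
qed

sublocale L: Metric_space "l2_space m" "l2_dist m"
  by (rule l2_metric)

lemma l2_mcomplete: "L.mcomplete"
  unfolding L.mcomplete_def
proof (intro allI impI)
  fix \<sigma> assume \<sigma>: "L.MCauchy \<sigma>"
  define f where "f n = l2_rep (\<sigma> n)" for n
  have f: "f n \<in> sq" "\<sigma> n = l2_class m (f n)" for n
    using \<sigma> l2_space_rep[of "\<sigma> n"] by (auto simp: L.MCauchy_def f_def)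
  have "\<exists>M. \<forall>i\<ge>M. \<forall>j\<ge>M. N (\<lambda>x. f i x - f j x) < e" if "0 < e" for e
    using \<sigma> that f by (simp add: L.MCauchy_def l2_dist_class)
  then obtain h where h: "h \<in> sq" "\<And>e. 0 < e \<Longrightarrow> \<exists>M. \<forall>i\<ge>M. N (\<lambda>x. f i x - h x) < e"
    using riesz_fischer[of f] f(1) by metis
  have "limitin L.mtopology \<sigma> (l2_class m h) sequentially"
    unfolding L.limitin_metric using h f
    by (auto simp: l2_class_space l2_dist_class eventually_sequentially)
  then show "\<exists>x. limitin L.mtopology \<sigma> x sequentially" ..
qed

end

section \<open>Haar measure\<close>

lemma complex_subspace_UNIV: "complex_subspace UNIV"
  by (simp add: complex_subspace_def)

lemma continuous_on_UNIV_add_left: "continuous_on UNIV (\<lambda>h. (g :: 'g::topological_group_add) + h)"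
  by (intro continuous_intros)

locale haar_compact =
  fixes m :: "'g::{topological_group_add, t2_space} measure"
  assumes comp_UNIV: "compact (UNIV :: 'g set)" and haar: "haar_measure m"
begin

lemma finite_haar: "finite_measure m" and sets_haar: "sets m = sets borel" and total_haar: "measure m UNIV = 1"
  and left_haar: "distr m borel (\<lambda>h. g + h) = m"
  using haar by (auto simp: haar_measure_def regular_borel_measure_def measure_def)

sublocale l2_finite m
  unfolding l2_finite_def by (rule finite_haar)

lemma space_haar: "space m = UNIV"
  using sets_eq_imp_space_eq[OF sets_haar] by simp

lemma measurable_haar: "continuous_on UNIV (u :: 'g \<Rightarrow> 'b::topological_space) \<Longrightarrow> u \<in> borel_measurable m"
  by (simp add: measurable_cong_sets[OF sets_haar refl] borel_measurable_continuous_onI)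

lemma haar_left:
  fixes u :: "'g \<Rightarrow> complex"
  assumes "continuous_on UNIV u"
  shows "(LINT x|m. u (g + x)) = (LINT x|m. u x)"
proof -
  have "(LINT x|m. u x) = (LINT x|distr m borel (\<lambda>h. g + h). u x)" by (simp add: left_haar)
  also have "\<dots> = (LINT x|m. u (g + x))"
    using measurable_haar[OF continuous_on_UNIV_add_left[of g]] assms
    by (intro integral_distr) (auto intro: borel_measurable_continuous_onI)
  finally show ?thesis by simp
qed

lemma bcontfun_sq: "apply_bcontfun f \<in> sq" and N_le_norm: "N (apply_bcontfun f) \<le> norm f"
proof -
  have "apply_bcontfun f \<in> borel_measurable m" by (intro measurable_haar) simp
  from bounded_sq[OF this norm_bounded] show "apply_bcontfun f \<in> sq" "N (apply_bcontfun f) \<le> norm f"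
    by (auto simp: space_haar total_haar)
qed

text \<open>Fubini for a continuous family: pairing with \<open>h\<close> is a functional on C(G)
  bounded by \<open>norm h\<close>, so it passes under the integral by
  \<open>functional_family_integral\<close>.\<close>

lemma pairing_family_integral:
  fixes F :: "'g \<Rightarrow> 'g \<Rightarrow>\<^sub>C complex"
  assumes \<mu>: "finite_borel \<mu>" and F: "continuous_on UNIV F"
  shows "(LINT x|m. family_integral \<mu> F x * cnj (apply_bcontfun h x)) =
    complex_measure_integral \<mu> (\<lambda>g. LINT x|m. F g x * cnj (apply_bcontfun h x))"
proof -
  define \<psi> where "\<psi> f = (LINT x|m. apply_bcontfun f x * cnj (apply_bcontfun h x))" for f
  have i: "integrable m (\<lambda>x. apply_bcontfun f x * cnj (apply_bcontfun h x))" for f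
    using sq_inner_integrable[OF bcontfun_sq bcontfun_sq] .
  have "\<psi> (family_integral \<mu> F) = complex_measure_integral \<mu> (\<lambda>g. \<psi> (F g))"
  proof (rule functional_family_integral[OF \<mu> comp_UNIV comp_UNIV F closed_UNIV complex_subspace_UNIV UNIV_I])
    show "\<psi> (f + g) = \<psi> f + \<psi> g" for f g
      using i[of f] i[of g] by (simp add: \<psi>_def distrib_right)
    show "\<psi> (const_bcontfun c * f) = c * \<psi> f" for c f
      by (simp add: \<psi>_def mult.assoc)
    show "cmod (\<psi> f) \<le> norm h * norm f" for f
    proof -
      have "cmod (\<psi> f) \<le> N f * N h" unfolding \<psi>_def by (rule Cauchy_Schwarz_L2[OF bcontfun_sq bcontfun_sq])
      also have "\<dots> \<le> norm f * norm h" by (intro mult_mono N_le_norm N_nonneg norm_ge_zero)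
      finally show ?thesis by (simp add: mult.commute)
    qed
  qed simp
  then show ?thesis by (simp add: \<psi>_def)
qed

text \<open>
  A left invariant probability measure equals its inverse image: integrate \<open>f(y\<^sup>-\<^sup>1x)\<close> in both
  orders. Right invariance follows.
\<close>

lemma haar_inverse:
  fixes u :: "'g \<Rightarrow> complex"
  assumes u: "continuous_on UNIV u"
  shows "(LINT x|m. u (- x)) = (LINT x|m. u x)"
proof -
  \<comment> \<open>Haar measure as a complex measure with null components, so that
    \<open>family_integral\<close> can use it.\<close>
  define \<mu> where "\<mu> k = (if k = 0 then m else null_measure borel)" for k :: nat
  have fb: "finite_borel \<mu>"
    using finite_haar sets_haar by (auto simp: finite_borel_def \<mu>_def intro!: finite_measureI)
  have cmi: "complex_measure_integral \<mu> v = (LINT x|m. v x)" for v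
    by (simp add: complex_measure_integral_def \<mu>_def eval_nat_numeral)
  define F where "F x = Bcontfun (\<lambda>y. u (- y + x))" for x
  have cu: "continuous_on S g \<Longrightarrow> continuous_on S (\<lambda>x. u (g x))" for S and g :: "'b::topological_space \<Rightarrow> 'g"
    by (rule continuous_on_compose2[OF u]) auto
  have F_apply: "apply_bcontfun (F x) y = u (- y + x)" for x y
    unfolding F_def by (subst bcontfun_compact[OF comp_UNIV]) (auto intro!: cu continuous_intros)
  have F: "continuous_on UNIV F"
    by (rule continuous_on_curry_bcontfun[OF comp_UNIV]) (auto simp: F_apply split_beta intro!: cu continuous_intros)
  have fi: "apply_bcontfun (family_integral \<mu> F) y = (LINT x|m. u x)" for y
    using haar_left[OF u] by (simp add: family_integral_apply[OF fb comp_UNIV comp_UNIV F] cmi F_apply)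
  \<comment> \<open>\<open>- y + x\<close> is the inverse of \<open>- x + y\<close>; left invariance
    in \<open>y\<close> then removes \<open>x\<close>.\<close>
  have inner: "(LINT y|m. u (- y + x)) = (LINT y|m. u (- y))" for x
  proof -
    have "(LINT y|m. u (- y + x)) = (LINT y|m. u (- (- x + y)))" by (simp add: minus_add)
    also have "\<dots> = (LINT y|m. u (- y))"
      by (rule haar_left) (intro cu continuous_intros)
    finally show ?thesis .
  qed
  \<comment> \<open>Pairing with the constant 1 equates the two orders of integration: one gives the
    integral of \<open>u x\<close>, the other that of \<open>u (- y)\<close>.\<close>
  show ?thesis
    using pairing_family_integral[OF fb F, of "const_bcontfun 1"]
    by (simp add: fi cmi F_apply inner space_haar total_haar)
qed

text \<open>Conjugation by the inverse turns a right translation into a left one.\<close>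

lemma haar_right:
  fixes u :: "'g \<Rightarrow> complex"
  assumes u: "continuous_on UNIV u"
  shows "(LINT x|m. u (x + g)) = (LINT x|m. u x)"
proof -
  have cu: "continuous_on S h \<Longrightarrow> continuous_on S (\<lambda>x. u (h x))" for S and h :: "'g \<Rightarrow> 'g"
    by (rule continuous_on_compose2[OF u]) auto
  have "(LINT x|m. u (x + g)) = (LINT x|m. u (- x + g))"
    by (rule haar_inverse[symmetric]) (intro cu continuous_intros)
  also have "\<dots> = (LINT x|m. u (- (- g + x)))" by (simp add: minus_add)
  also have "\<dots> = (LINT x|m. u (- x))"
    by (rule haar_left) (intro cu continuous_intros)
  also have "\<dots> = (LINT x|m. u x)" using u by (rule haar_inverse)
  finally show ?thesis .
qed

text \<open>Finitely many translates of \<open>U\<close> cover the compact group, and by left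
  invariance they all have the measure of \<open>U\<close>.\<close>

lemma haar_open_positive:
  assumes U: "open U" "u0 \<in> U"
  shows "emeasure m U \<noteq> 0"
proof
  assume zero: "emeasure m U = 0"
  define V where "V g = {x. g + x \<in> U}" for g
  have V: "V g = (\<lambda>h. g + h) -` U \<inter> space m" for g by (auto simp: V_def space_haar)
  have op: "open (V g)" for g
    using continuous_open_preimage[OF continuous_on_UNIV_add_left[of g] open_UNIV U(1)] by (simp add: V space_haar)
  have null: "emeasure m (V g) = 0" for g
  proof -
    have "emeasure m (V g) = emeasure (distr m borel (\<lambda>h. g + h)) U"
      using measurable_haar[OF continuous_on_UNIV_add_left[of g]] U(1) by (subst emeasure_distr) (auto simp: V)
    then show ?thesis by (simp add: left_haar zero)
  qed
  have "UNIV \<subseteq> (\<Union>g\<in>UNIV. V g)"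
  proof
    fix x have "x \<in> V (u0 - x)" using U(2) by (simp add: V_def)
    then show "x \<in> (\<Union>g\<in>UNIV. V g)" by blast
  qed
  then obtain D where D: "finite D" "UNIV \<subseteq> (\<Union>g\<in>D. V g)"
    using compactE_image[OF comp_UNIV, of UNIV V] op by metis
  have "emeasure m (\<Union>g\<in>D. V g) \<le> (\<Sum>g\<in>D. emeasure m (V g))"
    using D(1) op by (intro emeasure_subadditive_finite) (auto simp: sets_haar)
  then have "emeasure m UNIV = 0" using D(2) null by (simp add: top.extremum_unique)
  then show False using total_haar by (simp add: measure_def)
qed

text \<open>The set where two continuous functions differ is open, so it is empty if null.
  Consequently C(G) embeds injectively into L2.\<close>

lemma bcontfun_AE_eq:
  assumes "AE x in m. apply_bcontfun f x = apply_bcontfun h x"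
  shows "f = h"
proof (rule bcontfun_eqI, rule ccontr)
  fix x assume x: "apply_bcontfun f x \<noteq> apply_bcontfun h x"
  let ?U = "{x. apply_bcontfun f x \<noteq> apply_bcontfun h x}"
  have op: "open ?U" by (intro open_Collect_neq) auto
  then have "?U \<in> sets m" by (simp add: sets_haar)
  then have "emeasure m ?U = 0" using assms AE_iff_measurable[of ?U m "\<lambda>x. apply_bcontfun f x = apply_bcontfun h x"]
    by (simp add: space_haar)
  then show False using haar_open_positive[OF op] x by blast
qed

section \<open>Averages of right translations\<close>

definition average :: "(nat \<Rightarrow> 'g measure) \<Rightarrow> ('g \<Rightarrow>\<^sub>C complex) \<Rightarrow> 'g \<Rightarrow>\<^sub>C complex" where
  "average \<mu> f = family_integral \<mu> (\<lambda>g. right_trans g f)"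

text \<open>The conjugate of \<open>\<i> ^ k\<close> is \<open>\<i> ^ (4 - k)\<close>, so
  conjugating a complex measure exchanges the components 1 and 3.\<close>

definition conj_measure :: "(nat \<Rightarrow> 'g measure) \<Rightarrow> nat \<Rightarrow> 'g measure" where
  "conj_measure \<mu> k = \<mu> (if k = 1 then 3 else if k = 3 then 1 else k)"

text \<open>The L2 adjoint of \<open>average \<mu>\<close>: right translation by \<open>g\<close>
  has as adjoint the one by \<open>- g\<close>, and the measure is conjugated.\<close>

definition adj_average :: "(nat \<Rightarrow> 'g measure) \<Rightarrow> ('g \<Rightarrow>\<^sub>C complex) \<Rightarrow> 'g \<Rightarrow>\<^sub>C complex" where
  "adj_average \<mu> f = family_integral (conj_measure \<mu>) (\<lambda>g. right_trans (- g) f)"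

lemma conj_measure_integral:
  "complex_measure_integral (conj_measure \<mu>) u = cnj (complex_measure_integral \<mu> (\<lambda>x. cnj (u x)))"
  by (simp add: complex_measure_integral_def conj_measure_def eval_nat_numeral)

lemma finite_borel_conj: "finite_borel \<mu> \<Longrightarrow> finite_borel (conj_measure \<mu>)"
  by (simp add: finite_borel_def conj_measure_def)

lemma continuous_right_trans_minus: "continuous_on UNIV (\<lambda>g. right_trans (- g) (f :: 'g \<Rightarrow>\<^sub>C complex))"
  by (rule continuous_on_compose2[OF continuous_right_trans[OF comp_UNIV]]) (auto intro!: continuous_intros)

lemma average_apply:
  "finite_borel \<mu> \<Longrightarrow> apply_bcontfun (average \<mu> f) x = complex_measure_integral \<mu> (\<lambda>g. apply_bcontfun f (x + g))"
  by (simp add: average_def family_integral_apply comp_UNIV continuous_right_trans right_trans.rep_eq)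

lemma adj_average_apply:
  "finite_borel \<mu> \<Longrightarrow> apply_bcontfun (adj_average \<mu> f) x = cnj (complex_measure_integral \<mu> (\<lambda>g. cnj (apply_bcontfun f (x - g))))"
  by (simp add: adj_average_def family_integral_apply finite_borel_conj comp_UNIV continuous_right_trans_minus
      right_trans.rep_eq conj_measure_integral)

text \<open>Right invariance of Haar measure carries the translation by \<open>g\<close> from
  \<open>f\<close> to \<open>h\<close>; \<open>pairing_family_integral\<close> exchanges the
  integrations before and after.\<close>

lemma average_adjoint:
  assumes \<mu>: "finite_borel \<mu>"
  shows "(LINT x|m. average \<mu> f x * cnj (apply_bcontfun h x)) = (LINT x|m. apply_bcontfun f x * cnj (adj_average \<mu> h x))"
proof -
  have "(LINT x|m. average \<mu> f x * cnj (apply_bcontfun h x)) =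
    complex_measure_integral \<mu> (\<lambda>g. LINT x|m. apply_bcontfun f (x + g) * cnj (apply_bcontfun h x))"
    using pairing_family_integral[OF \<mu> continuous_right_trans[OF comp_UNIV]]
    by (simp add: average_def right_trans.rep_eq)
  also have "\<dots> = complex_measure_integral \<mu> (\<lambda>g. LINT x|m. apply_bcontfun f x * cnj (apply_bcontfun h (x - g)))"
  proof -
    have "(LINT x|m. apply_bcontfun f (x + g) * cnj (apply_bcontfun h x)) =
        (LINT x|m. apply_bcontfun f x * cnj (apply_bcontfun h (x - g)))" for g
      using haar_right[of "\<lambda>x. apply_bcontfun f x * cnj (apply_bcontfun h (x - g))" g]
      by (simp add: continuous_intros)
    then show ?thesis by simp
  qed
  also have "\<dots> = cnj (complex_measure_integral (conj_measure \<mu>) (\<lambda>g. LINT x|m. apply_bcontfun h (x - g) * cnj (apply_bcontfun f x)))"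
    unfolding conj_measure_integral by (simp add: mult.commute flip: Bochner_Integration.integral_cnj)
  also have "\<dots> = cnj (LINT x|m. adj_average \<mu> h x * cnj (apply_bcontfun f x))"
    using pairing_family_integral[OF finite_borel_conj[OF \<mu>] continuous_right_trans_minus]
    by (simp add: adj_average_def right_trans.rep_eq)
  also have "\<dots> = (LINT x|m. apply_bcontfun f x * cnj (adj_average \<mu> h x))"
    by (simp add: mult.commute flip: Bochner_Integration.integral_cnj)
  finally show ?thesis .
qed

lemma N_right_trans: "N (right_trans g f) = N f"
proof -
  have "complex_of_real (LINT x|m. (cmod (apply_bcontfun f (x + g)))\<^sup>2) = complex_of_real (LINT x|m. (cmod (f x))\<^sup>2)"
    using haar_right[of "\<lambda>x. complex_of_real ((cmod (apply_bcontfun f x))\<^sup>2)" g]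
    by (simp only: integral_complex_of_real) (simp add: continuous_intros)
  then show ?thesis unfolding N_def by (simp only: of_real_eq_iff right_trans.rep_eq)
qed

text \<open>Right translations are L2 isometries, so a Riemann sum has norm at most
  \<open>N f\<close> times the sum of the moduli of its weights, which is at most
  \<open>mass \<mu>\<close>. Approximation in the sup-norm suffices because Haar measure has total
  mass 1.\<close>

lemma N_average_le:
  assumes \<mu>: "finite_borel \<mu>"
  shows "N (average \<mu> f) \<le> mass \<mu> * N f"
proof (rule field_le_epsilon)
  fix e :: real assume e: "e > 0"
  let ?F = "\<lambda>g. right_trans g f"
  obtain S c where S: "riemann_approx \<mu> ?F e S c"
    by (rule riemann_sum[OF \<mu> comp_UNIV continuous_right_trans[OF comp_UNIV] e])
  let ?R = "\<Sum>s\<in>S. const_bcontfun (c s) * ?F s"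
  have "N ?R \<le> (\<Sum>s\<in>S. cmod (c s) * N f)"
    using riemann_approxD(1)[OF S]
  proof (induction S rule: finite_induct)
    case empty
    then show ?case by (simp add: zero_bcontfun.rep_eq[abs_def] N_zero)
  next
    case (insert s S)
    have "N (const_bcontfun (c s) * ?F s + (\<Sum>s\<in>S. const_bcontfun (c s) * ?F s)) \<le>
      N (const_bcontfun (c s) * ?F s) + N (\<Sum>s\<in>S. const_bcontfun (c s) * ?F s)"
      using N_triangle[OF bcontfun_sq[of "const_bcontfun (c s) * ?F s"] bcontfun_sq[of "\<Sum>s\<in>S. const_bcontfun (c s) * ?F s"]]
      by (simp only: plus_bcontfun.rep_eq)
    moreover have "N (const_bcontfun (c s) * ?F s) = cmod (c s) * N f"
      using N_scale[of "c s" "?F s"] by (simp add: times_bcontfun.rep_eq[abs_def] N_right_trans)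
    ultimately show ?case using insert by simp
  qed
  also have "\<dots> \<le> mass \<mu> * N f"
    unfolding sum_distrib_right[symmetric] by (intro mult_right_mono riemann_approxD(2)[OF S] N_nonneg)
  finally have R: "N ?R \<le> mass \<mu> * N f" .
  have "norm (average \<mu> f - ?R) \<le> e"
    unfolding average_def by (rule family_integral_approx[OF \<mu> comp_UNIV comp_UNIV continuous_right_trans[OF comp_UNIV] S])
  then have "N (average \<mu> f - ?R) \<le> e" using N_le_norm order_trans by blast
  moreover have "N (average \<mu> f) \<le> N (average \<mu> f - ?R) + N ?R"
    using N_triangle[OF bcontfun_sq[of "average \<mu> f - ?R"] bcontfun_sq[of ?R]] by simp
  ultimately show "N (average \<mu> f) \<le> mass \<mu> * N f + e" using R by linarith
qed

end

section \<open>Closure of the algebra under \<open>fun_star\<close>\<close>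

locale invariant_algebra_haar = invariant_algebra_compact A + haar_compact m
  for A :: "('g::{topological_group_add, t2_space} \<Rightarrow>\<^sub>C complex) set" and m :: "'g measure"
begin

lemma adj_average_A:
  assumes "finite_borel \<mu>" "f \<in> A"
  shows "adj_average \<mu> f \<in> A"
  unfolding adj_average_def
  using assms by (intro family_integral_in_closed_subspace finite_borel_conj comp continuous_right_trans_minus
      closed_A subspace_A right_A)

text \<open>
  Let a measure \<open>\<mu>\<close> annihilate \<open>A\<close> but not \<open>f\<^sup>\<star>\<close>, and let \<open>M\<close> be convolution with \<open>\<mu>\<close>.
  Then \<open>q = M\<^sup>* f \<in> A\<close>, hence \<open>M q = 0\<close> and \<open>\<langle>q, q\<rangle> = \<langle>M q, f\<rangle> = 0\<close>, although
  \<open>cnj (q 0)\<close> is the integral of \<open>f\<^sup>\<star>\<close>.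
\<close>

theorem fun_star_A:
  assumes f: "f \<in> A"
  shows "fun_star f \<in> A"
proof (rule ccontr)
  assume notin: "fun_star f \<notin> A"
  define d where "d = infdist (fun_star f) A"
  have d: "d > 0"
    unfolding d_def using notin closed_A zero_A by (intro infdist_pos_not_in_closed) auto
  have sub: "sublinear (norm :: ('g \<Rightarrow>\<^sub>C complex) \<Rightarrow> real)"
    by (auto simp: sublinear_def norm_triangle_ineq)
  \<comment> \<open>Separation from the subspace \<open>A\<close>: on pairs with nonnegative second
    entry \<open>t\<close>, \<open>t * d\<close> is below the norm because \<open>d\<close> is the
    distance of \<open>fun_star f\<close> from \<open>A\<close>. The resulting functional vanishes
    on \<open>A\<close> and is at least \<open>d\<close> at \<open>fun_star f\<close>.\<close>
  have "\<exists>F. linear F \<and> F \<le> norm \<and> (\<forall>p\<in>A \<times> {0..}. snd p * d \<le> F (fst p + snd p *\<^sub>R fun_star f))"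
  proof (rule hahn_banach[OF sub, of "A \<times> {0..}" "\<lambda>p. fst p + snd p *\<^sub>R fun_star f" "\<lambda>p. snd p * d"])
    show "0 \<in> A \<times> {0::real..}" using zero_A by (simp add: zero_prod_def)
    show "snd p * d \<le> norm (fst p + snd p *\<^sub>R fun_star f)" if p: "p \<in> A \<times> {0..}" for p
    proof (cases "snd p = 0")
      case False
      with p have t: "snd p > 0" by auto
      let ?a = "(- 1 / snd p) *\<^sub>R fst p"
      have "?a \<in> A" using p by (intro scaleR_A) auto
      then have "d \<le> dist (fun_star f) ?a" unfolding d_def by (rule infdist_le)
      then have "snd p * d \<le> snd p * norm (fun_star f - ?a)" using t by (simp add: dist_norm)
      also have "\<dots> = norm (snd p *\<^sub>R (fun_star f - ?a))" using t by simp
      also have "snd p *\<^sub>R (fun_star f - ?a) = fst p + snd p *\<^sub>R fun_star f"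
        using t by (simp add: scaleR_diff_right scaleR_add_right)
      finally show ?thesis .
    qed simp
  qed (auto simp: add_A scaleR_A algebra_simps)
  then obtain F where F: "linear F" "F \<le> norm"
    and Fd: "\<And>a t. a \<in> A \<Longrightarrow> 0 \<le> t \<Longrightarrow> t * d \<le> F (a + t *\<^sub>R fun_star f)" by force
  have FA: "F a = 0" if "a \<in> A" for a
    using Fd[OF that, of 0] Fd[OF scaleR_A[OF that, of "- 1"], of 0] by (simp add: linear_neg[OF F(1)])
  have Fs: "F (fun_star f) > 0" using Fd[OF zero_A, of 1] d by simp
  have F_abs: "\<bar>F h\<bar> \<le> norm h" for h
    using le_funD[OF F(2), of h] le_funD[OF F(2), of "- h"] by (simp add: linear_neg[OF F(1)])
  \<comment> \<open>The complex-linear functional with real part \<open>F\<close>. Any bound will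
    do, as only some representing measure is wanted.\<close>
  define \<Psi> where "\<Psi> h = complex_of_real (F h) - \<i> * complex_of_real (F (const_bcontfun \<i> * h))" for h
  have \<Psi>_add: "\<Psi> (h + k) = \<Psi> h + \<Psi> k" for h k
    by (simp add: \<Psi>_def linear_add[OF F(1)] algebra_simps)
  have \<Psi>_scale: "\<Psi> (const_bcontfun c * h) = c * \<Psi> h" for c h
  proof -
    have "const_bcontfun c * h = Re c *\<^sub>R h + Im c *\<^sub>R (const_bcontfun \<i> * h)"
      by (rule bcontfun_eqI) (simp add: complex_eq_iff)
    then have 1: "F (const_bcontfun c * h) = Re c * F h + Im c * F (const_bcontfun \<i> * h)"
      by (simp add: linear_add[OF F(1)] linear_scale[OF F(1)])
    have "const_bcontfun \<i> * (const_bcontfun c * h) = Re c *\<^sub>R (const_bcontfun \<i> * h) + (- Im c) *\<^sub>R h"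
      by (rule bcontfun_eqI) (simp add: complex_eq_iff)
    then have 2: "F (const_bcontfun \<i> * (const_bcontfun c * h)) = Re c * F (const_bcontfun \<i> * h) - Im c * F h"
      by (simp only: linear_add[OF F(1)] linear_scale[OF F(1)]) simp
    show ?thesis unfolding \<Psi>_def 1 2 by (simp add: complex_eq_iff)
  qed
  have \<Psi>_bound: "cmod (\<Psi> h) \<le> 2 * norm h" for h
  proof -
    have "norm (const_bcontfun \<i> * h) \<le> norm h"
      by (rule norm_bound) (simp add: norm_mult norm_bounded)
    moreover have "cmod (\<Psi> h) \<le> \<bar>F h\<bar> + \<bar>F (const_bcontfun \<i> * h)\<bar>"
      unfolding \<Psi>_def by (rule order_trans[OF norm_triangle_ineq4]) (simp add: norm_mult)
    ultimately show ?thesis using F_abs[of h] F_abs[of "const_bcontfun \<i> * h"] by linarith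
  qed
  obtain \<mu> where \<mu>: "measure_extends UNIV \<mu> \<Psi>"
    using exists_measure_extends[OF comp complex_subspace_UNIV \<Psi>_add \<Psi>_scale _ \<Psi>_bound] by force
  then have fb: "finite_borel \<mu>" and int: "complex_measure_integral \<mu> (apply_bcontfun h) = \<Psi> h" for h
    by (auto simp: measure_extends_def intro: regular_imp_finite_borel)
  define q where "q = adj_average \<mu> f"
  have q: "q \<in> A" unfolding q_def by (rule adj_average_A[OF fb f])
  \<comment> \<open>Every value of this average is \<open>\<Psi>\<close> of a left translate of
    \<open>q\<close>, an element of \<open>A\<close>.\<close>
  have "average \<mu> q = 0"
  proof (rule bcontfun_eqI)
    fix x
    have "apply_bcontfun (average \<mu> q) x = \<Psi> (left_trans x q)"
      using int[of "left_trans x q"] by (simp add: average_apply[OF fb] left_trans.rep_eq)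
    also have "\<dots> = 0" using left_A[OF q, of x] by (simp add: \<Psi>_def FA mult_A const_A)
    finally show "apply_bcontfun (average \<mu> q) x = apply_bcontfun 0 x" by simp
  qed
  \<comment> \<open>The adjoint relation turns the pairing of \<open>average \<mu> q\<close> with
    \<open>f\<close> into that of \<open>q\<close> with itself.\<close>
  then have "(LINT x|m. apply_bcontfun q x * cnj (apply_bcontfun q x)) = 0"
    using average_adjoint[OF fb, of q f] by (simp add: q_def)
  then have "complex_of_real (LINT x|m. (cmod (apply_bcontfun q x))\<^sup>2) = 0"
    by (simp only: complex_norm_square[symmetric] integral_complex_of_real)
  then have "N q = 0" by (simp add: N_def)
  then have "AE x in m. apply_bcontfun q x = apply_bcontfun 0 x"
    using N_eq_0[OF bcontfun_sq] by simp
  then have "q = 0" by (rule bcontfun_AE_eq)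
  then have "cnj (complex_measure_integral \<mu> (\<lambda>g. cnj (apply_bcontfun f (- g)))) = 0"
    using adj_average_apply[OF fb, of f 0] by (simp add: q_def)
  then have "\<Psi> (fun_star f) = 0"
    using int[of "fun_star f"] by (simp add: fun_star.rep_eq)
  then have "Re (\<Psi> (fun_star f)) = 0" by simp
  then show False using Fs by (simp add: \<Psi>_def)
qed

end

section \<open>Linear and inner product structure on classes\<close>

context l2_finite
begin

lemma l2_add_space: "F \<in> l2_space m \<Longrightarrow> H \<in> l2_space m \<Longrightarrow> l2_add m F H \<in> l2_space m"
  by (elim l2_spaceE) (simp add: l2_add_class l2_class_space sq_add)

lemma l2_scale_space: "F \<in> l2_space m \<Longrightarrow> l2_scale m c F \<in> l2_space m"
  by (elim l2_spaceE) (simp add: l2_scale_class l2_class_space sq_scale)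

lemma l2_dist_add_le:
  assumes "F \<in> l2_space m" "H \<in> l2_space m" "F' \<in> l2_space m" "H' \<in> l2_space m"
  shows "l2_dist m (l2_add m F H) (l2_add m F' H') \<le> l2_dist m F F' + l2_dist m H H'"
proof -
  obtain f h f' h' where "f \<in> sq" "F = l2_class m f" "h \<in> sq" "H = l2_class m h"
    "f' \<in> sq" "F' = l2_class m f'" "h' \<in> sq" "H' = l2_class m h'"
    using assms by (meson l2_spaceE)
  then show ?thesis
    using N_triangle[OF sq_diff[of f f'] sq_diff[of h h']]
    by (simp add: l2_add_class l2_dist_class sq_add algebra_simps)
qed

lemma l2_dist_scale:
  assumes "F \<in> l2_space m" "H \<in> l2_space m"
  shows "l2_dist m (l2_scale m c F) (l2_scale m c H) = cmod c * l2_dist m F H"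
proof -
  obtain f h where "f \<in> sq" "F = l2_class m f" "h \<in> sq" "H = l2_class m h"
    using assms by (meson l2_spaceE)
  then show ?thesis
    using N_scale[of c "\<lambda>x. f x - h x"] by (simp add: l2_scale_class l2_dist_class sq_scale right_diff_distrib)
qed

lemma zero_sq: "(\<lambda>_. 0) \<in> sq"
  by (rule bounded_sq(1)[of _ 0]) auto

lemma l2_norm_dist: "F \<in> l2_space m \<Longrightarrow> l2_norm m F = l2_dist m F (l2_class m (\<lambda>_. 0))"
  by (elim l2_spaceE) (simp add: l2_norm_class l2_dist_class zero_sq)

lemma l2_inner_diff_left:
  assumes "F \<in> l2_space m" "F' \<in> l2_space m" "H \<in> l2_space m"
  shows "cmod (l2_inner m F H - l2_inner m F' H) \<le> l2_dist m F F' * l2_norm m H"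
proof -
  obtain f f' h where s: "f \<in> sq" "F = l2_class m f" "f' \<in> sq" "F' = l2_class m f'" "h \<in> sq" "H = l2_class m h"
    using assms by (meson l2_spaceE)
  have "l2_inner m F H - l2_inner m F' H = (LINT x|m. (f x - f' x) * cnj (h x))"
    using s sq_inner_integrable by (simp add: l2_inner_class left_diff_distrib)
  with s show ?thesis
    using Cauchy_Schwarz_L2[OF sq_diff[of f f'], of h] by (simp add: l2_dist_class l2_norm_class)
qed

lemma l2_inner_commute:
  assumes "F \<in> l2_space m" "H \<in> l2_space m"
  shows "l2_inner m H F = cnj (l2_inner m F H)"
proof -
  obtain f h where "f \<in> sq" "F = l2_class m f" "h \<in> sq" "H = l2_class m h"
    using assms by (meson l2_spaceE)
  then show ?thesis
    by (simp add: l2_inner_class mult.commute flip: Bochner_Integration.integral_cnj)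
qed

lemma l2_inner_diff_right:
  assumes "F \<in> l2_space m" "H \<in> l2_space m" "H' \<in> l2_space m"
  shows "cmod (l2_inner m F H - l2_inner m F H') \<le> l2_dist m H H' * l2_norm m F"
proof -
  have "l2_inner m F H - l2_inner m F H' = cnj (l2_inner m H F - l2_inner m H' F)"
    by (simp add: l2_inner_commute[OF assms(2,1)] l2_inner_commute[OF assms(3,1)])
  then show ?thesis using l2_inner_diff_left[OF assms(2,3,1)] by (simp only: complex_mod_cnj)
qed

text \<open>Expansion of the squared distance; it yields the uniqueness of adjoints.\<close>

lemma l2_dist_power2:
  assumes "F \<in> l2_space m" "H \<in> l2_space m"
  shows "complex_of_real ((l2_dist m F H)\<^sup>2) =
    l2_inner m F F - l2_inner m F H - l2_inner m H F + l2_inner m H H"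
proof -
  obtain f h where s: "f \<in> sq" "F = l2_class m f" "h \<in> sq" "H = l2_class m h"
    using assms by (meson l2_spaceE)
  have "complex_of_real ((l2_dist m F H)\<^sup>2) = (LINT x|m. (f x - h x) * cnj (f x - h x))"
    using s by (simp only: l2_dist_class N_power2 complex_norm_square[symmetric] integral_complex_of_real)
  also have "\<dots> = (LINT x|m. f x * cnj (f x) - f x * cnj (h x) - h x * cnj (f x) + h x * cnj (h x))"
    by (intro Bochner_Integration.integral_cong) (simp_all add: algebra_simps)
  also have "\<dots> = l2_inner m F F - l2_inner m F H - l2_inner m H F + l2_inner m H H"
    using s sq_inner_integrable by (simp add: l2_inner_class)
  finally show ?thesis .
qed

end

section \<open>The space H2 and the dense image of the algebra\<close>

context invariant_algebra_haar
begin

definition cls :: "('g \<Rightarrow>\<^sub>C complex) \<Rightarrow> ('g \<Rightarrow> complex) set" where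
  "cls f = l2_class m (apply_bcontfun f)"

abbreviation "H \<equiv> H2 A m"
abbreviation "d \<equiv> l2_dist m"

lemma cls_space: "cls f \<in> l2_space m"
  unfolding cls_def by (rule l2_class_space[OF bcontfun_sq])

lemma cls_add: "l2_add m (cls f) (cls h) = cls (f + h)"
  unfolding cls_def l2_add_class[OF bcontfun_sq bcontfun_sq] by (simp add: plus_bcontfun.rep_eq[abs_def])

lemma cls_scale: "l2_scale m c (cls f) = cls (const_bcontfun c * f)"
  unfolding cls_def l2_scale_class[OF bcontfun_sq] by (simp add: times_bcontfun.rep_eq[abs_def])

lemma d_cls: "d (cls f) (cls h) = N (f - h)"
  unfolding cls_def l2_dist_class[OF bcontfun_sq bcontfun_sq] by (simp add: minus_bcontfun.rep_eq[abs_def])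

lemma cls_zero: "cls 0 = l2_class m (\<lambda>_. 0)"
  by (simp add: cls_def zero_bcontfun.rep_eq[abs_def])

lemma cls_inj: "cls f = cls h \<Longrightarrow> f = h"
  unfolding cls_def l2_class_eq_iff[OF bcontfun_sq bcontfun_sq] by (rule bcontfun_AE_eq)

lemma l2_topology_eq: "l2_topology m = L.mtopology"
  by (simp add: l2_topology_def)

lemma H_closure: "H = l2_topology m closure_of (cls ` A)"
  by (simp add: H2_def cls_def[abs_def])

text \<open>The working form of the closure: the density arguments below choose some
  \<open>f\<close> in \<open>A\<close> within a prescribed distance.\<close>

lemma H_iff: "x \<in> H \<longleftrightarrow> x \<in> l2_space m \<and> (\<forall>e>0. \<exists>f\<in>A. d x (cls f) < e)"
  unfolding H2_def l2_topology_eq L.metric_closure_of using cls_space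
  by (auto simp: cls_def[symmetric])

lemma H_space: "x \<in> H \<Longrightarrow> x \<in> l2_space m"
  by (simp add: H_iff)

lemma cls_H: "f \<in> A \<Longrightarrow> cls f \<in> H"
  using cls_space L.mdist_zero by (auto simp: H_iff intro!: bexI[of _ f])

lemma H_approx:
  assumes "x \<in> H" "e > 0"
  obtains f where "f \<in> A" "d x (cls f) < e"
  using assms by (auto simp: H_iff)

lemma H_add:
  assumes "x \<in> H" "y \<in> H"
  shows "l2_add m x y \<in> H"
  unfolding H_iff
proof (intro conjI allI impI)
  show "l2_add m x y \<in> l2_space m" using assms by (intro l2_add_space H_space)
  fix e :: real assume "e > 0"
  then have e: "e / 2 > 0" by simp
  obtain f where f: "f \<in> A" "d x (cls f) < e / 2" using assms(1) e by (rule H_approx)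
  obtain h where h: "h \<in> A" "d y (cls h) < e / 2" using assms(2) e by (rule H_approx)
  have "d (l2_add m x y) (cls (f + h)) < e"
    using l2_dist_add_le[OF H_space[OF assms(1)] H_space[OF assms(2)] cls_space[of f] cls_space[of h]] f h
    by (simp add: cls_add)
  with f h show "\<exists>f\<in>A. d (l2_add m x y) (cls f) < e" using add_A by blast
qed

lemma H_scale:
  assumes "x \<in> H"
  shows "l2_scale m c x \<in> H"
  unfolding H_iff
proof (intro conjI allI impI)
  show "l2_scale m c x \<in> l2_space m" using assms by (intro l2_scale_space H_space)
  fix e :: real assume e: "e > 0"
  \<comment> \<open>The added 1 allows \<open>c = 0\<close>.\<close>
  then have e': "e / (cmod c + 1) > 0" by (simp add: add_nonneg_pos)
  obtain f where f: "f \<in> A" "d x (cls f) < e / (cmod c + 1)" using assms(1) e' by (rule H_approx)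
  have "d (l2_scale m c x) (cls (const_bcontfun c * f)) = cmod c * d x (cls f)"
    using l2_dist_scale[OF H_space[OF assms] cls_space[of f]] by (simp add: cls_scale)
  also have "\<dots> \<le> (cmod c + 1) * d x (cls f)" by (intro mult_right_mono) auto
  also have "\<dots> < (cmod c + 1) * (e / (cmod c + 1))"
    using f(2) by (intro mult_strict_left_mono) (auto simp: add_nonneg_pos)
  also have "\<dots> = e" using norm_ge_zero[of c] by (simp add: field_simps add_nonneg_eq_0_iff)
  finally show "\<exists>f\<in>A. d (l2_scale m c x) (cls f) < e" using f(1) const_A mult_A by blast
qed

lemma topspace_H: "topspace (H2_topology A m) = H"
  using H_space by (auto simp: l2_topology_eq)

lemma Hausdorff_H: "Hausdorff_space (H2_topology A m)"
  unfolding l2_topology_eq by (intro Hausdorff_space_subtopology L.Hausdorff_space_mtopology)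

section \<open>Extension to the Hardy space\<close>

text \<open>The operator is an average over a measure of mass at most 4. Independence of
  \<open>\<phi>\<close> is what makes the whole family equicontinuous in L2.\<close>

lemma N_conv_op_le:
  assumes \<phi>: "\<phi> \<in> mult_functionals A" and f: "f \<in> A"
  shows "N (conv_op \<phi> f) \<le> 4 * N f"
proof -
  obtain \<mu> where \<mu>: "measure_extends A \<mu> \<phi>" "mass \<mu> \<le> 4" by (rule mult_functional_measure[OF \<phi>])
  then have fb: "finite_borel \<mu>" by (auto simp: measure_extends_def intro: regular_imp_finite_borel)
  have "conv_op \<phi> f = average \<mu> f"
    unfolding average_def by (rule conv_op_eq_integral[OF mult_functional_dual[OF \<phi>] f \<mu>(1)])
  then have "N (conv_op \<phi> f) \<le> mass \<mu> * N f" using N_average_le[OF fb] by simp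
  also have "\<dots> \<le> 4 * N f" using \<mu>(2) by (intro mult_right_mono N_nonneg)
  finally show ?thesis .
qed

lemma d_conv_op_le:
  assumes \<phi>: "\<phi> \<in> mult_functionals A" and f: "f \<in> A" and h: "h \<in> A"
  shows "d (cls (conv_op \<phi> f)) (cls (conv_op \<phi> h)) \<le> 4 * d (cls f) (cls h)"
  using N_conv_op_le[OF \<phi> diff_A[OF f h]]
  by (simp add: d_cls conv_op_diff[OF mult_functional_dual[OF \<phi>] f h])

text \<open>Continuous maps into a Hausdorff space that agree on a dense set are equal.\<close>

lemma continuous_extension_unique:
  assumes S: "continuous_extension A m S T" and T: "continuous_extension A m S T'"
  shows "T = T'"
proof (rule extensionalityI[of _ H])
  show "T \<in> extensional H" "T' \<in> extensional H" using assms by (auto simp: continuous_extension_def)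
  fix x assume x: "x \<in> H"
  have "cls ` A \<subseteq> H" using cls_H by auto
  then have "x \<in> (H2_topology A m) closure_of (cls ` A)"
    unfolding closure_of_subtopology using x by (simp only: Int_absorb1 H_closure[symmetric])
  then show "T x = T' x"
    by (rule forall_in_closure_of_eq[OF _ Hausdorff_H])
      (use assms in \<open>auto simp: continuous_extension_def cls_def\<close>)
qed

text \<open>A Lipschitz map on the image of \<open>A\<close> into the complete space L2 extends to
  the closure; invariance of H2 and the constant 4 are then recovered by approximation.\<close>

lemma exists_extension:
  assumes \<phi>: "\<phi> \<in> mult_functionals A"
  shows "\<exists>T. continuous_extension A m (R_op A \<phi>) T \<and> T \<in> H \<rightarrow> H \<and> (\<forall>x\<in>H. \<forall>y\<in>H. d (T x) (T y) \<le> 4 * d x y)"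
proof -
  let ?m = "metric (l2_space m, d)" and ?S = "cls ` A"
  \<comment> \<open>The operator is well defined on classes because a class contains at most one
    continuous function.\<close>
  define t where "t X = cls (conv_op \<phi> (inv_into A cls X))" for X
  have t: "t (cls f) = cls (conv_op \<phi> f)" if "f \<in> A" for f
    using that cls_inj by (simp add: t_def inv_into_f_f inj_on_def)
  have "Lipschitz_continuous_map (submetric ?m ?S) ?m t"
    unfolding Lipschitz_continuous_map_def
  proof (intro conjI exI[of _ 4] ballI)
    show "t \<in> mspace (submetric ?m ?S) \<rightarrow> mspace ?m" using cls_space by (auto simp: t_def)
    fix x y assume "x \<in> mspace (submetric ?m ?S)" "y \<in> mspace (submetric ?m ?S)"
    then show "mdist ?m (t x) (t y) \<le> 4 * mdist (submetric ?m ?S) x y"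
      using d_conv_op_le[OF \<phi>] by (auto simp: t)
  qed
  moreover have "mcomplete_of ?m" by (simp add: l2_mcomplete)
  ultimately obtain g where g: "Lipschitz_continuous_map (submetric ?m (mtopology_of ?m closure_of ?S)) ?m g"
    "\<And>x. x \<in> ?S \<Longrightarrow> g x = t x"
    using Lipschitz_continuous_map_extends_to_closure_of by blast
  have top: "mtopology_of ?m = l2_topology m" by (simp add: mtopology_of_def l2_topology_eq)
  have Heq: "mtopology_of ?m closure_of ?S = H" by (simp only: top H_closure)
  have ms: "mspace (submetric ?m H) = H" using H_space by auto
  have gl: "Lipschitz_continuous_map (submetric ?m H) ?m g" using g(1) by (simp only: Heq)
  then obtain B where B: "B > 0" "\<And>x y. x \<in> H \<Longrightarrow> y \<in> H \<Longrightarrow> d (g x) (g y) \<le> B * d x y"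
    and gs: "\<And>x. x \<in> H \<Longrightarrow> g x \<in> l2_space m"
    unfolding Lipschitz_continuous_map_pos ms by (auto simp: Pi_iff)
  have gc: "g (cls f) = cls (conv_op \<phi> f)" if "f \<in> A" for f using g(2) t that by simp
  have cA: "conv_op \<phi> f \<in> A" if "f \<in> A" for f using conv_op_A[OF mult_functional_dual[OF \<phi>] that] .
  have gH: "g x \<in> H" if x: "x \<in> H" for x
    unfolding H_iff
  proof (intro conjI allI impI gs[OF x])
    fix e :: real assume "e > 0"
    then have "e / B > 0" using B by simp
    then obtain f where f: "f \<in> A" "d x (cls f) < e / B" by (rule H_approx[OF x])
    have "d (g x) (cls (conv_op \<phi> f)) \<le> B * d x (cls f)" using B(2)[OF x cls_H[OF f(1)]] gc[OF f(1)] by simp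
    also have "\<dots> < e" using f(2) B(1) by (simp add: field_simps)
    finally show "\<exists>f\<in>A. d (g x) (cls f) < e" using cA[OF f(1)] by blast
  qed
  \<comment> \<open>The extension theorem supplies some constant \<open>B\<close>; the uniform
    constant 4 has to be carried over from \<open>A\<close>.\<close>
  have lip: "d (g x) (g y) \<le> 4 * d x y" if x: "x \<in> H" and y: "y \<in> H" for x y
  proof (rule field_le_epsilon)
    fix e :: real assume e: "e > 0"
    \<comment> \<open>Passing to \<open>f\<close> and \<open>h\<close> costs \<open>B * k\<close> at
      each of the two images and \<open>4 * k\<close> at each of the two points.\<close>
    define k where "k = e / (2 * B + 8)"
    have "(2 * B + 8) * k = e" "k > 0" using e B(1) by (auto simp: k_def)
    then have k: "k > 0" "2 * B * k + 8 * k = e" by (simp_all add: algebra_simps)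
    obtain f where f: "f \<in> A" "d x (cls f) < k" by (rule H_approx[OF x k(1)])
    obtain h where h: "h \<in> A" "d y (cls h) < k" by (rule H_approx[OF y k(1)])
    have fH: "cls f \<in> H" "cls h \<in> H" using f h by (auto intro: cls_H)
    have "d (g x) (g y) \<le> d (g x) (g (cls f)) + (d (g (cls f)) (g (cls h)) + d (g (cls h)) (g y))"
      using gs x y fH L.triangle[of "g x" "g (cls f)" "g y"] L.triangle[of "g (cls f)" "g (cls h)" "g y"] by simp
    moreover have "d (g x) (g (cls f)) \<le> B * k"
      by (rule order_trans[OF B(2)[OF x fH(1)] mult_left_mono]) (use f(2) B(1) in auto)
    moreover have "d (g (cls h)) (g y) \<le> B * k"
      by (rule order_trans[OF B(2)[OF fH(2) y] mult_left_mono]) (use h(2) B(1) in \<open>auto simp: L.commute\<close>)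
    moreover have "d (g (cls f)) (g (cls h)) \<le> 4 * d (cls f) (cls h)"
      using d_conv_op_le[OF \<phi> f(1) h(1)] by (simp add: gc f h)
    moreover have "d (cls f) (cls h) \<le> d x (cls f) + (d x y + d y (cls h))"
      using L.triangle[of "cls f" x "cls h"] L.triangle[of x y "cls h"] H_space[OF x] H_space[OF y] cls_space
      by (simp add: L.commute)
    ultimately show "d (g x) (g y) \<le> 4 * d x y + e" using f(2) h(2) k(2) by (simp add: algebra_simps)
  qed
  have "continuous_map (H2_topology A m) (l2_topology m) g"
    using Lipschitz_continuous_imp_continuous_map[OF gl] by (simp add: mtopology_of_submetric l2_topology_eq)
  then have "continuous_map (H2_topology A m) (l2_topology m) (restrict g H)"
    by (rule continuous_map_eq) (simp add: topspace_H)
  then have "continuous_map (H2_topology A m) (H2_topology A m) (restrict g H)"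
    unfolding continuous_map_in_subtopology topspace_H using gH by auto
  moreover have "restrict g H (cls f) = cls (R_op A \<phi> f)" if "f \<in> A" for f
    using that by (simp add: cls_H gc R_op_eq[OF mult_functional_dual[OF \<phi>]])
  ultimately have "continuous_extension A m (R_op A \<phi>) (restrict g H)"
    by (simp add: continuous_extension_def cls_def)
  then show ?thesis using gH lip by (intro exI[of _ "restrict g H"]) auto
qed

abbreviation "RH \<equiv> R_H2 A m"

lemma ex1_extension: "\<phi> \<in> mult_functionals A \<Longrightarrow> \<exists>!T. continuous_extension A m (R_op A \<phi>) T"
  using exists_extension continuous_extension_unique by blast

lemma RH_eq: "\<phi> \<in> mult_functionals A \<Longrightarrow> continuous_extension A m (R_op A \<phi>) T \<Longrightarrow> RH \<phi> = T"
  unfolding R_H2_def using continuous_extension_unique by (intro the_equality)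

lemma RH_extension:
  assumes \<phi>: "\<phi> \<in> mult_functionals A"
  shows "continuous_extension A m (R_op A \<phi>) (RH \<phi>)" "x \<in> H \<Longrightarrow> RH \<phi> x \<in> H"
    "x \<in> H \<Longrightarrow> y \<in> H \<Longrightarrow> d (RH \<phi> x) (RH \<phi> y) \<le> 4 * d x y"
    "RH \<phi> \<in> extensional H"
    "f \<in> A \<Longrightarrow> RH \<phi> (cls f) = cls (conv_op \<phi> f)"
proof -
  obtain T where T: "continuous_extension A m (R_op A \<phi>) T" "T \<in> H \<rightarrow> H" "\<forall>x\<in>H. \<forall>y\<in>H. d (T x) (T y) \<le> 4 * d x y"
    using exists_extension[OF \<phi>] by blast
  with RH_eq[OF \<phi> T(1)] show "continuous_extension A m (R_op A \<phi>) (RH \<phi>)" "x \<in> H \<Longrightarrow> RH \<phi> x \<in> H"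
    "x \<in> H \<Longrightarrow> y \<in> H \<Longrightarrow> d (RH \<phi> x) (RH \<phi> y) \<le> 4 * d x y"
    by auto
  then show "RH \<phi> \<in> extensional H" "f \<in> A \<Longrightarrow> RH \<phi> (cls f) = cls (conv_op \<phi> f)"
    by (auto simp: continuous_extension_def cls_def R_op_eq[OF mult_functional_dual[OF \<phi>]])
qed

text \<open>Density arguments leave an error \<open>C * e\<close> for every \<open>e\<close>; the
  factor is absorbed here once and for all.\<close>

lemma l2_eqI:
  assumes "x \<in> l2_space m" "y \<in> l2_space m" "\<And>e. e > 0 \<Longrightarrow> d x y \<le> C * e"
  shows "x = y"
proof -
  have "d x y \<le> 0 + e" if e: "e > 0" for e
  proof -
    have k: "0 < e / (\<bar>C\<bar> + 1)" using e by (simp add: add_nonneg_pos)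
    then have "d x y \<le> C * (e / (\<bar>C\<bar> + 1))" by (rule assms(3))
    also have "\<dots> \<le> (\<bar>C\<bar> + 1) * (e / (\<bar>C\<bar> + 1))" using k by (intro mult_right_mono) auto
    also have "\<dots> = e" using abs_ge_zero[of C] by simp
    finally show ?thesis by simp
  qed
  then have "d x y \<le> 0" by (rule field_le_epsilon)
  then have "d x y = 0" by (rule antisym[OF _ L.nonneg])
  with assms show ?thesis by simp
qed

text \<open>The linear laws hold on the image of \<open>A\<close> by \<open>conv_op_add\<close> and
  \<open>conv_op_scale\<close>, and pass to H2 because all the maps involved are Lipschitz.\<close>

lemma RH_BL:
  assumes \<phi>: "\<phi> \<in> mult_functionals A"
  shows "RH \<phi> \<in> BL_H2 A m"
proof -
  note R = RH_extension[OF \<phi>]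
  note dual = mult_functional_dual[OF \<phi>]
  have add: "RH \<phi> (l2_add m x y) = l2_add m (RH \<phi> x) (RH \<phi> y)" if x: "x \<in> H" and y: "y \<in> H" for x y
  \<comment> \<open>Each of the two comparisons with \<open>?z\<close> costs 4 times
    \<open>d x (cls f) + d y (cls h)\<close>, that is, at most \<open>8 * e\<close>.\<close>
  proof (rule l2_eqI[of _ _ 16])
    show "RH \<phi> (l2_add m x y) \<in> l2_space m" "l2_add m (RH \<phi> x) (RH \<phi> y) \<in> l2_space m"
      using x y by (auto intro!: H_space R(2) H_add)
    fix e :: real assume e: "e > 0"
    obtain f where f: "f \<in> A" "d x (cls f) < e" by (rule H_approx[OF x e])
    obtain h where h: "h \<in> A" "d y (cls h) < e" by (rule H_approx[OF y e])
    let ?z = "RH \<phi> (cls (f + h))"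
    have z: "?z = l2_add m (RH \<phi> (cls f)) (RH \<phi> (cls h))"
      using f h by (simp add: R(5) add_A conv_op_add[OF dual] cls_add)
    have "d (RH \<phi> (l2_add m x y)) ?z \<le> 4 * d (l2_add m x y) (cls (f + h))"
      using x y f h by (intro R(3) H_add cls_H add_A)
    moreover have "d (l2_add m x y) (cls (f + h)) \<le> d x (cls f) + d y (cls h)"
      using l2_dist_add_le[OF H_space[OF x] H_space[OF y] cls_space[of f] cls_space[of h]] by (simp add: cls_add)
    moreover have "d ?z (l2_add m (RH \<phi> x) (RH \<phi> y)) \<le> d (RH \<phi> (cls f)) (RH \<phi> x) + d (RH \<phi> (cls h)) (RH \<phi> y)"
      unfolding z using x y f h by (intro l2_dist_add_le H_space R(2) cls_H)
    moreover have "d (RH \<phi> (cls f)) (RH \<phi> x) \<le> 4 * d x (cls f)" "d (RH \<phi> (cls h)) (RH \<phi> y) \<le> 4 * d y (cls h)"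
      using R(3)[OF cls_H[OF f(1)] x] R(3)[OF cls_H[OF h(1)] y] by (simp_all add: L.commute)
    moreover have "d (RH \<phi> (l2_add m x y)) (l2_add m (RH \<phi> x) (RH \<phi> y)) \<le>
        d (RH \<phi> (l2_add m x y)) ?z + d ?z (l2_add m (RH \<phi> x) (RH \<phi> y))"
      using x y f h by (intro L.triangle l2_add_space H_space R(2) H_add cls_H add_A)
    ultimately show "d (RH \<phi> (l2_add m x y)) (l2_add m (RH \<phi> x) (RH \<phi> y)) \<le> 16 * e"
      using f(2) h(2) by linarith
  qed
  have scale: "RH \<phi> (l2_scale m c x) = l2_scale m c (RH \<phi> x)" if x: "x \<in> H" for c x
  proof (rule l2_eqI[of _ _ "8 * cmod c"])
    show "RH \<phi> (l2_scale m c x) \<in> l2_space m" "l2_scale m c (RH \<phi> x) \<in> l2_space m"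
      using x by (auto intro!: H_space R(2) H_scale)
    fix e :: real assume e: "e > 0"
    obtain f where f: "f \<in> A" "d x (cls f) < e" by (rule H_approx[OF x e])
    let ?z = "RH \<phi> (cls (const_bcontfun c * f))"
    have z: "?z = l2_scale m c (RH \<phi> (cls f))"
      using f by (simp add: R(5) mult_A const_A conv_op_scale[OF dual] cls_scale)
    have "d (RH \<phi> (l2_scale m c x)) ?z \<le> 4 * d (l2_scale m c x) (cls (const_bcontfun c * f))"
      using x f by (intro R(3) H_scale cls_H mult_A const_A)
    also have "d (l2_scale m c x) (cls (const_bcontfun c * f)) = cmod c * d x (cls f)"
      using l2_dist_scale[OF H_space[OF x] cls_space[of f]] by (simp add: cls_scale)
    finally have 1: "d (RH \<phi> (l2_scale m c x)) ?z \<le> 4 * (cmod c * d x (cls f))" .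
    have "d ?z (l2_scale m c (RH \<phi> x)) = cmod c * d (RH \<phi> (cls f)) (RH \<phi> x)"
      unfolding z using x f by (intro l2_dist_scale H_space R(2) cls_H)
    also have "\<dots> \<le> cmod c * (4 * d x (cls f))"
      using R(3)[OF cls_H[OF f(1)] x] by (intro mult_left_mono) (simp_all add: L.commute)
    finally have 2: "d ?z (l2_scale m c (RH \<phi> x)) \<le> 4 * (cmod c * d x (cls f))" by simp
    have 3: "cmod c * d x (cls f) \<le> cmod c * e" using f(2) by (intro mult_left_mono) auto
    have "d (RH \<phi> (l2_scale m c x)) (l2_scale m c (RH \<phi> x)) \<le>
        d (RH \<phi> (l2_scale m c x)) ?z + d ?z (l2_scale m c (RH \<phi> x))"
      using x f by (intro L.triangle l2_scale_space H_space R(2) H_scale cls_H mult_A const_A)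
    with 1 2 3 show "d (RH \<phi> (l2_scale m c x)) (l2_scale m c (RH \<phi> x)) \<le> 8 * cmod c * e" by linarith
  qed
  have z: "RH \<phi> (cls 0) = cls 0"
    using conv_op_diff[OF dual zero_A zero_A] by (simp add: R(5) zero_A)
  \<comment> \<open>The norm is the distance to the class of zero, which is fixed, so the Lipschitz
    constant bounds the operator.\<close>
  have "l2_norm m (RH \<phi> x) \<le> 4 * l2_norm m x" if x: "x \<in> H" for x
    using R(3)[OF x cls_H[OF zero_A]] l2_norm_dist[OF H_space[OF x]] l2_norm_dist[OF H_space[OF R(2)[OF x]]]
    by (simp add: z cls_zero[symmetric])
  then have "\<exists>K. \<forall>x\<in>H. l2_norm m (RH \<phi> x) \<le> K * l2_norm m x" by blast
  then show ?thesis
    using R(2,4) add scale by (auto simp: bounded_ops_def PiE_def)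
qed

section \<open>The involution\<close>

text \<open>\<open>fun_star\<close> respects sums and pointwise products and conjugates scalars; the
  outer conjugation restores linearity. \<open>fun_star_A\<close> keeps the argument of
  \<open>\<phi>\<close> inside \<open>A\<close>.\<close>

lemma functional_star_mult:
  assumes \<phi>: "\<phi> \<in> mult_functionals A"
  shows "functional_star A \<phi> \<in> mult_functionals A"
proof -
  note dual = mult_functional_dual[OF \<phi>]
  have star: "fun_star (f + h) = fun_star f + fun_star h" "fun_star (f * h) = fun_star f * fun_star h"
    "fun_star (const_bcontfun c) = const_bcontfun (cnj c)" for f h :: "'g \<Rightarrow>\<^sub>C complex" and c
    by (rule bcontfun_eqI; simp add: fun_star.rep_eq)+
  have "functional_star A \<phi> (const_bcontfun 1) \<noteq> 0"
    by (simp add: functional_star_def const_A star mult_functional_one[OF \<phi>])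
  moreover have "functional_star A \<phi> (const_bcontfun c * f) = c * functional_star A \<phi> f" if "f \<in> A" for c f
    using that by (simp add: functional_star_def mult_A const_A star dual_scale[OF dual] fun_star_A)
  moreover have "functional_star A \<phi> (f + h) = functional_star A \<phi> f + functional_star A \<phi> h"
    "functional_star A \<phi> (f * h) = functional_star A \<phi> f * functional_star A \<phi> h" if "f \<in> A" "h \<in> A" for f h
    using that by (simp_all add: functional_star_def mult_A add_A star dual_add[OF dual] mult_functional_mult[OF \<phi>] fun_star_A)
  moreover have "functional_star A \<phi> \<in> extensional A" by (simp add: functional_star_def)
  ultimately show ?thesis
    unfolding mult_functionals_def linear_functional_def using const_A[of 1] by blast
qed

text \<open>A measure that represents \<open>\<phi>\<close> also computes
  \<open>conv_op (functional_star A \<phi>)\<close>, namely through \<open>adj_average\<close>, so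
  the claim reduces to \<open>average_adjoint\<close>.\<close>

lemma conv_op_adjoint:
  assumes \<phi>: "\<phi> \<in> mult_functionals A" and f: "f \<in> A" and h: "h \<in> A"
  shows "(LINT x|m. conv_op \<phi> f x * cnj (apply_bcontfun h x)) =
    (LINT x|m. apply_bcontfun f x * cnj (conv_op (functional_star A \<phi>) h x))"
proof -
  obtain \<mu> where \<mu>: "measure_extends A \<mu> \<phi>" using dual_measure[OF mult_functional_dual[OF \<phi>]] .
  then have fb: "finite_borel \<mu>" by (auto simp: measure_extends_def intro: regular_imp_finite_borel)
  have "conv_op (functional_star A \<phi>) h = adj_average \<mu> h"
  proof (rule bcontfun_eqI)
    fix x
    have "apply_bcontfun (conv_op (functional_star A \<phi>) h) x = functional_star A \<phi> (left_trans x h)"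
      by (rule conv_op_apply[OF mult_functional_dual[OF functional_star_mult[OF \<phi>]] h])
    also have "\<dots> = cnj (\<phi> (fun_star (left_trans x h)))"
      using left_A[OF h] by (simp add: functional_star_def)
    also have "\<phi> (fun_star (left_trans x h)) = complex_measure_integral \<mu> (fun_star (left_trans x h))"
      using \<mu> fun_star_A[OF left_A[OF h]] by (simp add: measure_extends_def)
    also have "cnj \<dots> = apply_bcontfun (adj_average \<mu> h) x"
      by (simp add: adj_average_apply[OF fb] fun_star.rep_eq[abs_def] left_trans.rep_eq)
    finally show "apply_bcontfun (conv_op (functional_star A \<phi>) h) x = apply_bcontfun (adj_average \<mu> h) x" .
  qed
  moreover have "conv_op \<phi> f = average \<mu> f"
    unfolding average_def by (rule conv_op_eq_integral[OF mult_functional_dual[OF \<phi>] f \<mu>])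
  ultimately show ?thesis using average_adjoint[OF fb] by simp
qed

lemma le_mult_all_imp_zero:
  fixes z :: complex
  assumes "\<And>e. e > 0 \<Longrightarrow> cmod z \<le> C * e"
  shows "z = 0"
proof (rule ccontr)
  assume "z \<noteq> 0"
  then have "0 < cmod z / (2 * (\<bar>C\<bar> + 1))" by (simp add: add_nonneg_pos)
  from assms[OF this] have "cmod z \<le> \<bar>C\<bar> * (cmod z / (2 * (\<bar>C\<bar> + 1)))"
    by (rule order_trans) (intro mult_right_mono, auto)
  also have "\<dots> \<le> (\<bar>C\<bar> + 1) * (cmod z / (2 * (\<bar>C\<bar> + 1)))" by (intro mult_right_mono) auto
  also have "\<dots> = cmod z / 2" by (simp add: field_simps add_nonneg_eq_0_iff)
  finally show False using \<open>z \<noteq> 0\<close> by simp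
qed

text \<open>The identity extends from \<open>A\<close> by density in one argument at a time, first
  \<open>y\<close> and then \<open>x\<close>, since the inner product is Lipschitz in each argument
  with the norm of the other as constant.\<close>

lemma RH_adjoint:
  assumes \<phi>: "\<phi> \<in> mult_functionals A" and x: "x \<in> H" and y: "y \<in> H"
  shows "l2_inner m (RH \<phi> x) y = l2_inner m x (RH (functional_star A \<phi>) y)"
proof -
  note R = RH_extension[OF \<phi>] and R' = RH_extension[OF functional_star_mult[OF \<phi>]]
  let ?s = "RH (functional_star A \<phi>)"
  have base: "l2_inner m (RH \<phi> (cls f)) (cls h) = l2_inner m (cls f) (?s (cls h))" if "f \<in> A" "h \<in> A" for f h
    using conv_op_adjoint[OF \<phi> that] that
    by (simp add: R(5) R'(5)) (simp add: cls_def l2_inner_class bcontfun_sq)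
  have step: "l2_inner m (RH \<phi> (cls f)) y = l2_inner m (cls f) (?s y)" if f: "f \<in> A" for f
  proof -
    have "l2_inner m (RH \<phi> (cls f)) y - l2_inner m (cls f) (?s y) = 0"
    proof (rule le_mult_all_imp_zero)
      fix e :: real assume e: "e > 0"
      obtain h where h: "h \<in> A" "d y (cls h) < e" by (rule H_approx[OF y e])
      have 1: "cmod (l2_inner m (RH \<phi> (cls f)) y - l2_inner m (RH \<phi> (cls f)) (cls h)) \<le> d y (cls h) * l2_norm m (RH \<phi> (cls f))"
        using f h y by (intro l2_inner_diff_right H_space R(2) cls_H)
      have 2: "cmod (l2_inner m (cls f) (?s (cls h)) - l2_inner m (cls f) (?s y)) \<le> d (?s (cls h)) (?s y) * l2_norm m (cls f)"
        using f h y by (intro l2_inner_diff_right H_space R'(2) cls_H)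
      have 3: "d y (cls h) * l2_norm m (RH \<phi> (cls f)) \<le> e * l2_norm m (RH \<phi> (cls f))"
        using h(2) by (intro mult_right_mono) (auto simp: l2_norm_def)
      have "d (?s (cls h)) (?s y) \<le> 4 * d y (cls h)" using R'(3)[OF cls_H[OF h(1)] y] by (simp add: L.commute)
      then have 4: "d (?s (cls h)) (?s y) * l2_norm m (cls f) \<le> (4 * e) * l2_norm m (cls f)"
        using h(2) by (intro mult_right_mono) (auto simp: l2_norm_def)
      have "l2_inner m (RH \<phi> (cls f)) y - l2_inner m (cls f) (?s y) =
        (l2_inner m (RH \<phi> (cls f)) y - l2_inner m (RH \<phi> (cls f)) (cls h)) +
        (l2_inner m (cls f) (?s (cls h)) - l2_inner m (cls f) (?s y))" using base[OF f h(1)] by simp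
      then have "cmod (l2_inner m (RH \<phi> (cls f)) y - l2_inner m (cls f) (?s y)) \<le>
        cmod (l2_inner m (RH \<phi> (cls f)) y - l2_inner m (RH \<phi> (cls f)) (cls h)) +
        cmod (l2_inner m (cls f) (?s (cls h)) - l2_inner m (cls f) (?s y))" by (simp only: norm_triangle_ineq)
      with 1 2 3 4 show "cmod (l2_inner m (RH \<phi> (cls f)) y - l2_inner m (cls f) (?s y)) \<le>
         (l2_norm m (RH \<phi> (cls f)) + 4 * l2_norm m (cls f)) * e" by (simp add: algebra_simps)
    qed
    then show ?thesis by simp
  qed
  have "l2_inner m (RH \<phi> x) y - l2_inner m x (?s y) = 0"
  proof (rule le_mult_all_imp_zero)
    fix e :: real assume e: "e > 0"
    obtain f where f: "f \<in> A" "d x (cls f) < e" by (rule H_approx[OF x e])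
    have 1: "cmod (l2_inner m (RH \<phi> x) y - l2_inner m (RH \<phi> (cls f)) y) \<le> d (RH \<phi> x) (RH \<phi> (cls f)) * l2_norm m y"
      using f x y by (intro l2_inner_diff_left H_space R(2) cls_H)
    have 2: "cmod (l2_inner m (cls f) (?s y) - l2_inner m x (?s y)) \<le> d (cls f) x * l2_norm m (?s y)"
      using f x y by (intro l2_inner_diff_left H_space R'(2) cls_H)
    have "d (RH \<phi> x) (RH \<phi> (cls f)) \<le> 4 * d x (cls f)" using x f by (intro R(3) cls_H)
    then have 3: "d (RH \<phi> x) (RH \<phi> (cls f)) * l2_norm m y \<le> (4 * e) * l2_norm m y"
      using f(2) by (intro mult_right_mono) (auto simp: l2_norm_def)
    have 4: "d (cls f) x * l2_norm m (?s y) \<le> e * l2_norm m (?s y)"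
      using f(2) by (intro mult_right_mono) (auto simp: l2_norm_def L.commute)
    have "l2_inner m (RH \<phi> x) y - l2_inner m x (?s y) =
      (l2_inner m (RH \<phi> x) y - l2_inner m (RH \<phi> (cls f)) y) +
      (l2_inner m (cls f) (?s y) - l2_inner m x (?s y))" using step[OF f(1)] by simp
    then have "cmod (l2_inner m (RH \<phi> x) y - l2_inner m x (?s y)) \<le>
      cmod (l2_inner m (RH \<phi> x) y - l2_inner m (RH \<phi> (cls f)) y) +
      cmod (l2_inner m (cls f) (?s y) - l2_inner m x (?s y))" by (simp only: norm_triangle_ineq)
    with 1 2 3 4 show "cmod (l2_inner m (RH \<phi> x) y - l2_inner m x (?s y)) \<le> (4 * l2_norm m y + l2_norm m (?s y)) * e"
      by (simp add: algebra_simps)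
  qed
  then show ?thesis by simp
qed

lemma RH_star:
  assumes \<phi>: "\<phi> \<in> mult_functionals A"
  shows "RH (functional_star A \<phi>) = H2_adjoint A m (RH \<phi>)"
  unfolding H2_adjoint_def
proof (rule the_equality[symmetric])
  let ?s = "RH (functional_star A \<phi>)"
  show "?s \<in> BL_H2 A m \<and> (\<forall>x\<in>H. \<forall>y\<in>H. l2_inner m (RH \<phi> x) y = l2_inner m x (?s y))"
    using RH_BL[OF functional_star_mult[OF \<phi>]] RH_adjoint[OF \<phi>] by blast
  fix S assume S: "S \<in> BL_H2 A m \<and> (\<forall>x\<in>H. \<forall>y\<in>H. l2_inner m (RH \<phi> x) y = l2_inner m x (S y))"
  show "S = ?s"
  proof (rule extensionalityI[of _ H])
    show "S \<in> extensional H" using S by (simp add: bounded_ops_def PiE_def)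
    show "?s \<in> extensional H" using RH_extension(4)[OF functional_star_mult[OF \<phi>]] .
    fix y assume y: "y \<in> H"
    have H: "S y \<in> H" "?s y \<in> H"
      using S y RH_extension(2)[OF functional_star_mult[OF \<phi>] y] by (auto simp: bounded_ops_def)
    have eq: "l2_inner m x (S y) = l2_inner m x (?s y)" if "x \<in> H" for x
      using S RH_adjoint[OF \<phi> that y] that y by simp
    \<comment> \<open>Both \<open>S y\<close> and \<open>?s y\<close> lie in H2, so
      \<open>eq\<close> may be used with either as \<open>x\<close>; the four terms cancel.\<close>
    have "complex_of_real ((d (S y) (?s y))\<^sup>2) = 0"
      unfolding l2_dist_power2[OF H_space[OF H(1)] H_space[OF H(2)]] eq[OF H(1)] eq[OF H(2)] by simp
    then have "d (S y) (?s y) = 0" by simp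
    then show "S y = ?s y" using H H_space by simp
  qed
qed

text \<open>By \<open>R_op_convolution\<close> both sides extend the same operator on
  \<open>A\<close> continuously, so uniqueness of the extension decides.\<close>

lemma RH_convolution:
  assumes \<phi>: "\<phi> \<in> mult_functionals A" and \<psi>: "\<psi> \<in> mult_functionals A"
  shows "RH (convolution A \<phi> \<psi>) = compose H (RH \<phi>) (RH \<psi>)"
proof (rule RH_eq[OF convolution_mult_functional[OF \<phi> \<psi>]])
  have "continuous_map (H2_topology A m) (H2_topology A m) (RH \<phi> \<circ> RH \<psi>)"
    using RH_extension(1)[OF \<phi>] RH_extension(1)[OF \<psi>]
    by (intro continuous_map_compose) (auto simp: continuous_extension_def)
  then have "continuous_map (H2_topology A m) (H2_topology A m) (compose H (RH \<phi>) (RH \<psi>))"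
    by (rule continuous_map_eq) (simp add: topspace_H compose_def)
  moreover have "compose H (RH \<phi>) (RH \<psi>) (cls f) = cls (R_op A (convolution A \<phi> \<psi>) f)" if "f \<in> A" for f
    using that conv_op_A[OF mult_functional_dual[OF \<psi>] that]
    by (simp add: compose_def cls_H RH_extension(5) \<phi> \<psi> R_op_convolution R_op_eq mult_functional_dual)
  ultimately show "continuous_extension A m (R_op A (convolution A \<phi> \<psi>)) (compose H (RH \<phi>) (RH \<psi>))"
    by (simp add: continuous_extension_def cls_def compose_def)
qed

lemma RH_continuous:
  assumes x: "x \<in> H"
  shows "continuous_map (weak_star_topology A) (H2_topology A m) (\<lambda>\<phi>. RH \<phi> x)"
  unfolding continuous_map_in_subtopology topspace_weak_star l2_topology_eq L.continuous_map_to_metric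
proof (intro conjI ballI allI impI)
  show "(\<lambda>\<phi>. RH \<phi> x) \<in> mult_functionals A \<rightarrow> H" using RH_extension(2) x by blast
  fix \<phi> and e :: real assume \<phi>: "\<phi> \<in> mult_functionals A" and e: "0 < e"
  \<comment> \<open>Replacing \<open>x\<close> by \<open>cls f\<close> costs at most
    \<open>4 * (e / 16)\<close> for each of the two functionals, as the Lipschitz constant does not
    depend on \<open>\<psi>\<close>; the remaining \<open>e / 2\<close> is for \<open>f\<close>
    itself.\<close>
  have "e / 16 > 0" "e / 2 > 0" using e by auto
  obtain f where f: "f \<in> A" "d x (cls f) < e / 16" by (rule H_approx[OF x \<open>e / 16 > 0\<close>])
  obtain U where U: "openin (weak_star_topology A) U" "\<phi> \<in> U"
    "\<And>\<psi>. \<psi> \<in> U \<Longrightarrow> norm (conv_op \<psi> f - conv_op \<phi> f) < e / 2"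
    using conv_op_weak_star_continuous[OF \<phi> f(1) \<open>e / 2 > 0\<close>] by blast
  have "RH \<psi> x \<in> L.mball (RH \<phi> x) e" if "\<psi> \<in> U" for \<psi>
  proof -
    have \<psi>: "\<psi> \<in> mult_functionals A" using openin_subset[OF U(1)] that by (auto simp: topspace_weak_star)
    note S = H_space[OF RH_extension(2)[OF \<phi> x]] H_space[OF RH_extension(2)[OF \<psi> x]]
    let ?f = "cls (conv_op \<phi> f)" and ?g = "cls (conv_op \<psi> f)"
    have "d (RH \<phi> x) ?f \<le> 4 * d x (cls f)" "d (RH \<psi> x) ?g \<le> 4 * d x (cls f)"
      using RH_extension(3)[OF \<phi> x cls_H[OF f(1)]] RH_extension(3)[OF \<psi> x cls_H[OF f(1)]]
      by (simp_all add: RH_extension(5) \<phi> \<psi> f)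
    moreover have "d ?g ?f < e / 2"
      using U(3)[OF that] N_le_norm[of "conv_op \<psi> f - conv_op \<phi> f"] by (simp add: d_cls)
    moreover have "d (RH \<phi> x) (RH \<psi> x) \<le> d (RH \<phi> x) ?f + (d ?g ?f + d (RH \<psi> x) ?g)"
      using L.triangle[OF S(1) cls_space[of "conv_op \<phi> f"] S(2)]
        L.triangle[OF cls_space[of "conv_op \<phi> f"] cls_space[of "conv_op \<psi> f"] S(2)]
      by (simp add: L.commute)
    ultimately have "d (RH \<phi> x) (RH \<psi> x) < e" using f(2) by linarith
    with S show ?thesis by simp
  qed
  with U(1,2) show "\<exists>U. openin (weak_star_topology A) U \<and> \<phi> \<in> U \<and> (\<forall>\<psi>\<in>U. RH \<psi> x \<in> L.mball (RH \<phi> x) e)"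
    by blast
qed

text \<open>Injectivity rests on two facts: equal operators on H2 agree on classes of elements of
  \<open>A\<close>, hence as continuous functions, and evaluation at the unit returns the
  functional.\<close>

theorem RH_embedding:
  "embedding_map (weak_star_topology A) (strong_op_topology (H2_topology A m) (BL_H2 A m)) RH"
proof (rule continuous_imp_embedding_map[OF _ compact_weak_star])
  show "continuous_map (weak_star_topology A) (strong_op_topology (H2_topology A m) (BL_H2 A m)) RH"
    unfolding strong_op_topology_def
  proof (subst continuous_map_in_subtopology, intro conjI)
    show "continuous_map (weak_star_topology A) (product_topology (\<lambda>_. H2_topology A m) (topspace (H2_topology A m))) RH"
    proof (subst continuous_map_componentwise, intro conjI ballI)
      show "RH ` topspace (weak_star_topology A) \<subseteq> extensional (topspace (H2_topology A m))"
        unfolding topspace_weak_star topspace_H using RH_extension(4) by blast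
      show "continuous_map (weak_star_topology A) (H2_topology A m) (\<lambda>\<phi>. RH \<phi> x)" if "x \<in> topspace (H2_topology A m)" for x
        using that unfolding topspace_H by (rule RH_continuous)
    qed
    show "RH \<in> topspace (weak_star_topology A) \<rightarrow> BL_H2 A m"
      unfolding topspace_weak_star using RH_BL by blast
  qed
  show "Hausdorff_space (strong_op_topology (H2_topology A m) (BL_H2 A m))"
    unfolding strong_op_topology_def
    by (intro Hausdorff_space_subtopology Hausdorff_space_product_topology[THEN iffD2] disjI2 ballI Hausdorff_H)
  show "inj_on RH (topspace (weak_star_topology A))"
    unfolding topspace_weak_star
  proof (rule inj_onI)
    fix \<phi> \<psi> assume \<phi>: "\<phi> \<in> mult_functionals A" and \<psi>: "\<psi> \<in> mult_functionals A" and eq: "RH \<phi> = RH \<psi>"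
    show "\<phi> = \<psi>"
    proof (rule extensionalityI[of _ A])
      show "\<phi> \<in> extensional A" "\<psi> \<in> extensional A"
        using dual_extensional mult_functional_dual \<phi> \<psi> by auto
      fix f assume f: "f \<in> A"
      have "cls (conv_op \<phi> f) = cls (conv_op \<psi> f)"
        using eq RH_extension(5)[OF \<phi> f] RH_extension(5)[OF \<psi> f] by simp
      then have "conv_op \<phi> f = conv_op \<psi> f" by (rule cls_inj)
      then have "apply_bcontfun (conv_op \<phi> f) 0 = apply_bcontfun (conv_op \<psi> f) 0" by simp
      then show "\<phi> f = \<psi> f" by (simp add: conv_op_apply mult_functional_dual \<phi> \<psi> f left_trans_zero)
    qed
  qed
qed

end

text \<open>\<open>homeomorphic_map\<close> includes bijectivity onto the endomorphism semigroup;
  with the composition law it is the topological isomorphism. Operators are extensional, hence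
  \<open>compose\<close> relative to \<open>A\<close> and to H2.\<close>

theorem theorem2:
  fixes A :: "('g::{topological_group_add, t2_space} \<Rightarrow>\<^sub>C complex) set"
  assumes "compact (UNIV :: 'g set)"
    and "invariant_algebra A"
  shows
    "(\<forall>\<phi>\<in>mult_functionals A. \<forall>\<psi>\<in>mult_functionals A.
        convolution A \<phi> \<psi> \<in> mult_functionals A \<and>
        R_op A (convolution A \<phi> \<psi>) = compose A (R_op A \<phi>) (R_op A \<psi>)) \<and>
     homeomorphic_map (weak_star_topology A)
       (strong_op_topology (top_of_set A) (invariant_endomorphisms A)) (R_op A) \<and>
     (\<forall>m :: 'g measure. haar_measure m \<longrightarrow>
        (\<forall>\<phi>\<in>mult_functionals A.
           (\<exists>!T. continuous_extension A m (R_op A \<phi>) T) \<and>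
           R_H2 A m \<phi> \<in> BL_H2 A m \<and>
           functional_star A \<phi> \<in> mult_functionals A \<and>
           R_H2 A m (functional_star A \<phi>) = H2_adjoint A m (R_H2 A m \<phi>)) \<and>
        (\<forall>\<phi>\<in>mult_functionals A. \<forall>\<psi>\<in>mult_functionals A.
           R_H2 A m (convolution A \<phi> \<psi>) = compose (H2 A m) (R_H2 A m \<phi>) (R_H2 A m \<psi>)) \<and>
        embedding_map (weak_star_topology A)
          (strong_op_topology (H2_topology A m) (BL_H2 A m)) (R_H2 A m))"
proof -
  interpret invariant_algebra_compact A
    using assms by unfold_locales
  have "(\<forall>\<phi>\<in>mult_functionals A.
           (\<exists>!T. continuous_extension A m (R_op A \<phi>) T) \<and>
           R_H2 A m \<phi> \<in> BL_H2 A m \<and>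
           functional_star A \<phi> \<in> mult_functionals A \<and>
           R_H2 A m (functional_star A \<phi>) = H2_adjoint A m (R_H2 A m \<phi>)) \<and>
        (\<forall>\<phi>\<in>mult_functionals A. \<forall>\<psi>\<in>mult_functionals A.
           R_H2 A m (convolution A \<phi> \<psi>) = compose (H2 A m) (R_H2 A m \<phi>) (R_H2 A m \<psi>)) \<and>
        embedding_map (weak_star_topology A)
          (strong_op_topology (H2_topology A m) (BL_H2 A m)) (R_H2 A m)"
    if "haar_measure m" for m :: "'g measure"
  proof -
    interpret invariant_algebra_haar A m
      using assms(1) that by unfold_locales
    show ?thesis
      using ex1_extension RH_BL functional_star_mult RH_star RH_convolution RH_embedding by blast
  qed
  then show ?thesis
    using convolution_mult_functional R_op_convolution homeomorphic_R_op by blast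
qed

end
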